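(* Let $h>0$ and let the data $(G,K,b,\sigma,\theta,\{X^u_0\},\{Y^u_0\})$ satisfy the conditions (RD) of the context. Let $b_m,\sigma^u_m,\theta^u_m$ and the Euler sequences $\{\bar X^u_m\}_{m\in\mathbb N}$, $\{\bar Y^u_m\}_{m\in\mathbb N}$, $u\in I$, be as defined in the context. Assume that for every $m\in\mathbb N$ and $u\in I$: (i) $b_m$ is affine in $x$; (ii) for all $x,y\in\mathbb R^d$, $r\in[0,1]$, $\boldsymbol\mu\in\mathcal H(\mathbb R^d)$: $\sigma^u_m(rx+(1-r)y,\boldsymbol\mu)\preceq r\sigma^u_m(x,\boldsymbol\mu)+(1-r)\sigma^u_m(y,\boldsymbol\mu)$; (iii) for all $x\in\mathbb R^d$ and $\boldsymbol\mu,\boldsymbol\nu\in\mathcal H(\mathbb R^d)$ with $\mu^v\preceq_{cv}\nu^v$ for all $v\in I$: $\sigma^u_m(x,\boldsymbol\mu)\preceq\sigma^u_m(x,\boldsymbol\nu)$; (iv) for all $(x,\boldsymbol\mu)\in\mathbb R^d\times\mathcal H(\mathbb R^d)$: $\sigma^u_m(x,\boldsymbol\mu)\preceq\theta^u_m(x,\boldsymbol\mu)$; (v) $\bar X^u_0\preceq_{cv}\bar Y^u_0$. Then $\bar X^u_m\preceq_{cv}\bar Y^u_m$ for all $m\in\mathbb N$ and all $u\in I$.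
   Context: Notation. $I=[0,1]$. A graphon is a symmetric measurable function $I\times I\to I$. $|\cdot|$ is the Euclidean norm; for a $d\times q$ real matrix $A\in\mathbb M^{d\times q}(\mathbb R)$, $\|A\|=\sup_{|z|\le 1}|Az|$, and $A\preceq B$ means that $BB^\top-AA^\top$ is positive semi-definite. For $\mu,\nu$ probability measures on $\mathbb R^d$ with finite first moment, $\mu\preceq_{cv}\nu$ means $\int\varphi\,d\mu\le\int\varphi\,d\nu$ for all convex $\varphi:\mathbb R^d\to\mathbb R$; for random vectors, $X\preceq_{cv}Y$ means $\mathcal L(X)\preceq_{cv}\mathcal L(Y)$. $\mathcal P_2(\mathbb R^d)$ (resp. $\mathcal M_2(\mathbb R^d)$) is the set of Borel probability (resp. finite positive Borel) measures on $\mathbb R^d$ with finite second moment; $\mathcal W_2$ is the 2-Wasserstein distance. For $\mu\in\mathcal M_2(\mathbb R^d)$ let $m_\mu=\mu(\mathbb R^d)$; fix a reference point $x_0\in\mathbb R^d$, put $\overline\mu=\mu/m_\mu$ if $m_\mu>0$ and $\overline\mu=\delta_{x_0}$ otherwise, $T_a(x)=a(x-x_0)+x_0$, and $$\mathcal{WOP}_2^2(\mu,\nu)=(m_\mu-m_\nu)^2+\mathcal W_2^2\big(T_{m_\mu}\#\overline\mu,\,T_{m_\nu}\#\overline\nu\big),$$ where $\#$ denotes pushforward. $\mathcal H(\mathbb R^d)$ is the set of families $\boldsymbol\mu=\{\mu^u\}_{u\in I}\in\mathcal P_2(\mathbb R^d)^I$ such that $u\mapsto\mu^u(B)$ is measurable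 for every Borel $B$ and $\sup_{u\in I}\int|x|^2\mu^u(dx)<\infty$. For a graphon $G$ and $\boldsymbol\mu\in\mathcal H(\mathbb R^d)$, $[G\boldsymbol\mu]^u(dx):=\int_I G(u,v)\mu^v(dx)\,dv\in\mathcal M_2(\mathbb R^d)$. $\boldsymbol\delta_0$ is the family with $\delta_0^u=\delta_0$ for all $u$. Data. $G,K$ are graphons, $b:\mathbb R_+\times\mathbb R^d\to\mathbb R^d$, $\sigma,\theta:\mathbb R_+\times\mathbb R^d\times\mathcal M_2(\mathbb R^d)\to\mathbb M^{d\times q}(\mathbb R)$. On a filtered probability space, $\{B^u\}_{u\in I}$ are i.i.d. $q$-dimensional standard Brownian motions and $\{X^u_0,Y^u_0,B^u:u\in I\}$ are mutually independent. Euler sequences. Put $t_m=mh$, $Z^u_{m+1}=h^{-1/2}(B^u_{t_{m+1}}-B^u_{t_m})$ (i.i.d. $\mathcal N(0,\mathbf I_q)$), $b_m(x)=x+h\,b(t_m,x)$, $\sigma^u_m(x,\boldsymbol\mu)=\sqrt h\,\sigma(t_m,x,[G\boldsymbol\mu]^u)$, $\theta^u_m(x,\boldsymbol\mu)=\sqrt h\,\theta(t_m,x,[K\boldsymbol\mu]^u)$. Then $\bar X^u_{m+1}=b_m(\bar X^u_m)+\sigma^u_m(\bar X^u_m,\bar{\boldsymbol\mu}_m)Z^u_{m+1}$, $\bar X^u_0=X^u_0$, $\bar{\boldsymbol\mu}_m=\{\mathcal L(\bar X^u_m)\}_{u\in I}$; $\bar Y^u_{m+1}=b_m(\bar Y^u_m)+\theta^u_m(\bar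 Y^u_m,\bar{\boldsymbol\nu}_m)Z^u_{m+1}$, $\bar Y^u_0=Y^u_0$, $\bar{\boldsymbol\nu}_m=\{\mathcal L(\bar Y^u_m)\}_{u\in I}$. Conditions (RD). (i) There are $\rho\in(0,1]$, $\tilde L>0$, $L>0$ such that for all $t\ge s\ge 0$, $x,y\in\mathbb R^d$, $\mu,\nu\in\mathcal M_2(\mathbb R^d)$: $|b(t,x)-b(s,x)|\vee\|\sigma(t,x,\mu)-\sigma(s,x,\mu)\|\vee\|\theta(t,x,\mu)-\theta(s,x,\mu)\|\le\tilde L(1+|x|+\mathcal{WOP}_2(\mu,m_\mu\delta_0))(t-s)^\rho$ and $|b(t,x)-b(t,y)|\vee\|\sigma(t,x,\mu)-\sigma(t,y,\nu)\|\vee\|\theta(t,x,\mu)-\theta(t,y,\nu)\|\le L(|x-y|+\mathcal{WOP}_2(\mu,\nu))$. (ii) $u\mapsto\mathcal L(X^u_0)$ and $u\mapsto\mathcal L(Y^u_0)$ are measurable from $I$ to $\mathcal P(\mathbb R^d)$, and $\sup_u\mathbb E|X_0^u|^2<\infty$, $\sup_u\mathbb E|Y_0^u|^2<\infty$. (iii) There is $c_0\in(0,\infty)$ with $(x_1-x_2)\cdot(b(t,x_1)-b(t,x_2))\le-c_0|x_1-x_2|^2$ for all $t\ge 0$, $x_1,x_2\in\mathbb R^d$, and $\kappa_1:=c_0-8L^2q>0$. (iv) $\kappa_2:=\sup_{t}|b(t,0)|\vee\sup_{t}\sup_{u}\|\sigma(t,0,[G\boldsymbol\delta_0]^u)\|\vee\sup_{t}\sup_{u}\|\theta(t,0,[K\boldsymbol\delta_0]^u)\|<\infty$.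 *)

theory Defs
  imports "HOL-Probability.Probability"
begin

section \<open>Measures with finite second moment and their distances\<close>

text \<open>
  \<open>\<real>\<^sup>d\<close> is \<^typ>\<open>real ^ 'd\<close> and a \<open>d \<times> q\<close> matrix is a \<^typ>\<open>real ^ 'q ^ 'd\<close>, with operator norm
  \<open>onorm ((*v) A)\<close>. Families indexed by \<open>I = [0,1]\<close> are functions on \<^typ>\<open>real\<close> whose values outside
  \<open>{0..1}\<close> are irrelevant; likewise for time \<open>{0..}\<close>. ``Measurable'' on \<open>I\<close> means Borel measurable.
\<close>

definition finite_measures2 :: "(real ^ 'd) measure set" where
  "finite_measures2 = {\<mu>. sets \<mu> = sets borel \<and> finite_measure \<mu> \<and>
     (\<integral>\<^sup>+ x. ennreal ((norm x)\<^sup>2) \<partial>\<mu>) < \<infinity>}"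

definition prob_measures1 :: "(real ^ 'd) measure set" where
  "prob_measures1 = {\<mu>. sets \<mu> = sets borel \<and> prob_space \<mu> \<and>
     (\<integral>\<^sup>+ x. ennreal (norm x) \<partial>\<mu>) < \<infinity>}"

definition prob_measures2 :: "(real ^ 'd) measure set" where
  "prob_measures2 = {\<mu>. sets \<mu> = sets borel \<and> prob_space \<mu> \<and>
     (\<integral>\<^sup>+ x. ennreal ((norm x)\<^sup>2) \<partial>\<mu>) < \<infinity>}"

definition couplings ::
  "(real ^ 'd) measure \<Rightarrow> (real ^ 'd) measure \<Rightarrow> ((real ^ 'd) \<times> (real ^ 'd)) measure set" where
  "couplings \<mu> \<nu> = {\<pi>. sets \<pi> = sets (borel \<Otimes>\<^sub>M borel) \<and> prob_space \<pi> \<and>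
     distr \<pi> borel fst = \<mu> \<and> distr \<pi> borel snd = \<nu>}"

text \<open>Only meaningful on \<^const>\<open>prob_measures2\<close>, where the infimum is finite.\<close>

definition wasserstein2 :: "(real ^ 'd) measure \<Rightarrow> (real ^ 'd) measure \<Rightarrow> real" where
  "wasserstein2 \<mu> \<nu> =
     sqrt (enn2real (INF \<pi>\<in>couplings \<mu> \<nu>. \<integral>\<^sup>+ p. ennreal ((dist (fst p) (snd p))\<^sup>2) \<partial>\<pi>))"

definition mass :: "(real ^ 'd) measure \<Rightarrow> real" where
  "mass \<mu> = measure \<mu> UNIV"

definition normalized :: "real ^ 'd \<Rightarrow> (real ^ 'd) measure \<Rightarrow> (real ^ 'd) measure" where
  "normalized x\<^sub>0 \<mu> =
     (if mass \<mu> > 0 then scale_measure (ennreal (1 / mass \<mu>)) \<mu> else return borel x\<^sub>0)"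

definition dilation :: "real ^ 'd \<Rightarrow> real \<Rightarrow> real ^ 'd \<Rightarrow> real ^ 'd" where
  "dilation x\<^sub>0 a x = a *\<^sub>R (x - x\<^sub>0) + x\<^sub>0"

definition wop2 :: "real ^ 'd \<Rightarrow> (real ^ 'd) measure \<Rightarrow> (real ^ 'd) measure \<Rightarrow> real" where
  "wop2 x\<^sub>0 \<mu> \<nu> = sqrt ((mass \<mu> - mass \<nu>)\<^sup>2 +
     (wasserstein2 (distr (normalized x\<^sub>0 \<mu>) borel (dilation x\<^sub>0 (mass \<mu>)))
                   (distr (normalized x\<^sub>0 \<nu>) borel (dilation x\<^sub>0 (mass \<nu>))))\<^sup>2)"

section \<open>Convex order and matrix order\<close>

text \<open>
  A convex function is bounded below by an affine one, so under a law with finite first moment its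
  integral exists in \<open>(-\<infinity>, \<infinity>]\<close> but may be \<open>\<infinity>\<close>; the Bochner integral would then return \<open>0\<close>.
\<close>

definition ext_integral :: "'a measure \<Rightarrow> ('a \<Rightarrow> real) \<Rightarrow> ereal" where
  "ext_integral \<mu> \<phi> =
     enn2ereal (\<integral>\<^sup>+ x. ennreal (\<phi> x) \<partial>\<mu>) - enn2ereal (\<integral>\<^sup>+ x. ennreal (- \<phi> x) \<partial>\<mu>)"

definition convex_order :: "(real ^ 'd) measure \<Rightarrow> (real ^ 'd) measure \<Rightarrow> bool"
    (infix \<open>\<preceq>\<^sub>c\<^sub>v\<close> 50) where
  "\<mu> \<preceq>\<^sub>c\<^sub>v \<nu> \<longleftrightarrow> \<mu> \<in> prob_measures1 \<and> \<nu> \<in> prob_measures1 \<and>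
     (\<forall>\<phi>. convex_on UNIV \<phi> \<longrightarrow> ext_integral \<mu> \<phi> \<le> ext_integral \<nu> \<phi>)"

definition positive_semidefinite :: "real ^ 'd ^ 'd \<Rightarrow> bool" where
  "positive_semidefinite C \<longleftrightarrow> transpose C = C \<and> (\<forall>x. 0 \<le> x \<bullet> (C *v x))"

definition matrix_order :: "real ^ 'q ^ 'd \<Rightarrow> real ^ 'q ^ 'd \<Rightarrow> bool"
    (infix \<open>\<preceq>\<^sub>m\<close> 50) where
  "A \<preceq>\<^sub>m B \<longleftrightarrow> positive_semidefinite (B ** transpose B - A ** transpose A)"

section \<open>Graphons and families of measures\<close>

definition graphon :: "(real \<Rightarrow> real \<Rightarrow> real) \<Rightarrow> bool" where
  "graphon G \<longleftrightarrow> (\<forall>u\<in>{0..1}. \<forall>v\<in>{0..1}. G u v \<in> {0..1} \<and> G u v = G v u) \<and>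
     case_prod G \<in> borel_measurable (restrict_space borel ({0..1} \<times> {0..1}))"

definition measure_families :: "(real \<Rightarrow> (real ^ 'd) measure) set" where
  "measure_families = {\<mu>. (\<forall>u\<in>{0..1}. \<mu> u \<in> prob_measures2) \<and>
     (\<forall>A\<in>sets borel. (\<lambda>u. measure (\<mu> u) A) \<in> borel_measurable (restrict_space borel {0..1})) \<and>
     (SUP u\<in>{0..1}. \<integral>\<^sup>+ x. ennreal ((norm x)\<^sup>2) \<partial>\<mu> u) < \<infinity>}"

definition graphon_mix ::
  "(real \<Rightarrow> real \<Rightarrow> real) \<Rightarrow> (real \<Rightarrow> (real ^ 'd) measure) \<Rightarrow> real \<Rightarrow> (real ^ 'd) measure" where
  "graphon_mix G \<mu> u = measure_of UNIV (sets borel)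
     (\<lambda>A. \<integral>\<^sup>+ v\<in>{0..1}. ennreal (G u v) * emeasure (\<mu> v) A \<partial>lborel)"

section \<open>The random data\<close>

definition law :: "'w measure \<Rightarrow> ('w \<Rightarrow> real ^ 'd) \<Rightarrow> (real ^ 'd) measure" where
  "law M X = distr M borel X"

definition filtered_prob_space :: "'w measure \<Rightarrow> (real \<Rightarrow> 'w measure) \<Rightarrow> bool" where
  "filtered_prob_space M F \<longleftrightarrow> prob_space M \<and> (\<forall>t\<ge>0. subalgebra M (F t)) \<and>
     (\<forall>s t. 0 \<le> s \<and> s \<le> t \<longrightarrow> sets (F s) \<subseteq> sets (F t))"

definition gaussian_density :: "real \<Rightarrow> real ^ 'q \<Rightarrow> real" where
  "gaussian_density v z = (\<Prod>i\<in>UNIV. normal_density 0 (sqrt v) (z $ i))"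

definition brownian_motion :: "'w measure \<Rightarrow> (real \<Rightarrow> 'w \<Rightarrow> real ^ 'q) \<Rightarrow> bool" where
  "brownian_motion M B \<longleftrightarrow>
     (\<forall>t\<ge>0. B t \<in> borel_measurable M) \<and>
     (AE \<omega> in M. B 0 \<omega> = 0) \<and>
     (\<forall>s t. 0 \<le> s \<and> s < t \<longrightarrow>
        distributed M lborel (\<lambda>\<omega>. B t \<omega> - B s \<omega>) (\<lambda>z. ennreal (gaussian_density (t - s) z))) \<and>
     (\<forall>(\<tau> :: nat \<Rightarrow> real) n. 0 \<le> \<tau> 0 \<and> strict_mono_on {..n} \<tau> \<longrightarrow>
        prob_space.indep_vars M (\<lambda>_. borel) (\<lambda>k \<omega>. B (\<tau> (Suc k)) \<omega> - B (\<tau> k) \<omega>) {..<n}) \<and>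
     (AE \<omega> in M. continuous_on {0..} (\<lambda>t. B t \<omega>))"

text \<open>
  The members of \<open>{X\<^sub>0\<^sup>u, Y\<^sub>0\<^sup>u, B\<^sup>u : u \<in> I}\<close> take values in different spaces, so their mutual
  independence is stated for the generated \<open>\<sigma>\<close>-algebras; \<open>B\<^sup>u\<close> is regarded as a random element of
  \<open>(\<real>\<^sup>q)\<^bsup>[0,\<infinity>)\<^esup>\<close>.
\<close>

datatype source = Init_X real | Init_Y real | Noise real

definition path :: "(real \<Rightarrow> 'w \<Rightarrow> real ^ 'q) \<Rightarrow> 'w \<Rightarrow> real \<Rightarrow> real ^ 'q" where
  "path B \<omega> = (\<lambda>t\<in>{0..}. B t \<omega>)"

definition source_events ::
  "'w measure \<Rightarrow> (real \<Rightarrow> 'w \<Rightarrow> real ^ 'd) \<Rightarrow> (real \<Rightarrow> 'w \<Rightarrow> real ^ 'd) \<Rightarrow>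
   (real \<Rightarrow> real \<Rightarrow> 'w \<Rightarrow> real ^ 'q) \<Rightarrow> source \<Rightarrow> 'w set set" where
  "source_events M X\<^sub>0 Y\<^sub>0 B i = (case i of
       Init_X u \<Rightarrow> sets (vimage_algebra (space M) (X\<^sub>0 u) borel)
     | Init_Y u \<Rightarrow> sets (vimage_algebra (space M) (Y\<^sub>0 u) borel)
     | Noise u \<Rightarrow> sets (vimage_algebra (space M) (path (B u)) (\<Pi>\<^sub>M t\<in>{0..}. borel)))"

text \<open>
  No adaptedness is imposed: the Euler sequences do not refer to the filtration. That the \<open>B\<^sup>u\<close> are
  identically distributed is part of their being standard Brownian motions.
\<close>

definition random_data ::
  "'w measure \<Rightarrow> (real \<Rightarrow> 'w measure) \<Rightarrow> (real \<Rightarrow> 'w \<Rightarrow> real ^ 'd) \<Rightarrow>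
   (real \<Rightarrow> 'w \<Rightarrow> real ^ 'd) \<Rightarrow> (real \<Rightarrow> real \<Rightarrow> 'w \<Rightarrow> real ^ 'q) \<Rightarrow> bool" where
  "random_data M F X\<^sub>0 Y\<^sub>0 B \<longleftrightarrow>
     filtered_prob_space M F \<and>
     (\<forall>u\<in>{0..1}. X\<^sub>0 u \<in> borel_measurable M \<and> Y\<^sub>0 u \<in> borel_measurable M \<and>
        brownian_motion M (B u)) \<and>
     prob_space.indep_sets M (source_events M X\<^sub>0 Y\<^sub>0 B)
       (Init_X ` {0..1} \<union> Init_Y ` {0..1} \<union> Noise ` {0..1})"

section \<open>Euler sequences\<close>

definition gauss_step :: "real \<Rightarrow> (real \<Rightarrow> 'w \<Rightarrow> real ^ 'q) \<Rightarrow> nat \<Rightarrow> 'w \<Rightarrow> real ^ 'q" where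
  "gauss_step h B m \<omega> = (1 / sqrt h) *\<^sub>R (B (real m * h) \<omega> - B (real (m - 1) * h) \<omega>)"

definition drift_step ::
  "real \<Rightarrow> (real \<Rightarrow> real ^ 'd \<Rightarrow> real ^ 'd) \<Rightarrow> nat \<Rightarrow> real ^ 'd \<Rightarrow> real ^ 'd" where
  "drift_step h b m x = x + h *\<^sub>R b (real m * h) x"

text \<open>\<open>\<sigma>\<^sup>u\<^sub>m\<close> is \<open>diffusion_step h G \<sigma> u m\<close>, and \<open>\<theta>\<^sup>u\<^sub>m\<close> is \<open>diffusion_step h K \<theta> u m\<close>.\<close>

definition diffusion_step ::
  "real \<Rightarrow> (real \<Rightarrow> real \<Rightarrow> real) \<Rightarrow> (real \<Rightarrow> real ^ 'd \<Rightarrow> (real ^ 'd) measure \<Rightarrow> real ^ 'q ^ 'd) \<Rightarrow>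
   real \<Rightarrow> nat \<Rightarrow> real ^ 'd \<Rightarrow> (real \<Rightarrow> (real ^ 'd) measure) \<Rightarrow> real ^ 'q ^ 'd" where
  "diffusion_step h G s u m x \<mu> = sqrt h *\<^sub>R s (real m * h) x (graphon_mix G \<mu> u)"

primrec euler ::
  "'w measure \<Rightarrow> real \<Rightarrow> (real \<Rightarrow> real \<Rightarrow> real) \<Rightarrow> (real \<Rightarrow> real ^ 'd \<Rightarrow> real ^ 'd) \<Rightarrow>
   (real \<Rightarrow> real ^ 'd \<Rightarrow> (real ^ 'd) measure \<Rightarrow> real ^ 'q ^ 'd) \<Rightarrow>
   (real \<Rightarrow> 'w \<Rightarrow> real ^ 'd) \<Rightarrow> (real \<Rightarrow> real \<Rightarrow> 'w \<Rightarrow> real ^ 'q) \<Rightarrow>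
   nat \<Rightarrow> real \<Rightarrow> 'w \<Rightarrow> real ^ 'd" where
  "euler M h G b s X\<^sub>0 B 0 = X\<^sub>0"
| "euler M h G b s X\<^sub>0 B (Suc m) = (\<lambda>u \<omega>.
     drift_step h b m (euler M h G b s X\<^sub>0 B m u \<omega>) +
     diffusion_step h G s u m (euler M h G b s X\<^sub>0 B m u \<omega>)
       (\<lambda>v. law M (euler M h G b s X\<^sub>0 B m v)) *v gauss_step h (B u) (Suc m) \<omega>)"

definition affine_map :: "(real ^ 'd \<Rightarrow> real ^ 'd) \<Rightarrow> bool" where
  "affine_map f \<longleftrightarrow> (\<exists>l c. linear l \<and> (\<forall>x. f x = l x + c))"

section \<open>The conditions (RD)\<close>

definition time_holder ::
  "real ^ 'd \<Rightarrow> (real \<Rightarrow> real ^ 'd \<Rightarrow> real ^ 'd) \<Rightarrow>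
   (real \<Rightarrow> real ^ 'd \<Rightarrow> (real ^ 'd) measure \<Rightarrow> real ^ 'q ^ 'd) \<Rightarrow>
   (real \<Rightarrow> real ^ 'd \<Rightarrow> (real ^ 'd) measure \<Rightarrow> real ^ 'q ^ 'd) \<Rightarrow> real \<Rightarrow> real \<Rightarrow> bool" where
  "time_holder x\<^sub>0 b \<sigma> \<theta> \<rho> L \<longleftrightarrow>
     (\<forall>s t x. \<forall>\<mu>\<in>finite_measures2. 0 \<le> s \<and> s \<le> t \<longrightarrow>
        max (norm (b t x - b s x))
          (max (onorm ((*v) (\<sigma> t x \<mu> - \<sigma> s x \<mu>))) (onorm ((*v) (\<theta> t x \<mu> - \<theta> s x \<mu>))))
        \<le> L * (1 + norm x + wop2 x\<^sub>0 \<mu> (scale_measure (ennreal (mass \<mu>)) (return borel 0)))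
            * (t - s) powr \<rho>)"

definition space_lipschitz ::
  "real ^ 'd \<Rightarrow> (real \<Rightarrow> real ^ 'd \<Rightarrow> real ^ 'd) \<Rightarrow>
   (real \<Rightarrow> real ^ 'd \<Rightarrow> (real ^ 'd) measure \<Rightarrow> real ^ 'q ^ 'd) \<Rightarrow>
   (real \<Rightarrow> real ^ 'd \<Rightarrow> (real ^ 'd) measure \<Rightarrow> real ^ 'q ^ 'd) \<Rightarrow> real \<Rightarrow> bool" where
  "space_lipschitz x\<^sub>0 b \<sigma> \<theta> L \<longleftrightarrow>
     (\<forall>t\<ge>0. \<forall>x y. \<forall>\<mu>\<in>finite_measures2. \<forall>\<nu>\<in>finite_measures2.
        max (norm (b t x - b t y))
          (max (onorm ((*v) (\<sigma> t x \<mu> - \<sigma> t y \<nu>))) (onorm ((*v) (\<theta> t x \<mu> - \<theta> t y \<nu>))))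
        \<le> L * (norm (x - y) + wop2 x\<^sub>0 \<mu> \<nu>))"

definition initial_regular :: "'w measure \<Rightarrow> (real \<Rightarrow> 'w \<Rightarrow> real ^ 'd) \<Rightarrow> bool" where
  "initial_regular M X\<^sub>0 \<longleftrightarrow>
     (\<lambda>u. law M (X\<^sub>0 u)) \<in> restrict_space borel {0..1} \<rightarrow>\<^sub>M prob_algebra borel \<and>
     (SUP u\<in>{0..1}. \<integral>\<^sup>+ \<omega>. ennreal ((norm (X\<^sub>0 u \<omega>))\<^sup>2) \<partial>M) < \<infinity>"

definition dissipative :: "(real \<Rightarrow> real ^ 'd \<Rightarrow> real ^ 'd) \<Rightarrow> real \<Rightarrow> bool" where
  "dissipative b c \<longleftrightarrow>
     (\<forall>t\<ge>0. \<forall>x y. (x - y) \<bullet> (b t x - b t y) \<le> - c * (norm (x - y))\<^sup>2)"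

definition kappa2 ::
  "(real \<Rightarrow> real \<Rightarrow> real) \<Rightarrow> (real \<Rightarrow> real \<Rightarrow> real) \<Rightarrow> (real \<Rightarrow> real ^ 'd \<Rightarrow> real ^ 'd) \<Rightarrow>
   (real \<Rightarrow> real ^ 'd \<Rightarrow> (real ^ 'd) measure \<Rightarrow> real ^ 'q ^ 'd) \<Rightarrow>
   (real \<Rightarrow> real ^ 'd \<Rightarrow> (real ^ 'd) measure \<Rightarrow> real ^ 'q ^ 'd) \<Rightarrow> ereal" where
  "kappa2 G K b \<sigma> \<theta> = max (SUP t\<in>{0..}. ereal (norm (b t 0)))
     (max (SUP t\<in>{0..}. SUP u\<in>{0..1}.
             ereal (onorm ((*v) (\<sigma> t 0 (graphon_mix G (\<lambda>_. return borel 0) u)))))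
          (SUP t\<in>{0..}. SUP u\<in>{0..1}.
             ereal (onorm ((*v) (\<theta> t 0 (graphon_mix K (\<lambda>_. return borel 0) u))))))"

definition RD ::
  "real ^ 'd \<Rightarrow> 'w measure \<Rightarrow> (real \<Rightarrow> real \<Rightarrow> real) \<Rightarrow> (real \<Rightarrow> real \<Rightarrow> real) \<Rightarrow>
   (real \<Rightarrow> real ^ 'd \<Rightarrow> real ^ 'd) \<Rightarrow>
   (real \<Rightarrow> real ^ 'd \<Rightarrow> (real ^ 'd) measure \<Rightarrow> real ^ 'q ^ 'd) \<Rightarrow>
   (real \<Rightarrow> real ^ 'd \<Rightarrow> (real ^ 'd) measure \<Rightarrow> real ^ 'q ^ 'd) \<Rightarrow>
   (real \<Rightarrow> 'w \<Rightarrow> real ^ 'd) \<Rightarrow> (real \<Rightarrow> 'w \<Rightarrow> real ^ 'd) \<Rightarrow> bool" where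
  "RD x\<^sub>0 M G K b \<sigma> \<theta> X\<^sub>0 Y\<^sub>0 \<longleftrightarrow>
     (\<exists>\<rho> L' L c\<^sub>0. 0 < \<rho> \<and> \<rho> \<le> 1 \<and> 0 < L' \<and> 0 < L \<and> 0 < c\<^sub>0 \<and>
        time_holder x\<^sub>0 b \<sigma> \<theta> \<rho> L' \<and>
        space_lipschitz x\<^sub>0 b \<sigma> \<theta> L \<and>
        initial_regular M X\<^sub>0 \<and> initial_regular M Y\<^sub>0 \<and>
        dissipative b c\<^sub>0 \<and> 0 < c\<^sub>0 - 8 * L\<^sup>2 * real CARD('q) \<and>
        kappa2 G K b \<sigma> \<theta> < \<infinity>)"

end

theory Submission
  imports Defs
begin

text \<open>
  The proof is by induction on \<open>m\<close>. For a convex Lipschitz \<open>\<phi>\<close> let \<open>Q\<^sub>S \<phi> x\<close> be the expectation of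
  \<open>\<phi> (b x + S x Z)\<close> for a standard Gaussian \<open>Z\<close>. If \<open>A A\<^sup>T \<le> B B\<^sup>T\<close> then \<open>A = B T\<close> with a
  contraction \<open>T\<close>, and \<open>T\<close> is a convex combination of orthogonal matrices; since the law of \<open>Z\<close> is
  invariant under these, the expectation of \<open>\<phi> (y + A Z)\<close> is at most that of \<open>\<phi> (y + B Z)\<close>. So
  \<open>Q\<^sub>S \<phi>\<close> is monotone in \<open>S\<close>, and it is convex when \<open>b\<close> is affine and \<open>S\<close> is matrix convex. Hence
  \<open>\<integral> Q\<^sub>\<sigma> \<phi> d\<mu> \<le> \<integral> Q\<^sub>\<sigma> \<phi> d\<nu> \<le> \<integral> Q\<^sub>\<theta> \<phi> d\<nu>\<close> for the laws \<open>\<mu>\<close>, \<open>\<nu>\<close> of the two sequences at time \<open>m\<close>.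

  The hypotheses apply only to measurable families of laws, so measurability in the label \<open>u\<close> has to
  be carried along. The diffusion coefficient at \<open>u\<close> is a function of \<open>G u\<close> that is
  continuous for the \<open>L\<^sup>1\<close> distance, by an explicit coupling, and \<open>u \<mapsto> G u\<close> is a measurable map
  into the separable space \<open>L\<^sup>1\<close>.
\<close>

section \<open>Convex order and Lipschitz test functions\<close>

text \<open>A convex function may have an infinite integral, while every integral in the comparison
  has to be finite. Lipschitz convex functions are integrable under every law with a first moment,
  and by monotone approximation from below they determine the order. The two coefficients are
  evaluated at different families of laws, so the comparison passes through a hybrid: \<sigma> at
  the laws of X is below \<sigma> at the laws of Y by monotonicity in the measure, and this is below
  \<theta> at the laws of Y by domination, all at the same point x. Convexity in x enters earlier,
  when the law of the current state is changed while the coefficient \<sigma> stays at the laws of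
  X. Labels interact only through these deterministic laws. For a fixed label each sequence is
  therefore a recursion driven by independent Gaussian increments. The distance \<open>wop2\<close>
  of two mixtures of one family is at most a constant times the square root of the L1 distance of
  their densities; the constant comes from the uniform second moment of the family.\<close>

lemma convex_on_subgradient:
  fixes \<phi> :: "'a::euclidean_space \<Rightarrow> real"
  assumes "convex_on UNIV \<phi>"
  obtains g where "\<And>y. \<phi> x + g \<bullet> (y - x) \<le> \<phi> y"
proof -
  \<comment> \<open>The strict epigraph is separated from the point (x, \<phi> x). If the normal (v,
    s) of the hyperplane has s > 0, the hyperplane is the graph of an affine function with slope - v
    / s.\<close>
  let ?E = "{p :: 'a \<times> real. \<phi> (fst p) < snd p}"
  have "convex ?E"
  proof (rule convexI)
    fix p q :: "'a \<times> real" and u v :: real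
    assume pq: "p \<in> ?E" "q \<in> ?E" and uv: "0 \<le> u" "0 \<le> v" "u + v = 1"
    have "\<phi> (u *\<^sub>R fst p + v *\<^sub>R fst q) \<le> u * \<phi> (fst p) + v * \<phi> (fst q)"
      using assms uv by (auto simp: convex_on_def)
    also have "\<dots> < u * snd p + v * snd q"
    proof (cases "u = 0")
      case True
      then show ?thesis using pq uv by simp
    next
      case False
      then have "u * \<phi> (fst p) < u * snd p" using pq uv by simp
      moreover have "v * \<phi> (fst q) \<le> v * snd q" using pq uv by (simp add: mult_left_mono)
      ultimately show ?thesis by linarith
    qed
    finally show "u *\<^sub>R p + v *\<^sub>R q \<in> ?E" by simp
  qed
  moreover have "(0, \<phi> 0 + 1) \<in> ?E" by simp
  then have "?E \<noteq> {}" by blast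
  moreover have "convex {(x, \<phi> x)}" "{(x, \<phi> x)} \<noteq> {}" "{(x, \<phi> x)} \<inter> ?E = {}" by auto
  ultimately obtain a c where a: "a \<noteq> 0" and ax: "\<forall>p\<in>{(x, \<phi> x)}. a \<bullet> p \<le> c" and aE: "\<forall>p\<in>?E. c \<le> a \<bullet> p"
    using separating_hyperplane_sets[of "{(x, \<phi> x)}" ?E] by blast
  obtain v s where vs: "a = (v, s)" by (cases a)
  have le: "v \<bullet> x + s * \<phi> x \<le> v \<bullet> y + s * t" if "\<phi> y < t" for y t
  proof -
    have "a \<bullet> (x, \<phi> x) \<le> a \<bullet> (y, t)" using ax aE that by force
    then show ?thesis by (simp add: vs)
  qed
  have "0 \<le> s"
    using le[of x "\<phi> x + 1"] by (simp add: algebra_simps)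
  \<comment> \<open>A vertical hyperplane is impossible because \<phi> is finite everywhere: for s =
    0 the point x - v would give v . v \<le> 0.\<close>
  moreover have "s \<noteq> 0"
  proof
    assume "s = 0"
    then have "v \<bullet> x \<le> v \<bullet> y" for y using le[of y "\<phi> y + 1"] by simp
    from this[of "x - v"] have "v \<bullet> v \<le> 0" by (simp add: inner_diff_right)
    then have "v = 0" by (metis antisym inner_eq_zero_iff inner_ge_zero)
    with \<open>s = 0\<close> a vs show False by (simp add: zero_prod_def)
  qed
  ultimately have s: "0 < s" by simp
  have "\<phi> x + (- (1 / s) *\<^sub>R v) \<bullet> (y - x) \<le> \<phi> y" for y
  proof (rule field_le_epsilon)
    fix e :: real assume "0 < e"
    have "v \<bullet> x + s * \<phi> x \<le> v \<bullet> y + s * (\<phi> y + e)" using le[of y "\<phi> y + e"] \<open>0 < e\<close> by simp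
    then have "s * \<phi> x - v \<bullet> (y - x) \<le> s * (\<phi> y + e)" by (simp add: inner_diff_right)
    then have "(s * \<phi> x - v \<bullet> (y - x)) / s \<le> \<phi> y + e" using s by (simp add: divide_le_eq mult.commute)
    then show "\<phi> x + (- (1 / s) *\<^sub>R v) \<bullet> (y - x) \<le> \<phi> y + e" using s by (simp add: diff_divide_distrib)
  qed
  then show ?thesis by (rule that)
qed

lemma convex_on_UNIV_borel_measurable:
  fixes \<phi> :: "'a::euclidean_space \<Rightarrow> real"
  assumes "convex_on UNIV \<phi>"
  shows "\<phi> \<in> borel_measurable borel"
  using convex_on_continuous[OF open_UNIV assms] by (rule borel_measurable_continuous_onI)

text \<open>For convex \<phi> and large n this is the infimal convolution of \<phi> with n |.|. As a
  supremum of affine functions of slope at most n it is visibly convex and n-Lipschitz. The real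
  supremum is meaningful once n reaches the norm of a subgradient at 0, the \<open>g\<^sub>0\<close>
  below, since the index set is then nonempty.\<close>

definition lip_minorant :: "('a::euclidean_space \<Rightarrow> real) \<Rightarrow> real \<Rightarrow> 'a \<Rightarrow> real" where
  "lip_minorant \<phi> n x = (SUP (a, c)\<in>{(a, c). norm a \<le> n \<and> (\<forall>y. a \<bullet> y + c \<le> \<phi> y)}. a \<bullet> x + c)"

context
  fixes \<phi> :: "'a::euclidean_space \<Rightarrow> real" and g\<^sub>0 :: 'a
  assumes g\<^sub>0: "\<And>y. \<phi> 0 + g\<^sub>0 \<bullet> y \<le> \<phi> y"
begin

lemma affine_minorant_le_lip_minorant:
  assumes "norm a \<le> n" "\<And>y. a \<bullet> y + c \<le> \<phi> y"
  shows "a \<bullet> x + c \<le> lip_minorant \<phi> n x"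
proof -
  have "bdd_above ((\<lambda>(a, c). a \<bullet> x + c) ` {(a, c). norm a \<le> n \<and> (\<forall>y. a \<bullet> y + c \<le> \<phi> y)})"
    by (rule bdd_aboveI[of _ "\<phi> x"]) auto
  then show ?thesis
    unfolding lip_minorant_def using assms
    by (auto intro: cSUP_upper2[where x = "(a, c)"])
qed

lemma lip_minorant_leI:
  assumes "norm g\<^sub>0 \<le> n"
    and "\<And>a c. norm a \<le> n \<Longrightarrow> (\<And>y. a \<bullet> y + c \<le> \<phi> y) \<Longrightarrow> a \<bullet> x + c \<le> r"
  shows "lip_minorant \<phi> n x \<le> r"
  unfolding lip_minorant_def
proof (rule cSUP_least)
  show "{(a, c). norm a \<le> n \<and> (\<forall>y. a \<bullet> y + c \<le> \<phi> y)} \<noteq> {}"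
    using assms(1) g\<^sub>0 by (auto intro!: exI[of _ g\<^sub>0] exI[of _ "\<phi> 0"] simp: add.commute)
qed (use assms(2) in auto)

lemma lip_minorant_le: "norm g\<^sub>0 \<le> n \<Longrightarrow> lip_minorant \<phi> n x \<le> \<phi> x"
  by (rule lip_minorant_leI)

lemma lip_minorant_mono:
  "norm g\<^sub>0 \<le> n \<Longrightarrow> n \<le> n' \<Longrightarrow> lip_minorant \<phi> n x \<le> lip_minorant \<phi> n' x"
  by (rule lip_minorant_leI) (auto intro: affine_minorant_le_lip_minorant)

lemma lip_minorant_lipschitz:
  assumes "norm g\<^sub>0 \<le> n"
  shows "lip_minorant \<phi> n x - lip_minorant \<phi> n y \<le> n * norm (x - y)"
proof -
  have "lip_minorant \<phi> n x \<le> lip_minorant \<phi> n y + n * norm (x - y)"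
  proof (rule lip_minorant_leI[OF assms])
    fix a :: 'a and c assume a: "norm a \<le> n" and c: "\<And>y. a \<bullet> y + c \<le> \<phi> y"
    have "a \<bullet> (x - y) \<le> norm a * norm (x - y)" by (rule norm_cauchy_schwarz)
    also have "\<dots> \<le> n * norm (x - y)" using a by (simp add: mult_right_mono)
    finally show "a \<bullet> x + c \<le> lip_minorant \<phi> n y + n * norm (x - y)"
      using affine_minorant_le_lip_minorant[OF a c, of y] by (simp add: inner_diff_right)
  qed
  then show ?thesis by simp
qed

lemma convex_on_lip_minorant:
  assumes "norm g\<^sub>0 \<le> n"
  shows "convex_on UNIV (lip_minorant \<phi> n)"
proof (rule convex_onI)
  fix t x y :: _ assume t: "0 < t" "t < (1::real)"
  show "lip_minorant \<phi> n ((1 - t) *\<^sub>R x + t *\<^sub>R y)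
      \<le> (1 - t) * lip_minorant \<phi> n x + t * lip_minorant \<phi> n y"
  proof (rule lip_minorant_leI[OF assms])
    fix a :: 'a and c assume a: "norm a \<le> n" and c: "\<And>y. a \<bullet> y + c \<le> \<phi> y"
    have "a \<bullet> ((1 - t) *\<^sub>R x + t *\<^sub>R y) + c = (1 - t) * (a \<bullet> x + c) + t * (a \<bullet> y + c)"
      by (simp add: inner_add_right algebra_simps)
    also have "\<dots> \<le> (1 - t) * lip_minorant \<phi> n x + t * lip_minorant \<phi> n y"
      using t affine_minorant_le_lip_minorant[OF a c] by (intro add_mono mult_left_mono) auto
    finally show "a \<bullet> ((1 - t) *\<^sub>R x + t *\<^sub>R y) + c \<le> \<dots>" .
  qed
qed simp

text \<open>A subgradient at x takes part in the supremum as soon as n reaches its norm, and its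
  affine function touches \<phi> at x. The value \<phi> x is thus attained from some n on, depending
  on x.\<close>

lemma lip_minorant_eventually_eq:
  assumes "convex_on UNIV \<phi>"
  obtains n\<^sub>0 where "\<And>n. n\<^sub>0 \<le> n \<Longrightarrow> lip_minorant \<phi> n x = \<phi> x"
proof -
  obtain g where g: "\<And>y. \<phi> x + g \<bullet> (y - x) \<le> \<phi> y" using convex_on_subgradient[OF assms, of x] by auto
  have "lip_minorant \<phi> n x = \<phi> x" if "max (norm g\<^sub>0) (norm g) \<le> n" for n
  proof (rule antisym)
    show "lip_minorant \<phi> n x \<le> \<phi> x" using that by (intro lip_minorant_le) auto
    have "g \<bullet> x + (\<phi> x - g \<bullet> x) \<le> lip_minorant \<phi> n x"
      using that g by (intro affine_minorant_le_lip_minorant) (auto simp: inner_diff_right algebra_simps)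
    then show "\<phi> x \<le> lip_minorant \<phi> n x" by simp
  qed
  then show ?thesis by (rule that)
qed

end

section \<open>Extended integrals and the reduction to Lipschitz test functions\<close>

lemma integrable_lipschitz:
  fixes \<phi> :: "'a::euclidean_space \<Rightarrow> real"
  assumes "finite_measure \<mu>" "sets \<mu> = sets borel" "(\<integral>\<^sup>+ x. ennreal (norm x) \<partial>\<mu>) < \<infinity>"
    and lip: "\<And>x y. \<phi> x - \<phi> y \<le> C * norm (x - y)"
  shows "integrable \<mu> \<phi>"
proof -
  interpret finite_measure \<mu> by fact
  have [measurable_cong]: "sets \<mu> = sets borel" by fact
  have lip': "\<bar>\<phi> x - \<phi> y\<bar> \<le> C * norm (x - y)" for x y
    using lip[of x y] lip[of y x] by (simp add: abs_if norm_minus_commute)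
  \<comment> \<open>Comparing a unit vector with 0 forces the Lipschitz constant to be
    nonnegative.\<close>
  obtain e :: 'a where "e \<in> Basis" using nonempty_Basis by blast
  then have C: "0 \<le> C" using order_trans[OF abs_ge_zero lip'[of e 0]] by simp
  then have "C-lipschitz_on UNIV \<phi>" using lip' by (intro lipschitz_onI) (simp_all add: dist_norm)
  then have [measurable]: "\<phi> \<in> borel_measurable borel"
    by (intro borel_measurable_continuous_onI lipschitz_on_continuous_on)
  have "integrable \<mu> (\<lambda>x. norm x)"
    by (rule integrableI_bounded) (use assms(3) in auto)
  then have "integrable \<mu> (\<lambda>x. \<bar>\<phi> 0\<bar> + C * norm x)" by simp
  then show ?thesis
  proof (rule Bochner_Integration.integrable_bound)
    have "norm (\<phi> x) \<le> norm (\<bar>\<phi> 0\<bar> + C * norm x)" for x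
      using lip'[of x 0] by simp
    then show "AE x in \<mu>. norm (\<phi> x) \<le> norm (\<bar>\<phi> 0\<bar> + C * norm x)" by simp
  qed measurable
qed

lemma ext_integral_eq_integral:
  assumes "integrable \<mu> \<phi>"
  shows "ext_integral \<mu> \<phi> = ereal (integral\<^sup>L \<mu> \<phi>)"
proof -
  have "(\<integral>\<^sup>+x. ennreal (\<phi> x) \<partial>\<mu>) < \<infinity>" "(\<integral>\<^sup>+x. ennreal (- \<phi> x) \<partial>\<mu>) < \<infinity>"
    using assms by (auto simp: real_integrable_def top.not_eq_extremum)
  then show ?thesis
    unfolding ext_integral_def real_lebesgue_integral_def[OF assms]
    by (cases "\<integral>\<^sup>+x. ennreal (\<phi> x) \<partial>\<mu>" rule: ennreal_cases;
        cases "\<integral>\<^sup>+x. ennreal (- \<phi> x) \<partial>\<mu>" rule: ennreal_cases) auto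
qed

text \<open>The Lipschitz envelopes increase to \<phi>, so inequalities between their finite
  integrals pass to the extended integrals of \<phi>. The limit of the difference is legitimate
  because the negative parts stay finite, even where the positive part tends to infinity.\<close>

lemma convex_orderI_lipschitz:
  fixes \<mu> \<nu> :: "(real ^ 'd) measure"
  assumes "\<mu> \<in> prob_measures1" "\<nu> \<in> prob_measures1"
    and le: "\<And>\<phi> C. convex_on UNIV \<phi> \<Longrightarrow> (\<And>x y. \<phi> x - \<phi> y \<le> C * norm (x - y)) \<Longrightarrow>
      integral\<^sup>L \<mu> \<phi> \<le> integral\<^sup>L \<nu> \<phi>"
  shows "\<mu> \<preceq>\<^sub>c\<^sub>v \<nu>"
  unfolding convex_order_def
proof (intro conjI allI impI assms(1,2))
  fix \<phi> :: "real ^ 'd \<Rightarrow> real" assume cvx: "convex_on UNIV \<phi>"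
  obtain g where g: "\<And>y. \<phi> 0 + g \<bullet> y \<le> \<phi> y" using convex_on_subgradient[OF cvx, of 0] by auto
  \<comment> \<open>The shift by \<open>norm g\<close>, with g a subgradient at 0, puts every index
    in the range where the envelope is well defined.\<close>
  define \<psi> where "\<psi> n = lip_minorant \<phi> (norm g + real n)" for n
  have n: "norm g \<le> norm g + real n" for n by simp
  have \<psi>_cvx: "convex_on UNIV (\<psi> n)" for n
    unfolding \<psi>_def by (rule convex_on_lip_minorant[OF g n])
  have \<psi>_lip: "\<psi> n x - \<psi> n y \<le> (norm g + real n) * norm (x - y)" for n x y
    unfolding \<psi>_def by (rule lip_minorant_lipschitz[OF g n])
  have \<psi>_le: "\<psi> n x \<le> \<phi> x" for n x unfolding \<psi>_def by (rule lip_minorant_le[OF g n])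
  have \<psi>_mono: "\<psi> n x \<le> \<psi> n' x" if "n \<le> n'" for n n' x
    unfolding \<psi>_def using that by (intro lip_minorant_mono[OF g n]) auto
  have \<psi>_lim: "(\<lambda>n. \<psi> n x) \<longlonglongrightarrow> \<phi> x" for x
  proof -
    obtain n\<^sub>0 where n\<^sub>0: "\<And>n. n\<^sub>0 \<le> n \<Longrightarrow> lip_minorant \<phi> n x = \<phi> x"
      using lip_minorant_eventually_eq[OF g cvx] by blast
    have "eventually (\<lambda>n. \<psi> n x = \<phi> x) sequentially"
      using eventually_ge_at_top[of "nat \<lceil>n\<^sub>0\<rceil>"]
    proof eventually_elim
      case (elim n)
      then have "n\<^sub>0 \<le> norm g + real n" using norm_ge_zero[of g] by linarith
      then show ?case unfolding \<psi>_def by (rule n\<^sub>0)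
    qed
    then show ?thesis by (rule tendsto_eventually)
  qed
  have [measurable]: "\<psi> n \<in> borel_measurable borel" for n
    using \<psi>_cvx by (rule convex_on_UNIV_borel_measurable)
  have [measurable]: "\<phi> \<in> borel_measurable borel" using cvx by (rule convex_on_UNIV_borel_measurable)
  have int: "integrable \<kappa> (\<psi> n)" if "\<kappa> \<in> prob_measures1" for \<kappa> n
    using that by (intro integrable_lipschitz[OF _ _ _ \<psi>_lip]) (auto simp: prob_measures1_def prob_space.axioms)
  text \<open>Monotone convergence for the positive part; the negative part is dominated by that of \<open>\<psi> 0\<close>.\<close>
  have lim: "(\<lambda>n. ereal (integral\<^sup>L \<kappa> (\<psi> n))) \<longlonglongrightarrow> ext_integral \<kappa> \<phi>" if \<kappa>: "\<kappa> \<in> prob_measures1" for \<kappa>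
  proof -
    have [measurable_cong]: "sets \<kappa> = sets borel" using \<kappa> by (auto simp: prob_measures1_def)
    have "(\<lambda>n. \<integral>\<^sup>+x. ennreal (\<psi> n x) \<partial>\<kappa>) \<longlonglongrightarrow> (\<integral>\<^sup>+x. ennreal (\<phi> x) \<partial>\<kappa>)"
      by (rule nn_integral_LIMSEQ)
        (auto intro!: incseq_SucI le_funI ennreal_leI \<psi>_mono tendsto_ennrealI \<psi>_lim)
    then have pos: "(\<lambda>n. enn2ereal (\<integral>\<^sup>+x. ennreal (\<psi> n x) \<partial>\<kappa>)) \<longlonglongrightarrow> enn2ereal (\<integral>\<^sup>+x. ennreal (\<phi> x) \<partial>\<kappa>)"
      by (rule continuous_on_tendsto_compose[OF continuous_on_enn2ereal]) auto
    have fin0: "(\<integral>\<^sup>+x. ennreal (- \<psi> 0 x) \<partial>\<kappa>) < \<infinity>"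
      using int[OF \<kappa>, of 0] by (auto simp: real_integrable_def top.not_eq_extremum)
    have "(\<lambda>n. \<integral>\<^sup>+x. ennreal (- \<psi> n x) \<partial>\<kappa>) \<longlonglongrightarrow> (\<integral>\<^sup>+x. ennreal (- \<phi> x) \<partial>\<kappa>)"
      by (rule nn_integral_dominated_convergence[where w = "\<lambda>x. ennreal (- \<psi> 0 x)"])
        (use fin0 in \<open>auto intro!: ennreal_leI \<psi>_mono tendsto_ennrealI tendsto_minus \<psi>_lim AE_I2\<close>)
    then have neg: "(\<lambda>n. enn2ereal (\<integral>\<^sup>+x. ennreal (- \<psi> n x) \<partial>\<kappa>)) \<longlonglongrightarrow> enn2ereal (\<integral>\<^sup>+x. ennreal (- \<phi> x) \<partial>\<kappa>)"
      by (rule continuous_on_tendsto_compose[OF continuous_on_enn2ereal]) auto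
    have "(\<integral>\<^sup>+x. ennreal (- \<phi> x) \<partial>\<kappa>) \<le> (\<integral>\<^sup>+x. ennreal (- \<psi> 0 x) \<partial>\<kappa>)"
      by (intro nn_integral_mono ennreal_leI) (simp add: \<psi>_le)
    then have "(\<integral>\<^sup>+x. ennreal (- \<phi> x) \<partial>\<kappa>) < \<infinity>" using fin0 by (rule le_less_trans)
    then have negfin: "\<bar>enn2ereal (\<integral>\<^sup>+x. ennreal (- \<phi> x) \<partial>\<kappa>)\<bar> \<noteq> \<infinity>"
      by (cases "\<integral>\<^sup>+x. ennreal (- \<phi> x) \<partial>\<kappa>" rule: ennreal_cases) auto
    have "(\<lambda>n. enn2ereal (\<integral>\<^sup>+x. ennreal (\<psi> n x) \<partial>\<kappa>) - enn2ereal (\<integral>\<^sup>+x. ennreal (- \<psi> n x) \<partial>\<kappa>))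
        \<longlonglongrightarrow> ext_integral \<kappa> \<phi>"
      unfolding ext_integral_def using pos neg negfin
      by (intro tendsto_diff_ereal_general) auto
    then show ?thesis
      using ext_integral_eq_integral[OF int[OF \<kappa>]] by (simp add: ext_integral_def)
  qed
  show "ext_integral \<mu> \<phi> \<le> ext_integral \<nu> \<phi>"
    by (rule LIMSEQ_le[OF lim[OF assms(1)] lim[OF assms(2)]]) (use le[OF \<psi>_cvx \<psi>_lip] in auto)
qed

lemma convex_order_integral_le:
  assumes "\<mu> \<preceq>\<^sub>c\<^sub>v \<nu>" "convex_on UNIV \<phi>" "integrable \<mu> \<phi>" "integrable \<nu> \<phi>"
  shows "integral\<^sup>L \<mu> \<phi> \<le> integral\<^sup>L \<nu> \<phi>"
  using assms by (auto simp: convex_order_def ext_integral_eq_integral)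

section \<open>Contractions and orthogonal matrices\<close>

text \<open>\<open>y v* A\<close> is A^T y, and the quadratic form of A A^T at y is |A^T y|^2. The
  matrix order is thus a comparison of lengths, the form in which factorization uses it.\<close>

lemma matrix_order_norm_le:
  fixes A B :: "real ^ 'q ^ 'd"
  assumes "A \<preceq>\<^sub>m B"
  shows "norm (y v* A) \<le> norm (y v* B)"
proof -
  have "y \<bullet> ((C ** transpose C) *v y) = (y v* C) \<bullet> (y v* C)" for C :: "real ^ 'q ^ 'd"
    by (simp add: dot_lmul_matrix matrix_vector_mul_assoc[symmetric])
  then have "y \<bullet> ((B ** transpose B - A ** transpose A) *v y) = (y v* B) \<bullet> (y v* B) - (y v* A) \<bullet> (y v* A)"
    by (simp add: matrix_vector_mult_diff_rdistrib inner_diff_right)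
  moreover have "0 \<le> y \<bullet> ((B ** transpose B - A ** transpose A) *v y)"
    using assms by (auto simp: matrix_order_def positive_semidefinite_def)
  ultimately show ?thesis by (simp add: norm_le)
qed

text \<open>This is the orthogonal projection, written in an orthonormal basis of V; the norm bound
  is Pythagoras.\<close>

lemma contractive_projection_exists:
  fixes V :: "'a::euclidean_space set"
  assumes "subspace V"
  obtains P where "linear P" "range P \<subseteq> V" "\<And>v. v \<in> V \<Longrightarrow> P v = v" "\<And>v. norm (P v) \<le> norm v"
proof -
  obtain W where W: "W \<subseteq> V" "pairwise orthogonal W" "\<And>x. x \<in> W \<Longrightarrow> norm x = 1"
      "independent W" "span W = V"
    using orthonormal_basis_subspace[OF assms] by metis
  have [simp]: "finite W" using W(4) by (rule independent_imp_finite)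
  define P where "P v = (\<Sum>w\<in>W. (v \<bullet> w) *\<^sub>R w)" for v
  have lin: "linear P"
    unfolding P_def by (intro linearI)
      (simp_all add: inner_add_left scaleR_add_left sum.distrib scaleR_sum_right)
  have PV: "P v \<in> V" for v
    unfolding P_def using W(1) assms by (auto intro!: subspace_sum subspace_scale)
  have Pw: "P v \<bullet> w = v \<bullet> w" if "w \<in> W" for v w
  proof -
    have "P v \<bullet> w = (\<Sum>u\<in>W. (v \<bullet> u) * (u \<bullet> w))" by (simp add: P_def inner_sum_left)
    also have "\<dots> = (\<Sum>u\<in>W. if u = w then v \<bullet> w else 0)"
    proof (rule sum.cong)
      fix u assume "u \<in> W"
      then show "(v \<bullet> u) * (u \<bullet> w) = (if u = w then v \<bullet> w else 0)"
        using W(2,3) that by (auto simp: pairwise_def orthogonal_def norm_eq_1)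
    qed simp
    finally show ?thesis using that by simp
  qed
  have orth: "(v - P v) \<bullet> x = 0" if "x \<in> V" for v x
    using that unfolding W(5)[symmetric]
    by (induction rule: span_induct_alt) (simp_all add: inner_add_right Pw inner_diff_left)
  show ?thesis
  proof (rule that[OF lin])
    show "range P \<subseteq> V" using PV by auto
    show "P v = v" if "v \<in> V" for v
    proof -
      have "(v - P v) \<bullet> (v - P v) = 0" using that PV assms by (intro orth subspace_diff) auto
      then show ?thesis by simp
    qed
    show "norm (P v) \<le> norm v" for v
    proof -
      have "(v - P v) \<bullet> P v = 0" by (intro orth PV)
      then have "v \<bullet> v = (v - P v) \<bullet> (v - P v) + P v \<bullet> P v"
        by (simp add: inner_diff_left inner_diff_right inner_commute)
      then have "P v \<bullet> P v \<le> v \<bullet> v" using inner_ge_zero[of "v - P v"] by linarith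
      then show ?thesis by (simp add: norm_le)
    qed
  qed
qed

text \<open>Douglas' factorization lemma: \<open>S\<close> maps \<open>B\<^sup>T y\<close> to \<open>A\<^sup>T y\<close> and vanishes on the orthogonal
  complement of the range of \<open>B\<^sup>T\<close>.\<close>

lemma matrix_order_contraction:
  fixes A B :: "real ^ 'q ^ 'd"
  assumes "A \<preceq>\<^sub>m B"
  obtains T :: "real ^ 'q ^ 'q" where "A = B ** T" "\<And>z. norm (T *v z) \<le> norm z"
proof -
  let ?Bt = "\<lambda>y. y v* B" and ?At = "\<lambda>y. y v* A"
  have le: "norm (?At y) \<le> norm (?Bt y)" for y using assms by (rule matrix_order_norm_le)
  have At: "linear ?At" and Bt: "linear ?Bt"
    using matrix_vector_mul_linear[of "transpose A"] matrix_vector_mul_linear[of "transpose B"] by simp_all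
  have sub: "subspace (range ?Bt)" using Bt by (simp add: linear_subspace_image)
  obtain P where P: "linear P" "range P \<subseteq> range ?Bt" "\<And>v. v \<in> range ?Bt \<Longrightarrow> P v = v"
      "\<And>v. norm (P v) \<le> norm v"
    using contractive_projection_exists[OF sub] by blast
  obtain r where r: "linear r" "\<And>v. v \<in> range ?Bt \<Longrightarrow> ?Bt (r v) = v"
    using linear_exists_right_inverse_on[OF Bt subspace_UNIV] by auto
  define S where "S v = ?At (r (P v))" for v
  have "linear (?At \<circ> (r \<circ> P))" by (intro linear_compose P(1) r(1) At)
  moreover have "?At \<circ> (r \<circ> P) = S" by (simp add: S_def fun_eq_iff)
  ultimately have S_lin: "linear S" by simp
  have S_le: "norm (S v) \<le> norm v" for v
  proof -
    have "norm (S v) \<le> norm (?Bt (r (P v)))" unfolding S_def by (rule le)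
    also have "\<dots> = norm (P v)" using P(2) by (subst r(2)) auto
    finally show ?thesis using P(4)[of v] by simp
  qed
  \<comment> \<open>The choice of preimage under B^T is immaterial: two preimages differ by an
    element of the kernel of B^T, and the norm comparison puts it into the kernel of A^T.\<close>
  have S_Bt: "S (?Bt y) = ?At y" for y
  proof -
    have "norm (?At (r (?Bt y) - y)) \<le> norm (?Bt (r (?Bt y) - y))" by (rule le)
    also have "\<dots> = 0" by (simp add: linear_diff[OF Bt] r(2))
    finally show ?thesis by (simp add: S_def P(3) linear_diff[OF At])
  qed
  define T where "T = transpose (matrix S)"
  have mS: "matrix S *v v = S v" for v using fun_cong[OF matrix_vector_mul(2)[OF S_lin]] by simp
  have Tv: "T *v z = z v* matrix S" for z by (simp add: T_def)
  have "transpose A = matrix S ** transpose B"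
    by (simp add: matrix_eq matrix_vector_mul_assoc[symmetric] mS S_Bt)
  then have "A = B ** T" by (metis T_def matrix_transpose_mul transpose_transpose)
  \<comment> \<open>The bound passes from S to its transpose T: |T z|^2 = z . S (T z) \<le> |z| |T
    z|.\<close>
  moreover have "norm (T *v z) \<le> norm z" for z
  proof (cases "T *v z = 0")
    case False
    have "(T *v z) \<bullet> (T *v z) = z \<bullet> S (T *v z)"
      by (subst (1) Tv) (simp add: dot_lmul_matrix mS)
    also have "\<dots> \<le> norm z * norm (S (T *v z))" by (rule norm_cauchy_schwarz)
    also have "\<dots> \<le> norm z * norm (T *v z)" by (intro mult_left_mono S_le) simp
    finally have "norm (T *v z) * norm (T *v z) \<le> norm z * norm (T *v z)"
      by (simp add: power2_norm_eq_inner[symmetric] power2_eq_square)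
    then show ?thesis using False by (simp add: mult_le_cancel_right)
  qed simp
  ultimately show ?thesis by (rule that)
qed

section \<open>Contractions as the convex hull of the orthogonal matrices\<close>

definition contractions :: "(real ^ 'q ^ 'q) set" where
  "contractions = {T. \<forall>z. norm (T *v z) \<le> norm z}"

text \<open>The rank-one matrix w z^T; adding a multiple of it changes the image of z and leaves the
  orthogonal complement of z alone.\<close>

definition outer :: "real ^ 'q \<Rightarrow> real ^ 'q \<Rightarrow> real ^ 'q ^ 'q" where
  "outer w z = (\<chi> i j. w $ i * z $ j)"

lemma outer_mult: "outer w z *v x = (z \<bullet> x) *\<^sub>R w"
  by (simp add: outer_def vec_eq_iff matrix_vector_mult_def inner_vec_def sum_distrib_left ac_simps)

lemma convex_contractions: "convex contractions"
proof (rule convexI)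
  fix S T :: "real ^ 'q ^ 'q" and u v :: real
  assume ST: "S \<in> contractions" "T \<in> contractions" and uv: "0 \<le> u" "0 \<le> v" "u + v = 1"
  have "norm ((u *\<^sub>R S + v *\<^sub>R T) *v z) \<le> norm z" for z
  proof -
    have "norm ((u *\<^sub>R S + v *\<^sub>R T) *v z) = norm (u *\<^sub>R (S *v z) + v *\<^sub>R (T *v z))"
      by (simp add: matrix_vector_mult_add_rdistrib scaleR_matrix_vector_assoc)
    also have "\<dots> \<le> u * norm (S *v z) + v * norm (T *v z)"
      using uv by (intro order_trans[OF norm_triangle_ineq]) simp
    also have "\<dots> \<le> u * norm z + v * norm z"
      using uv ST by (intro add_mono mult_left_mono) (auto simp: contractions_def)
    also have "\<dots> = norm z" using uv by (simp add: distrib_right[symmetric])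
    finally show ?thesis .
  qed
  then show "u *\<^sub>R S + v *\<^sub>R T \<in> contractions" by (simp add: contractions_def)
qed

lemma continuous_on_matrix_vector_mult_left:
  "continuous_on UNIV (\<lambda>T :: real ^ 'q ^ 'd. T *v z)"
  by (intro linear_continuous_on linear_conv_bounded_linear[THEN iffD1] linearI)
    (simp_all add: matrix_vector_mult_add_rdistrib scaleR_matrix_vector_assoc)

text \<open>The norm of the matrix type is the Euclidean norm of the entries, whereas the Lipschitz
  conditions are in operator norm. A crude dimensional factor suffices, as it only enlarges a
  Lipschitz constant.\<close>

lemma norm_matrix_le_onorm:
  fixes A :: "real ^ 'q ^ 'd"
  shows "norm A \<le> real CARD('d) * real CARD('q) * onorm ((*v) A)"
proof -
  have "norm A \<le> (\<Sum>i\<in>UNIV. norm (A $ i))" unfolding norm_vec_def by (rule L2_set_le_sum) simp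
  also have "\<dots> \<le> (\<Sum>i\<in>(UNIV::'d set). \<Sum>j\<in>(UNIV::'q set). \<bar>A $ i $ j\<bar>)"
    by (intro sum_mono norm_le_l1_cart)
  also have "\<dots> \<le> (\<Sum>i\<in>(UNIV::'d set). \<Sum>j\<in>(UNIV::'q set). onorm ((*v) A))"
    by (intro sum_mono matrix_component_le_onorm)
  finally show ?thesis by simp
qed

lemma compact_contractions: "compact (contractions :: (real ^ 'q ^ 'q) set)"
proof (rule compact_eq_bounded_closed[THEN iffD2], intro conjI)
  have "norm T \<le> real CARD('q) * real CARD('q) * 1" if "T \<in> contractions" for T :: "real ^ 'q ^ 'q"
  proof -
    have "onorm ((*v) T) \<le> 1" using that by (intro onorm_bound) (auto simp: contractions_def)
    then show ?thesis
      by (intro order_trans[OF norm_matrix_le_onorm] mult_left_mono) auto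
  qed
  then show "bounded (contractions :: (real ^ 'q ^ 'q) set)" by (auto simp: bounded_iff)
  have "contractions = (\<Inter>z. {T :: real ^ 'q ^ 'q. norm (T *v z) \<le> norm z})"
    by (auto simp: contractions_def)
  also have "closed \<dots>"
    by (intro closed_INT ballI closed_Collect_le continuous_on_norm continuous_on_const
        continuous_on_matrix_vector_mult_left)
  finally show "closed (contractions :: (real ^ 'q ^ 'q) set)" .
qed

text \<open>If \<open>T\<close> shrinks some vector, let \<open>z\<close> be a unit vector that it shrinks most. Then \<open>T\<close> maps
  \<open>z\<^sup>\<bottom>\<close> into \<open>(T z)\<^sup>\<bottom>\<close>, so \<open>T\<close> can be perturbed in both directions along \<open>T z\<close> or, if \<open>T z = 0\<close>,
  along a vector orthogonal to the range of \<open>T\<close>.\<close>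

lemma extreme_contraction_isometry:
  fixes T :: "real ^ 'q ^ 'q"
  assumes T: "T extreme_point_of contractions"
  shows "norm (T *v x) = norm x"
proof (rule ccontr)
  assume neq: "norm (T *v x) \<noteq> norm x"
  have T_le: "norm (T *v z) \<le> norm z" for z using T by (auto simp: extreme_point_of_def contractions_def)
  have "x \<noteq> 0" using neq by auto
  let ?S = "sphere (0 :: real ^ 'q) 1"
  have "continuous_on ?S (\<lambda>z. norm (T *v z))"
    by (intro continuous_on_norm linear_continuous_on linear_conv_bounded_linear[THEN iffD1]) simp
  moreover have "x /\<^sub>R norm x \<in> ?S" using \<open>x \<noteq> 0\<close> by simp
  ultimately obtain z where z: "z \<in> ?S" and min: "\<And>y. y \<in> ?S \<Longrightarrow> norm (T *v z) \<le> norm (T *v y)"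
    using continuous_attains_inf[OF compact_sphere, of 0 1 "\<lambda>z. norm (T *v z)"] by blast
  have z1 [simp]: "norm z = 1" "z \<bullet> z = 1" using z by (auto simp: norm_eq_1)
  have min': "norm (T *v z) * norm y \<le> norm (T *v y)" for y
  proof (cases "y = 0")
    case False
    have "norm (T *v z) \<le> norm (T *v (y /\<^sub>R norm y))" using False by (intro min) simp
    also have "\<dots> = norm (T *v y) / norm y" by (simp add: matrix_vector_mult_scaleR divide_inverse_commute)
    finally show ?thesis using False by (simp add: le_divide_eq)
  qed simp
  define l where "l = (T *v z) \<bullet> (T *v z)"
  have l0: "0 \<le> l" by (simp add: l_def)
  have min2: "l * (y \<bullet> y) \<le> (T *v y) \<bullet> (T *v y)" for y
    using power_mono[OF min'[of y], of 2] unfolding l_def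
    by (simp add: power_mult_distrib power2_norm_eq_inner)
  have le2: "(T *v y) \<bullet> (T *v y) \<le> y \<bullet> y" for y using T_le[of y] by (simp add: norm_le)
  have "norm (T *v z) < 1"
  proof -
    have "norm (T *v z) * norm x < norm x" using min'[of x] T_le[of x] neq by simp
    then show ?thesis using \<open>x \<noteq> 0\<close> by simp
  qed
  then have l1: "l < 1" unfolding l_def by (simp add: power2_norm_eq_inner[symmetric] power_less_one_iff abs_square_less_1)
  have orth: "(T *v z) \<bullet> (T *v y) = 0" if "z \<bullet> y = 0" for y
  proof (rule ccontr)
    let ?p = "(T *v z) \<bullet> (T *v y)" and ?n = "1 + (T *v y) \<bullet> (T *v y)"
    assume "?p \<noteq> 0"
    have n: "0 < ?n" by (simp add: add_pos_nonneg)
    \<comment> \<open>Apart from the summand 1 that keeps \<open>?n\<close> positive, this minimizes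
      2 t p + t^2 |T y|^2. The value is at most - p^2 / \<open>?n\<close> < 0, which contradicts the
      minimality of z.\<close>
    define t where "t = - ?p / ?n"
    have "(z + t *\<^sub>R y) \<bullet> (z + t *\<^sub>R y) = 1 + t\<^sup>2 * (y \<bullet> y)"
      using that by (simp add: inner_add_left inner_add_right inner_commute[of y z] power2_eq_square)
    moreover have "(T *v (z + t *\<^sub>R y)) \<bullet> (T *v (z + t *\<^sub>R y)) = l + 2 * t * ?p + t\<^sup>2 * ((T *v y) \<bullet> (T *v y))"
      by (simp add: l_def matrix_vector_right_distrib matrix_vector_mult_scaleR inner_add_left inner_add_right
          inner_commute[of "T *v y" "T *v z"] power2_eq_square distrib_left)
    ultimately have "l * (1 + t\<^sup>2 * (y \<bullet> y)) \<le> l + 2 * t * ?p + t\<^sup>2 * ((T *v y) \<bullet> (T *v y))"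
      using min2[of "z + t *\<^sub>R y"] by simp
    then have "l * (t\<^sup>2 * (y \<bullet> y)) \<le> 2 * t * ?p + t\<^sup>2 * ((T *v y) \<bullet> (T *v y))"
      by (simp add: distrib_left)
    moreover have "0 \<le> l * (t\<^sup>2 * (y \<bullet> y))" using l0 by simp
    moreover have "2 * t * ?p + t\<^sup>2 * ((T *v y) \<bullet> (T *v y)) < 0"
    proof -
      have "t\<^sup>2 * ((T *v y) \<bullet> (T *v y)) \<le> t\<^sup>2 * ?n" by (simp add: algebra_simps)
      also have "\<dots> = - t * ?p" using n by (simp add: t_def power2_eq_square)
      finally have "2 * t * ?p + t\<^sup>2 * ((T *v y) \<bullet> (T *v y)) \<le> t * ?p" by simp
      also have "\<dots> = - (?p\<^sup>2 / ?n)" by (simp add: t_def power2_eq_square)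
      also have "\<dots> < 0" using n \<open>?p \<noteq> 0\<close> by simp
      finally show ?thesis .
    qed
    ultimately show False by linarith
  qed
  obtain w where w: "w \<noteq> 0" and w_orth: "\<And>y. z \<bullet> y = 0 \<Longrightarrow> w \<bullet> (T *v y) = 0"
    and w_bound: "\<And>s. \<bar>s\<bar> = 1 \<Longrightarrow> (T *v z + s *\<^sub>R w) \<bullet> (T *v z + s *\<^sub>R w) \<le> 1"
  proof (cases "T *v z = 0")
    case True
    have "\<not> inj ((*v) T)"
      using True z1 by (metis injD matrix_vector_mult_0_right norm_zero zero_neq_one)
    then have "\<not> surj ((*v) T)" using linear_surjective_imp_injective[of "(*v) T"] by auto
    then have "span (range ((*v) T)) \<noteq> UNIV"
      by (metis linear_subspace_image matrix_vector_mul_linear span_eq_iff subspace_UNIV)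
    then obtain a where a: "a \<noteq> 0" "\<And>v. v \<in> span (range ((*v) T)) \<Longrightarrow> a \<bullet> v = 0"
      using span_not_univ_subset_hyperplane[of "range ((*v) T)"] span_not_UNIV_orthogonal by metis
    show ?thesis
    proof (rule that[of "a /\<^sub>R norm a"])
      show "a /\<^sub>R norm a \<noteq> 0" using a by simp
      show "(a /\<^sub>R norm a) \<bullet> (T *v y) = 0" for y using a(2)[of "T *v y"] by (simp add: span_base)
      show "(T *v z + s *\<^sub>R (a /\<^sub>R norm a)) \<bullet> (T *v z + s *\<^sub>R (a /\<^sub>R norm a)) \<le> 1" if "\<bar>s\<bar> = 1" for s
        using that a(1) True by (simp add: power2_norm_eq_inner[symmetric] dot_square_norm power2_eq_square abs_if split: if_splits)
    qed
  next
    case False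
    \<comment> \<open>With this e one gets (1 + e)^2 l \<le> (1 + 4 e) l = (2 - l) l = 1 - (1 - l)^2
      \<le> 1, so stretching T z by the factor 1 + e keeps it in the unit ball.\<close>
    define e where "e = (1 - l) / 4"
    have e: "0 < e" "e \<le> 1 / 4" using l0 l1 by (auto simp: e_def)
    show ?thesis
    proof (rule that[of "e *\<^sub>R (T *v z)"])
      show "e *\<^sub>R (T *v z) \<noteq> 0" using False e by simp
      show "(e *\<^sub>R (T *v z)) \<bullet> (T *v y) = 0" if "z \<bullet> y = 0" for y using orth[OF that] by simp
      fix s :: real assume s: "\<bar>s\<bar> = 1"
      have "(T *v z + s *\<^sub>R e *\<^sub>R (T *v z)) \<bullet> (T *v z + s *\<^sub>R e *\<^sub>R (T *v z)) = (1 + s * e)\<^sup>2 * l"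
        by (simp add: l_def inner_add_left inner_add_right power2_eq_square algebra_simps)
      also have "\<dots> \<le> (1 + e)\<^sup>2 * l"
        using s e l0 by (intro mult_right_mono power_mono) (auto simp: abs_if split: if_splits)
      also have "\<dots> \<le> (1 + 4 * e) * l"
      proof (rule mult_right_mono[OF _ l0])
        have "e * e \<le> e * (1 / 4)" using e by (intro mult_left_mono) auto
        then show "(1 + e)\<^sup>2 \<le> 1 + 4 * e" using e by (simp add: power2_eq_square algebra_simps)
      qed
      also have "\<dots> = 1 - (1 - l)\<^sup>2"
      proof -
        have "1 + 4 * e = 2 - l" by (simp add: e_def)
        then show ?thesis by (simp only:) (simp add: power2_eq_square algebra_simps)
      qed
      also have "\<dots> \<le> 1" by simp
      finally show "(T *v z + s *\<^sub>R e *\<^sub>R (T *v z)) \<bullet> (T *v z + s *\<^sub>R e *\<^sub>R (T *v z)) \<le> 1" .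
    qed
  qed
  \<comment> \<open>For y = c z + y' with y' orthogonal to z, the perturbed matrix still sends the
    two parts to orthogonal vectors. Pythagoras bounds them separately: the image of z by
    \<open>w_bound\<close>, that of y' because T itself is a contraction.\<close>
  have mem: "T + s *\<^sub>R outer w z \<in> contractions" if s: "\<bar>s\<bar> = 1" for s
    unfolding contractions_def
  proof (rule CollectI, rule allI)
    fix y
    define c where "c = z \<bullet> y"
    define y' where "y' = y - c *\<^sub>R z"
    have y: "y = c *\<^sub>R z + y'" and zy': "z \<bullet> y' = 0" by (auto simp: y'_def c_def inner_diff_right)
    let ?v = "T *v z + s *\<^sub>R w"
    have "(T + s *\<^sub>R outer w z) *v y = c *\<^sub>R ?v + T *v y'"
      unfolding y using zy'
      by (simp add: matrix_vector_mult_add_rdistrib scaleR_matrix_vector_assoc[symmetric] outer_mult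
          matrix_vector_right_distrib matrix_vector_mult_scaleR algebra_simps)
    moreover have vy': "?v \<bullet> (T *v y') = 0" using orth[OF zy'] w_orth[OF zy'] by (simp add: inner_add_left)
    moreover have "(T *v y') \<bullet> ?v = 0" using vy' by (simp only: inner_commute)
    ultimately have "((T + s *\<^sub>R outer w z) *v y) \<bullet> ((T + s *\<^sub>R outer w z) *v y)
        = c\<^sup>2 * (?v \<bullet> ?v) + (T *v y') \<bullet> (T *v y')"
      by (simp only: inner_add_left[of "c *\<^sub>R ?v"] inner_add_right[of _ "c *\<^sub>R ?v"])
        (simp add: power2_eq_square)
    also have "\<dots> \<le> c\<^sup>2 * 1 + y' \<bullet> y'" by (intro add_mono mult_left_mono w_bound s le2) auto
    also have "\<dots> = y \<bullet> y"
      unfolding y using zy' by (simp add: inner_add_left inner_add_right inner_commute[of y' z] power2_eq_square)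
    finally show "norm ((T + s *\<^sub>R outer w z) *v y) \<le> norm y" by (simp add: norm_le)
  qed
  have "T = midpoint (T + 1 *\<^sub>R outer w z) (T + (-1) *\<^sub>R outer w z)"
    by (simp add: midpoint_def scaleR_2[symmetric])
  moreover have "T + 1 *\<^sub>R outer w z \<noteq> T + (-1) *\<^sub>R outer w z"
  proof
    assume "T + 1 *\<^sub>R outer w z = T + (-1) *\<^sub>R outer w z"
    then have "2 *\<^sub>R outer w z = 0" by (simp add: scaleR_2 eq_neg_iff_add_eq_0)
    then have "outer w z *v z = 0" by simp
    then show False using w by (simp add: outer_mult)
  qed
  ultimately have "T \<in> open_segment (T + 1 *\<^sub>R outer w z) (T + (-1) *\<^sub>R outer w z)"
    by (metis midpoint_in_open_segment)
  then show False
    using T mem[of 1] mem[of "-1"] by (auto simp: extreme_point_of_def)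
qed

text \<open>By Minkowski's theorem a compact convex set in finite dimension is the hull of its
  extreme points, and a norm-preserving matrix is orthogonal.\<close>

lemma contractions_eq_convex_hull:
  "contractions = convex hull {T :: real ^ 'q ^ 'q. orthogonal_transformation ((*v) T)}"
proof
  let ?O = "{T :: real ^ 'q ^ 'q. orthogonal_transformation ((*v) T)}"
  have "contractions = convex hull {T :: real ^ 'q ^ 'q. T extreme_point_of contractions}"
    by (intro Krein_Milman_Minkowski compact_contractions convex_contractions)
  also have "\<dots> \<subseteq> convex hull ?O"
    by (intro hull_mono) (auto simp: orthogonal_transformation extreme_contraction_isometry)
  finally show "contractions \<subseteq> convex hull ?O" .
  show "convex hull ?O \<subseteq> contractions"
    by (intro hull_minimal convex_contractions) (auto simp: contractions_def orthogonal_transformation)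
qed

section \<open>Isotropic noise\<close>

lemma orthogonal_transformation_borel_measurable:
  fixes f :: "'a::euclidean_space \<Rightarrow> 'a"
  shows "orthogonal_transformation f \<Longrightarrow> f \<in> borel_measurable borel"
  using orthogonal_transformation_linear[of f]
  by (intro borel_measurable_continuous_onI linear_continuous_on) (simp add: linear_conv_bounded_linear)

text \<open>Uniqueness of Haar measure, specialised: Fubini and translation invariance give
  \<open>\<lambda> B * \<nu> A = \<nu> B * \<lambda> A\<close> for \<open>\<nu> = f \<lambda>\<close>, and \<open>\<nu> B = \<lambda> B\<close> for the unit ball \<open>B\<close>. The library has
  the invariance only for index types of class \<^class>\<open>wellorder\<close>.\<close>

lemma lborel_distr_orthogonal_transformation:
  fixes f :: "'a::euclidean_space \<Rightarrow> 'a"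
  assumes f: "orthogonal_transformation f"
  shows "distr lborel borel f = lborel"
proof (rule measure_eqI)
  let ?N = "distr lborel borel f"
  have lin: "linear f" using f by (rule orthogonal_transformation_linear)
  note [measurable] = orthogonal_transformation_borel_measurable[OF f]
  show "sets ?N = sets lborel" by simp
  fix A :: "'a set" assume "A \<in> sets ?N"
  then have [measurable]: "A \<in> sets borel" by simp
  obtain g where g: "orthogonal_transformation g" "\<And>x. f (g x) = x" "\<And>x. g (f x) = x"
    using orthogonal_transformation_inv[OF f] orthogonal_transformation_bij[OF f]
    by (metis bij_inv_eq_iff)
  have lborel_shift: "(\<integral>\<^sup>+x. u x \<partial>lborel) = (\<integral>\<^sup>+x. u (a + s *\<^sub>R x) \<partial>lborel)"
    if "s = 1 \<or> s = -1" "u \<in> borel_measurable borel" for u :: "'a \<Rightarrow> ennreal" and a s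
  proof -
    have "(\<integral>\<^sup>+x. u x \<partial>lborel) = (\<integral>\<^sup>+x. u x \<partial>(density (distr lborel borel (\<lambda>x. a + s *\<^sub>R x)) (\<lambda>_. \<bar>s\<bar> ^ DIM('a))))"
      using lborel_affine[of s a] that(1) by auto
    also have "density (distr lborel borel (\<lambda>x. a + s *\<^sub>R x)) (\<lambda>_. \<bar>s\<bar> ^ DIM('a)) = distr lborel borel (\<lambda>x. a + s *\<^sub>R x)"
      using that(1) by (auto simp: density_1)
    finally show ?thesis using that(2) by (simp add: nn_integral_distr)
  qed
  \<comment> \<open>Since f is linear with inverse g, translating by a after f amounts to
    translating by g a before it.\<close>
  have nu_shift: "(\<integral>\<^sup>+x. u x \<partial>?N) = (\<integral>\<^sup>+x. u (x - a) \<partial>?N)" if [measurable]: "u \<in> borel_measurable borel" for u :: "'a \<Rightarrow> ennreal" and a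
  proof -
    have "(\<integral>\<^sup>+x. u x \<partial>?N) = (\<integral>\<^sup>+x. u (f x) \<partial>lborel)" by (simp add: nn_integral_distr)
    also have "\<dots> = (\<integral>\<^sup>+x. u (f (- g a + 1 *\<^sub>R x)) \<partial>lborel)" by (rule lborel_shift) auto
    also have "\<dots> = (\<integral>\<^sup>+x. u (f x - a) \<partial>lborel)" using lin g by (simp add: linear_diff)
    also have "\<dots> = (\<integral>\<^sup>+x. u (x - a) \<partial>?N)" by (simp add: nn_integral_distr)
    finally show ?thesis .
  qed
  let ?B = "ball (0::'a) 1"
  have [measurable]: "?B \<in> sets borel" by simp
  have fB: "f -` ?B = ?B" using f by (auto simp: orthogonal_transformation)
  have "sigma_finite_measure ?N"
  proof (rule sigma_finite_measure.intro, intro exI conjI)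
    let ?S = "range (\<lambda>n::nat. ball (0::'a) (real n))"
    show "countable ?S" "?S \<subseteq> sets ?N" by auto
    show "\<Union>?S = space ?N" by (auto intro: reals_Archimedean2)
    have "f -` ball 0 r = ball 0 r" for r using f by (auto simp: orthogonal_transformation)
    then show "\<forall>a\<in>?S. emeasure ?N a \<noteq> \<infinity>"
      using emeasure_lborel_ball_finite[of "0::'a"] by (auto simp: emeasure_distr less_top[symmetric])
  qed
  then interpret N: sigma_finite_measure ?N .
  interpret pair_sigma_finite lborel ?N by unfold_locales
  have "emeasure lborel ?B * emeasure ?N A = (\<integral>\<^sup>+y. (\<integral>\<^sup>+x. indicator A y * indicator ?B x \<partial>lborel) \<partial>?N)"
  proof -
    have "(\<integral>\<^sup>+x. indicator A y * indicator ?B x \<partial>lborel) = indicator A y * emeasure lborel ?B" for y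
      by (rule nn_integral_cmult_indicator) simp
    moreover have "(\<integral>\<^sup>+y. indicator A y * emeasure lborel ?B \<partial>?N) = emeasure ?N A * emeasure lborel ?B"
      by (subst nn_integral_multc) simp_all
    ultimately show ?thesis by (simp only: mult.commute)
  qed
  also have "\<dots> = (\<integral>\<^sup>+y. (\<integral>\<^sup>+x. indicator A y * indicator ?B (y + 1 *\<^sub>R x) \<partial>lborel) \<partial>?N)"
    by (rule nn_integral_cong, rule lborel_shift) (simp, measurable)
  also have "\<dots> = (\<integral>\<^sup>+x. (\<integral>\<^sup>+y. indicator A y * indicator ?B (y + x) \<partial>?N) \<partial>lborel)"
    by (subst Fubini'[symmetric]) (simp_all add: split_beta')
  also have "\<dots> = (\<integral>\<^sup>+x. (\<integral>\<^sup>+y. indicator A (y - x) * indicator ?B y \<partial>?N) \<partial>lborel)"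
  proof (rule nn_integral_cong)
    fix x
    show "(\<integral>\<^sup>+y. indicator A y * indicator ?B (y + x) \<partial>?N) = (\<integral>\<^sup>+y. indicator A (y - x) * indicator ?B y \<partial>?N)"
      using nu_shift[of "\<lambda>y. indicator A y * indicator ?B (y + x)" x] by simp
  qed
  also have "\<dots> = (\<integral>\<^sup>+y. (\<integral>\<^sup>+x. indicator A (y - x) * indicator ?B y \<partial>lborel) \<partial>?N)"
    by (subst Fubini'[symmetric]) (simp_all add: split_beta')
  \<comment> \<open>Here x enters as y - x, so the substitution combines a translation with a
    reflection, the case s = -1 of \<open>lborel_shift\<close>.\<close>
  also have "\<dots> = (\<integral>\<^sup>+y. (\<integral>\<^sup>+x. indicator A x * indicator ?B y \<partial>lborel) \<partial>?N)"
  proof (rule nn_integral_cong)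
    fix y
    show "(\<integral>\<^sup>+x. indicator A (y - x) * indicator ?B y \<partial>lborel) = (\<integral>\<^sup>+x. indicator A x * indicator ?B y \<partial>lborel)"
      using lborel_shift[of "-1" "\<lambda>x. indicator A x * indicator ?B y" y] by simp
  qed
  also have "\<dots> = emeasure ?N ?B * emeasure lborel A"
  proof -
    have "(\<integral>\<^sup>+x. indicator A x * indicator ?B y \<partial>lborel) = emeasure lborel A * indicator ?B y" for y
      by (subst nn_integral_multc) simp_all
    moreover have "(\<integral>\<^sup>+y. emeasure lborel A * indicator ?B y \<partial>?N) = emeasure lborel A * emeasure ?N ?B"
      by (rule nn_integral_cmult_indicator) simp
    ultimately show ?thesis by (simp only: mult.commute)
  qed
  also have "emeasure ?N ?B = emeasure lborel ?B" by (simp add: emeasure_distr fB)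
  finally have "emeasure lborel ?B * emeasure ?N A = emeasure lborel ?B * emeasure lborel A" .
  moreover have "emeasure lborel ?B \<noteq> 0" "emeasure lborel ?B \<noteq> top"
    using emeasure_lborel_ball_finite[of "0::'a" 1] content_ball_pos[of 1 "0::'a"]
    by (auto simp: measure_def)
  ultimately show "emeasure ?N A = emeasure lborel A"
    by (simp add: ennreal_mult_cancel_left)
qed

text \<open>In this form the density depends on z only through its norm, the source of its rotation
  invariance.\<close>

lemma gaussian_density_eq:
  fixes z :: "real ^ 'q"
  assumes "0 < v"
  shows "gaussian_density v z = (1 / sqrt (2 * pi * v)) ^ CARD('q) * exp (- (norm z)\<^sup>2 / (2 * v))"
proof -
  have "(norm z)\<^sup>2 = (\<Sum>i\<in>UNIV. (z $ i)\<^sup>2)"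
    unfolding power2_norm_eq_inner by (simp add: inner_vec_def power2_eq_square)
  then show ?thesis
    using assms
    by (simp add: gaussian_density_def normal_density_def prod.distrib exp_sum[symmetric]
        sum_negf sum_divide_distrib prod_dividef power_one_over)
qed

lemma borel_measurable_gaussian_density [measurable]: "gaussian_density v \<in> borel_measurable borel"
  unfolding gaussian_density_def by measurable

lemma gaussian_density_Basis:
  fixes z :: "real ^ 'q"
  shows "gaussian_density v z = (\<Prod>b\<in>Basis. normal_density 0 (sqrt v) (z \<bullet> b))"
proof -
  have B: "Basis = (\<lambda>i. axis i 1 :: real ^ 'q) ` UNIV" by (auto simp: Basis_vec_def)
  have inj: "inj (\<lambda>i. axis i 1 :: real ^ 'q)" by (rule injI) (simp add: axis_eq_axis)
  show ?thesis
    unfolding B by (subst prod.reindex[OF inj]) (simp add: gaussian_density_def inner_axis)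
qed

text \<open>|z|^2 is the sum of the squared coordinates, and each summand times the density is a
  product over coordinates: a one-dimensional second moment in one factor, total masses in the
  others.\<close>

lemma gaussian_second_moment:
  assumes "0 < v"
  shows "(\<integral>\<^sup>+ z. ennreal ((norm (z :: real ^ 'q))\<^sup>2) * ennreal (gaussian_density v z) \<partial>lborel) < \<infinity>"
proof -
  let ?n = "normal_density 0 (sqrt v)"
  have sq: "0 < sqrt v" using assms by simp
  have fin: "(\<integral>\<^sup>+ t. ennreal (t\<^sup>2 * ?n t) \<partial>lborel) < \<infinity>" "(\<integral>\<^sup>+ t. ennreal (?n t) \<partial>lborel) < \<infinity>"
    using normal_moment_even[OF sq, of 0 1] integrable_normal_density[OF sq, of 0]
    by (auto simp: has_bochner_integral_iff integrable_iff_bounded mult.commute)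
  have nonneg: "0 \<le> gaussian_density v z" for z :: "real ^ 'q"
    by (simp add: gaussian_density_def prod_nonneg)
  have "(\<integral>\<^sup>+ z. ennreal ((norm (z :: real ^ 'q))\<^sup>2) * ennreal (gaussian_density v z) \<partial>lborel)
      = (\<integral>\<^sup>+ z. (\<Sum>b\<in>Basis. ennreal (((z :: real ^ 'q) \<bullet> b)\<^sup>2 * gaussian_density v z)) \<partial>lborel)"
  proof (rule nn_integral_cong)
    fix z :: "real ^ 'q"
    have "(norm z)\<^sup>2 = (\<Sum>b\<in>Basis. (z \<bullet> b)\<^sup>2)"
      unfolding power2_norm_eq_inner by (subst euclidean_inner) (simp add: power2_eq_square)
    then show "ennreal ((norm z)\<^sup>2) * ennreal (gaussian_density v z)
        = (\<Sum>b\<in>Basis. ennreal ((z \<bullet> b)\<^sup>2 * gaussian_density v z))"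
      by (simp add: ennreal_mult[symmetric] nonneg sum_nonneg sum_distrib_right)
  qed
  also have "\<dots> = (\<Sum>b\<in>Basis. \<integral>\<^sup>+ z. ennreal (((z :: real ^ 'q) \<bullet> b)\<^sup>2 * gaussian_density v z) \<partial>lborel)"
    by (intro nn_integral_sum) simp
  also have "\<dots> < \<infinity>"
  proof (subst infinity_ennreal_def, subst ennreal_sum_less_top, simp, rule ballI)
    fix c :: "real ^ 'q" assume c: "c \<in> Basis"
    let ?f = "\<lambda>b t. ennreal (if b = c then t\<^sup>2 * ?n t else ?n t)"
    have "ennreal ((z \<bullet> c)\<^sup>2 * gaussian_density v z) = (\<Prod>b\<in>Basis. ?f b (z \<bullet> b))" for z
    proof -
      have "(z \<bullet> c)\<^sup>2 * gaussian_density v z = (\<Prod>b\<in>Basis. (if b = c then (z \<bullet> b)\<^sup>2 else 1) * ?n (z \<bullet> b))"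
        using c by (simp add: gaussian_density_Basis prod.distrib prod.delta)
      also have "\<dots> = (\<Prod>b\<in>Basis. (if b = c then (z \<bullet> b)\<^sup>2 * ?n (z \<bullet> b) else ?n (z \<bullet> b)))"
        by (intro prod.cong) auto
      finally show ?thesis by (simp add: prod_ennreal)
    qed
    then have "(\<integral>\<^sup>+ z. ennreal ((z \<bullet> c)\<^sup>2 * gaussian_density v z) \<partial>lborel)
        = (\<integral>\<^sup>+ z. (\<Prod>b\<in>Basis. ?f b (z \<bullet> b)) \<partial>lborel)" by simp
    also have "\<dots> = (\<Prod>b\<in>Basis. (\<integral>\<^sup>+ t. ?f b t \<partial>lborel))"
      by (intro nn_integral_lborel_prod) auto
    also have "\<dots> < top"
    proof -
      have "(\<integral>\<^sup>+ t. ?f b t \<partial>lborel) \<noteq> top" for b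
        using fin by (cases "b = c") simp_all
      then show ?thesis by (simp add: less_top[symmetric] ennreal_prod_eq_top)
    qed
    finally show "(\<integral>\<^sup>+ z. ennreal ((z \<bullet> c)\<^sup>2 * gaussian_density v z) \<partial>lborel) < top" .
  qed
  finally show ?thesis .
qed

text \<open>These are the properties of the Gaussian law on which the convexity argument rests: the
  moment makes Lipschitz functions integrable, the invariance drives the comparison.\<close>

locale isotropic_prob = prob_space \<gamma> for \<gamma> :: "(real ^ 'q) measure" +
  assumes sets_eq_borel [measurable_cong]: "sets \<gamma> = sets borel"
    and second_moment: "(\<integral>\<^sup>+ z. ennreal ((norm z)\<^sup>2) \<partial>\<gamma>) < \<infinity>"
    and distr_orthogonal: "\<And>f. orthogonal_transformation f \<Longrightarrow> distr \<gamma> borel f = \<gamma>"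

text \<open>Meant for an increment of variance v = h rescaled by c = 1 / sqrt h. With the
  pushforward kept as it is, no density of the rescaled law has to be computed: scaling commutes
  with orthogonal maps.\<close>

lemma isotropic_prob_gaussian:
  fixes c v :: real
  defines "\<gamma> \<equiv> distr (density lborel (\<lambda>z :: real ^ 'q. ennreal (gaussian_density v z))) borel ((*\<^sub>R) c)"
  assumes v: "0 < v" and prob: "prob_space (density lborel (\<lambda>z :: real ^ 'q. ennreal (gaussian_density v z)))"
  shows "isotropic_prob \<gamma>"
proof -
  let ?D = "density lborel (\<lambda>z :: real ^ 'q. ennreal (gaussian_density v z))"
  have orth: "distr ?D borel f = ?D" if f: "orthogonal_transformation f" for f
  proof -
    note [measurable] = orthogonal_transformation_borel_measurable[OF f]
    have "gaussian_density v z = gaussian_density v (f z)" for z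
      using f v by (simp add: gaussian_density_eq orthogonal_transformation)
    then have "distr ?D borel f = distr (density lborel (\<lambda>z. ennreal (gaussian_density v (f z)))) borel f"
      by simp
    also have "\<dots> = density (distr lborel borel f) (\<lambda>z. ennreal (gaussian_density v z))"
      by (rule density_distr[symmetric]) auto
    also have "\<dots> = ?D" by (simp add: lborel_distr_orthogonal_transformation[OF f])
    finally show ?thesis .
  qed
  have "prob_space \<gamma>" unfolding \<gamma>_def by (intro prob_space.prob_space_distr[OF prob]) simp
  moreover have "(\<integral>\<^sup>+ z. ennreal ((norm z)\<^sup>2) \<partial>\<gamma>) < \<infinity>"
  proof -
    have "(\<integral>\<^sup>+ z. ennreal ((norm z)\<^sup>2) \<partial>\<gamma>)
        = (\<integral>\<^sup>+ z. ennreal (c\<^sup>2) * (ennreal ((norm (z :: real ^ 'q))\<^sup>2) * ennreal (gaussian_density v z)) \<partial>lborel)"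
      by (simp add: \<gamma>_def nn_integral_distr nn_integral_density power_mult_distrib ennreal_mult ac_simps)
    also have "\<dots> = ennreal (c\<^sup>2) * (\<integral>\<^sup>+ z. ennreal ((norm (z :: real ^ 'q))\<^sup>2) * ennreal (gaussian_density v z) \<partial>lborel)"
      by (rule nn_integral_cmult) simp
    also have "\<dots> < \<infinity>"
      using gaussian_second_moment[OF v, where 'q = 'q] by (simp add: ennreal_mult_less_top)
    finally show ?thesis .
  qed
  moreover have "distr \<gamma> borel f = \<gamma>" if f: "orthogonal_transformation f" for f
  proof -
    note [measurable] = orthogonal_transformation_borel_measurable[OF f]
    have "distr \<gamma> borel f = distr ?D borel (\<lambda>z. f (c *\<^sub>R z))" by (simp add: \<gamma>_def distr_distr comp_def)
    also have "\<dots> = distr ?D borel (\<lambda>z. c *\<^sub>R f z)" by (simp add: orthogonal_transformation_scaleR[OF f])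
    also have "\<dots> = distr (distr ?D borel f) borel ((*\<^sub>R) c)" by (simp add: distr_distr comp_def)
    finally show ?thesis by (simp add: orth[OF f] \<gamma>_def)
  qed
  ultimately show ?thesis
    by (simp add: isotropic_prob_def isotropic_prob_axioms_def) (simp add: \<gamma>_def)
qed

lemma nn_integral_norm_finite:
  assumes "prob_space \<mu>" "sets \<mu> = sets borel" "(\<integral>\<^sup>+ x. ennreal ((norm x)\<^sup>2) \<partial>\<mu>) < \<infinity>"
  shows "(\<integral>\<^sup>+ x. ennreal (norm (x :: 'a :: euclidean_space)) \<partial>\<mu>) < \<infinity>"
proof -
  interpret prob_space \<mu> by fact
  have [measurable_cong]: "sets \<mu> = sets borel" by fact
  have "norm x \<le> 1 + (norm x)\<^sup>2" for x :: 'a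
  proof -
    have "2 * norm x \<le> 1 + (norm x)\<^sup>2" using sum_squares_bound[of 1 "norm x"] by simp
    then show ?thesis using norm_ge_zero[of x] by linarith
  qed
  then have "(\<integral>\<^sup>+ x. ennreal (norm x) \<partial>\<mu>) \<le> (\<integral>\<^sup>+ x. 1 + ennreal ((norm x)\<^sup>2) \<partial>\<mu>)"
    by (intro nn_integral_mono) (simp flip: ennreal_1 ennreal_plus)
  also have "\<dots> = 1 + (\<integral>\<^sup>+ x. ennreal ((norm x)\<^sup>2) \<partial>\<mu>)"
    by (subst nn_integral_add) (auto simp: emeasure_space_1)
  also have "\<dots> < \<infinity>" using assms(3) by simp
  finally show ?thesis .
qed

section \<open>Averages of convex functions over isotropic noise\<close>

context isotropic_prob
begin

lemma integrable_of_lipschitz: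
  assumes "\<And>x y. \<bar>\<psi> x - \<psi> y\<bar> \<le> C * norm (x - y)"
  shows "integrable \<gamma> \<psi>"
proof (rule integrable_lipschitz)
  show "finite_measure \<gamma>" by (rule finite_measure_axioms)
  show "(\<integral>\<^sup>+ z. ennreal (norm z) \<partial>\<gamma>) < \<infinity>"
    by (rule nn_integral_norm_finite[OF prob_space_axioms sets_eq_borel second_moment])
  show "\<psi> x - \<psi> y \<le> C * norm (x - y)" for x y using assms[of x y] by simp
qed (rule sets_eq_borel)

lemma integral_orthogonal:
  assumes "orthogonal_transformation f" "\<psi> \<in> borel_measurable borel"
  shows "(\<integral>z. \<psi> (f z) \<partial>\<gamma>) = (\<integral>z. (\<psi> z :: real) \<partial>\<gamma>)"
proof -
  note [measurable] = orthogonal_transformation_borel_measurable[OF assms(1)]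
  have "(\<integral>z. \<psi> z \<partial>\<gamma>) = (\<integral>z. \<psi> z \<partial>(distr \<gamma> borel f))" by (simp add: distr_orthogonal[OF assms(1)])
  also have "\<dots> = (\<integral>z. \<psi> (f z) \<partial>\<gamma>)" using assms(2) by (intro integral_distr) auto
  finally show ?thesis by simp
qed

text \<open>With T a convex combination of orthogonal S, convexity bounds \<psi> (T z) pointwise by
  the combination of the \<psi> (S z), and each of these has the same integral as \<psi>.\<close>

lemma integral_contraction_le:
  assumes cvx: "convex_on UNIV \<psi>" and lip: "\<And>x y. \<bar>\<psi> x - \<psi> y\<bar> \<le> C * norm (x - y)"
    and T: "\<And>z. norm (T *v z) \<le> norm z"
  shows "(\<integral>z. \<psi> (T *v z) \<partial>\<gamma>) \<le> (\<integral>z. \<psi> z \<partial>\<gamma>)"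
proof -
  have C: "0 \<le> C" using lip[of "axis undefined 1" 0] by (simp add: order_trans[OF abs_ge_zero])
  have int: "integrable \<gamma> (\<lambda>z. \<psi> (S *v z))" if "\<And>z. norm (S *v z) \<le> norm z" for S :: "real ^ 'q ^ 'q"
  proof (rule integrable_of_lipschitz)
    fix x y
    have "\<bar>\<psi> (S *v x) - \<psi> (S *v y)\<bar> \<le> C * norm (S *v (x - y))"
      using lip[of "S *v x" "S *v y"] by (simp add: matrix_vector_mult_diff_distrib)
    also have "\<dots> \<le> C * norm (x - y)" using C that by (intro mult_left_mono)
    finally show "\<bar>\<psi> (S *v x) - \<psi> (S *v y)\<bar> \<le> C * norm (x - y)" .
  qed
  have "T \<in> convex hull {T. orthogonal_transformation ((*v) T)}"
    using T by (simp add: contractions_eq_convex_hull[symmetric] contractions_def)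
  then obtain \<O> u where O: "finite \<O>" "\<O> \<subseteq> {T. orthogonal_transformation ((*v) T)}"
      and u: "\<And>S. S \<in> \<O> \<Longrightarrow> 0 \<le> u S" "sum u \<O> = 1" and T_eq: "(\<Sum>S\<in>\<O>. u S *\<^sub>R S) = T"
    unfolding convex_hull_explicit by blast
  have O_iso: "norm (S *v z) = norm z" if "S \<in> \<O>" for S z
    using O(2) that by (auto simp: orthogonal_transformation)
  have mono: "\<psi> (T *v z) \<le> (\<Sum>S\<in>\<O>. u S * \<psi> (S *v z))" for z
  proof -
    have "T *v z = (\<Sum>S\<in>\<O>. u S *\<^sub>R (S *v z))"
      unfolding T_eq[symmetric] using O(1)
      by (induction rule: finite_induct)
        (simp_all add: matrix_vector_mult_add_rdistrib scaleR_matrix_vector_assoc)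
    moreover have "\<O> \<noteq> {}" using u(2) by auto
    ultimately show ?thesis using convex_on_sum[OF O(1) _ cvx u(2) u(1)] by auto
  qed
  have "(\<integral>z. \<psi> (T *v z) \<partial>\<gamma>) \<le> (\<integral>z. (\<Sum>S\<in>\<O>. u S * \<psi> (S *v z)) \<partial>\<gamma>)"
    by (intro integral_mono int T mono Bochner_Integration.integrable_sum integrable_mult_right)
      (auto simp: O_iso)
  also have "\<dots> = (\<Sum>S\<in>\<O>. u S * (\<integral>z. \<psi> (S *v z) \<partial>\<gamma>))"
    by (subst Bochner_Integration.integral_sum) (auto intro!: int integrable_mult_right simp: O_iso)
  also have "\<dots> = (\<Sum>S\<in>\<O>. u S * (\<integral>z. \<psi> z \<partial>\<gamma>))"
    using O(2) by (intro sum.cong refl arg_cong2[where f = "(*)"] integral_orthogonal convex_on_UNIV_borel_measurable cvx) auto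
  also have "\<dots> = (\<integral>z. \<psi> z \<partial>\<gamma>)" using u(2) by (simp add: sum_distrib_right[symmetric])
  finally show ?thesis .
qed

text \<open>At y = b x and A = S x this is the function Q of the overview. The point and the matrix
  are separate arguments because monotonicity moves A at fixed y.\<close>

definition avg :: "(real ^ 'd \<Rightarrow> real) \<Rightarrow> real ^ 'd \<Rightarrow> real ^ 'q ^ 'd \<Rightarrow> real" where
  "avg \<phi> y A = (\<integral>z. \<phi> (y + A *v z) \<partial>\<gamma>)"

context
  fixes \<phi> :: "real ^ 'd \<Rightarrow> real" and C :: real
  assumes cvx: "convex_on UNIV \<phi>" and lip: "\<And>x y. \<phi> x - \<phi> y \<le> C * norm (x - y)"
begin

lemma lip_const_nonneg: "0 \<le> C"
  using lip[of "axis undefined 1" 0] lip[of 0 "axis undefined 1"] by simp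

lemma lip_abs: "\<bar>\<phi> x - \<phi> y\<bar> \<le> C * norm (x - y)"
  using lip[of x y] lip[of y x] by (simp add: abs_if norm_minus_commute)

lemma lip_affine: "\<bar>\<phi> (y + A *v z) - \<phi> (y + A *v z')\<bar> \<le> C * onorm ((*v) A) * norm (z - z')"
proof -
  have "\<bar>\<phi> (y + A *v z) - \<phi> (y + A *v z')\<bar> \<le> C * norm (A *v (z - z'))"
    using lip_abs[of "y + A *v z" "y + A *v z'"] by (simp add: matrix_vector_mult_diff_distrib)
  also have "\<dots> \<le> C * (onorm ((*v) A) * norm (z - z'))"
    using lip_const_nonneg by (intro mult_left_mono onorm) auto
  finally show ?thesis by (simp add: mult.assoc)
qed

lemma integrable_avg: "integrable \<gamma> (\<lambda>z. \<phi> (y + A *v z))"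
  using lip_affine by (rule integrable_of_lipschitz)

text \<open>Factor A = B T with a contraction T; the contraction inequality then applies to z
  \<mapsto> \<phi> (y + B z), which is again convex and Lipschitz.\<close>

lemma avg_mono:
  assumes "A \<preceq>\<^sub>m B"
  shows "avg \<phi> y A \<le> avg \<phi> y B"
proof -
  obtain T where T: "A = B ** T" "\<And>z. norm (T *v z) \<le> norm z"
    using matrix_order_contraction[OF assms] by blast
  have "convex_on UNIV (\<lambda>z. \<phi> (y + B *v z))"
  proof (rule convex_onI)
    fix t :: real and z z' assume "0 < t" "t < 1"
    have "y + B *v ((1 - t) *\<^sub>R z + t *\<^sub>R z') = (1 - t) *\<^sub>R (y + B *v z) + t *\<^sub>R (y + B *v z')"
      by (simp add: matrix_vector_right_distrib matrix_vector_mult_scaleR algebra_simps)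
    then show "\<phi> (y + B *v ((1 - t) *\<^sub>R z + t *\<^sub>R z')) \<le> (1 - t) * \<phi> (y + B *v z) + t * \<phi> (y + B *v z')"
      using convex_onD[OF cvx, of t "y + B *v z" "y + B *v z'"] \<open>0 < t\<close> \<open>t < 1\<close> by simp
  qed simp
  from integral_contraction_le[OF this lip_affine T(2)] show ?thesis
    by (simp add: avg_def T(1) matrix_vector_mul_assoc)
qed

text \<open>\<open>avg\<close> is jointly convex in the point and the matrix, by convexity of \<phi>
  at each fixed z. Affinity of b makes the mixed point exact, and matrix convexity with
  \<open>avg_mono\<close> replaces S at the mixed point by the mixture of matrices.\<close>

lemma convex_on_avg:
  assumes b: "affine_map b"
    and S: "\<And>x y r. r \<in> {0..1} \<Longrightarrow> S (r *\<^sub>R x + (1 - r) *\<^sub>R y) \<preceq>\<^sub>m r *\<^sub>R S x + (1 - r) *\<^sub>R S y"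
  shows "convex_on UNIV (\<lambda>x. avg \<phi> (b x) (S x))"
proof (rule convex_onI)
  fix t :: real and x y assume t: "0 < t" "t < 1"
  let ?A = "(1 - t) *\<^sub>R S x + t *\<^sub>R S y"
  obtain l c where l: "linear l" and b_eq: "\<And>x. b x = l x + c" using b by (auto simp: affine_map_def)
  have bxy: "b ((1 - t) *\<^sub>R x + t *\<^sub>R y) = (1 - t) *\<^sub>R b x + t *\<^sub>R b y"
    by (simp only: b_eq linear_add[OF l] linear_cmul[OF l]) (simp add: algebra_simps)
  have "avg \<phi> (b ((1 - t) *\<^sub>R x + t *\<^sub>R y)) (S ((1 - t) *\<^sub>R x + t *\<^sub>R y))
      \<le> avg \<phi> ((1 - t) *\<^sub>R b x + t *\<^sub>R b y) ?A"
    unfolding bxy using S[of "1 - t" x y] t by (intro avg_mono) simp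
  also have "\<dots> \<le> (\<integral>z. (1 - t) * \<phi> (b x + S x *v z) + t * \<phi> (b y + S y *v z) \<partial>\<gamma>)"
    unfolding avg_def
  proof (rule integral_mono)
    fix z
    have "(1 - t) *\<^sub>R b x + t *\<^sub>R b y + ?A *v z = (1 - t) *\<^sub>R (b x + S x *v z) + t *\<^sub>R (b y + S y *v z)"
      by (simp add: matrix_vector_mult_add_rdistrib scaleR_matrix_vector_assoc[symmetric] scaleR_add_right)
    then show "\<phi> ((1 - t) *\<^sub>R b x + t *\<^sub>R b y + ?A *v z)
        \<le> (1 - t) * \<phi> (b x + S x *v z) + t * \<phi> (b y + S y *v z)"
      using convex_onD[OF cvx, of t "b x + S x *v z" "b y + S y *v z"] t by simp
  qed (intro integrable_avg Bochner_Integration.integrable_add integrable_mult_right)+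
  also have "\<dots> = (1 - t) * avg \<phi> (b x) (S x) + t * avg \<phi> (b y) (S y)"
    unfolding avg_def
    by (subst Bochner_Integration.integral_add) (auto intro!: integrable_avg)
  finally show "avg \<phi> (b ((1 - t) *\<^sub>R x + t *\<^sub>R y)) (S ((1 - t) *\<^sub>R x + t *\<^sub>R y))
      \<le> (1 - t) * avg \<phi> (b x) (S x) + t * avg \<phi> (b y) (S y)" .
qed simp

end

end

section \<open>A countable dense family in \<open>L\<^sup>1\<close> of the unit interval\<close>

abbreviation unit_interval :: "real measure" where
  "unit_interval \<equiv> restrict_space lborel {0..1}"

lemma prob_space_unit_interval: "prob_space unit_interval"
  by (rule prob_spaceI) (simp add: emeasure_restrict_space)

abbreviation L1_dist :: "(real \<Rightarrow> real) \<Rightarrow> (real \<Rightarrow> real) \<Rightarrow> real" where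
  "L1_dist f g \<equiv> \<integral>v. \<bar>f v - g v\<bar> \<partial>unit_interval"

lemma integrable_unit_interval_bounded:
  fixes f :: "real \<Rightarrow> real"
  assumes "f \<in> borel_measurable unit_interval" "\<And>v. v \<in> {0..1} \<Longrightarrow> \<bar>f v\<bar> \<le> C"
  shows "integrable unit_interval f"
proof -
  interpret prob_space unit_interval by (rule prob_space_unit_interval)
  show ?thesis using assms by (intro integrable_const_bound[of _ C] AE_I2) auto
qed

text \<open>Lists of pairs of rationals form a countable type, which \<open>from_nat\<close>
  enumerates. Half-lines are enough: they generate the Borel sets and are stable under
  intersection.\<close>

definition rat_step :: "(rat \<times> rat) list \<Rightarrow> real \<Rightarrow> real" where
  "rat_step l v = (\<Sum>(c, a)\<leftarrow>l. of_rat c * indicator {..of_rat a} v)"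

lemma rat_step_measurable [measurable]: "rat_step l \<in> borel_measurable borel"
  by (induction l) (auto simp: rat_step_def)

lemma rat_step_unit_interval [measurable]: "rat_step l \<in> borel_measurable unit_interval"
  using rat_step_measurable[of l] by (intro measurable_restrict_space1) simp

lemma rat_step_append: "rat_step (l @ l') v = rat_step l v + rat_step l' v"
  by (simp add: rat_step_def)

lemma rat_step_scale: "rat_step (map (\<lambda>(c, a). (r * c, a)) l) v = of_rat r * rat_step l v"
  by (induction l) (auto simp: rat_step_def of_rat_mult algebra_simps)

lemma integrable_rat_step: "integrable unit_interval (rat_step l)"
proof (induction l)
  case Nil
  then show ?case by (simp add: rat_step_def)
next
  case (Cons p l)
  have "integrable unit_interval (rat_step [p])"
    by (rule integrable_unit_interval_bounded[of _ "\<bar>of_rat (fst p)\<bar>"])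
      (cases p; auto simp: rat_step_def split: split_indicator)+
  moreover have "rat_step (p # l) = (\<lambda>v. rat_step [p] v + rat_step l v)"
    by (auto simp: fun_eq_iff rat_step_append[symmetric])
  ultimately show ?case using Cons by simp
qed

text \<open>Membership in the L1 closure of the rational step functions. Integrability is stated
  explicitly because the Bochner integral in \<open>L1_dist\<close> defaults to 0 on nonintegrable
  functions, where a small value means nothing.\<close>

definition approximable :: "(real \<Rightarrow> real) \<Rightarrow> bool" where
  "approximable f \<longleftrightarrow> integrable unit_interval f \<and>
     (\<forall>e>0. \<exists>l. L1_dist f (rat_step l) < e)"

lemma approximable_limit:
  assumes f: "integrable unit_interval f"
    and s: "\<And>e. 0 < e \<Longrightarrow> \<exists>g. approximable g \<and> L1_dist f g < e"
  shows "approximable f"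
  unfolding approximable_def
proof (intro conjI allI impI f)
  fix e :: real assume "0 < e"
  then obtain g where g: "approximable g" "L1_dist f g < e / 2"
    using s[of "e / 2"] by auto
  then obtain l where l: "L1_dist g (rat_step l) < e / 2"
    using \<open>0 < e\<close> unfolding approximable_def by (meson half_gt_zero)
  have gi: "integrable unit_interval g" using g(1) by (simp add: approximable_def)
  have "L1_dist f (rat_step l) \<le> (\<integral>v. \<bar>f v - g v\<bar> + \<bar>g v - rat_step l v\<bar> \<partial>unit_interval)"
    by (intro integral_mono Bochner_Integration.integrable_add integrable_abs
        Bochner_Integration.integrable_diff f gi integrable_rat_step) linarith
  also have "\<dots> = L1_dist f g + L1_dist g (rat_step l)"
    by (intro Bochner_Integration.integral_add integrable_abs
        Bochner_Integration.integrable_diff f gi integrable_rat_step)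
  also have "\<dots> < e" using g(2) l by simp
  finally show "\<exists>l. L1_dist f (rat_step l) < e" by blast
qed

lemma approximable_rat_step: "approximable (rat_step l)"
  unfolding approximable_def by (auto intro!: integrable_rat_step exI[of _ l])

lemma approximable_add:
  assumes "approximable f" "approximable g"
  shows "approximable (\<lambda>v. f v + g v)"
proof (rule approximable_limit)
  have fg: "integrable unit_interval f" "integrable unit_interval g"
    using assms by (auto simp: approximable_def)
  then show "integrable unit_interval (\<lambda>v. f v + g v)" by simp
  fix e :: real assume "0 < e"
  then obtain l l' where l: "L1_dist f (rat_step l) < e / 2"
      "L1_dist g (rat_step l') < e / 2"
    using assms unfolding approximable_def by (meson half_gt_zero)
  have "(\<integral>v. \<bar>f v + g v - rat_step (l @ l') v\<bar> \<partial>unit_interval)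
      \<le> (\<integral>v. \<bar>f v - rat_step l v\<bar> + \<bar>g v - rat_step l' v\<bar> \<partial>unit_interval)"
    by (intro integral_mono Bochner_Integration.integrable_add integrable_abs
        Bochner_Integration.integrable_diff fg integrable_rat_step) (simp add: rat_step_append)
  also have "\<dots> = L1_dist f (rat_step l) + L1_dist g (rat_step l')"
    by (intro Bochner_Integration.integral_add integrable_abs
        Bochner_Integration.integrable_diff fg integrable_rat_step)
  also have "\<dots> < e" using l by simp
  finally show "\<exists>h. approximable h \<and> (\<integral>v. \<bar>f v + g v - h v\<bar> \<partial>unit_interval) < e"
    using approximable_rat_step by blast
qed

lemma approximable_scale:
  assumes "approximable f"
  shows "approximable (\<lambda>v. c * f v)"
proof (rule approximable_limit)
  have f: "integrable unit_interval f" using assms by (auto simp: approximable_def)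
  then show "integrable unit_interval (\<lambda>v. c * f v)" by simp
  fix e :: real assume e: "0 < e"
  let ?F = "\<integral>v. \<bar>f v\<bar> \<partial>unit_interval"
  have F: "0 \<le> ?F" by (rule integral_nonneg_AE) simp
  \<comment> \<open>The errors |c - r| \<open>?F\<close> and |r| times the distance from f to the
    step function get e / 2 each. The summand 1 in \<open>?F + 1\<close> covers \<open>?F\<close> =
    0 and gives strictness; the cap 1 bounds |r| by |c| + 2.\<close>
  obtain r :: rat where r: "c < of_rat r" "of_rat r < c + min 1 (e / (2 * (?F + 1)))"
    using of_rat_dense[of c "c + min 1 (e / (2 * (?F + 1)))"] e F by auto
  have "0 < e / (2 * (\<bar>c\<bar> + 2))" using e by simp
  then obtain l where l: "L1_dist f (rat_step l) < e / (2 * (\<bar>c\<bar> + 2))"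
    using assms unfolding approximable_def by meson
  let ?l = "map (\<lambda>(c, a). (r * c, a)) l"
  have "(\<integral>v. \<bar>c * f v - rat_step ?l v\<bar> \<partial>unit_interval)
      \<le> (\<integral>v. \<bar>c - of_rat r\<bar> * \<bar>f v\<bar> + \<bar>of_rat r\<bar> * \<bar>f v - rat_step l v\<bar> \<partial>unit_interval)"
  proof (intro integral_mono Bochner_Integration.integrable_add integrable_mult_right integrable_abs
        Bochner_Integration.integrable_diff f integrable_rat_step)
    fix v
    have "c * f v - rat_step ?l v = (c - of_rat r) * f v + of_rat r * (f v - rat_step l v)"
      by (simp only: rat_step_scale) (simp add: algebra_simps)
    then show "\<bar>c * f v - rat_step ?l v\<bar> \<le> \<bar>c - of_rat r\<bar> * \<bar>f v\<bar> + \<bar>of_rat r\<bar> * \<bar>f v - rat_step l v\<bar>"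
      by (metis abs_mult abs_triangle_ineq)
  qed
  also have "\<dots> = \<bar>c - of_rat r\<bar> * ?F + \<bar>of_rat r\<bar> * L1_dist f (rat_step l)"
    by (subst Bochner_Integration.integral_add) (auto intro!: f integrable_rat_step)
  also have "\<dots> < e / 2 + e / 2"
  proof (rule add_less_le_mono)
    have "\<bar>c - of_rat r\<bar> * ?F \<le> e / (2 * (?F + 1)) * ?F" using r F by (intro mult_right_mono) auto
    also have "\<dots> < e / 2"
    proof -
      have "x / (x + 1) < 1" if "0 \<le> x" for x :: real using that by simp
      from this[OF F] have "?F / (?F + 1) < 1" .
      then have "(e / 2) * (?F / (?F + 1)) < (e / 2) * 1" using e by (intro mult_strict_left_mono) auto
      then show ?thesis by simp
    qed
    finally show "\<bar>c - of_rat r\<bar> * ?F < e / 2" .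
    have "\<bar>of_rat r :: real\<bar> \<le> \<bar>c\<bar> + 2" using r by linarith
    then have "\<bar>of_rat r\<bar> * L1_dist f (rat_step l) \<le> (\<bar>c\<bar> + 2) * (e / (2 * (\<bar>c\<bar> + 2)))"
      using l by (intro mult_mono integral_nonneg_AE) auto
    also have "\<dots> = e / 2"
    proof -
      have "d * (e / (2 * d)) = e / 2" if "0 < d" for d :: real using that by simp
      from this[of "\<bar>c\<bar> + 2"] show ?thesis by simp
    qed
    finally show "\<bar>of_rat r\<bar> * L1_dist f (rat_step l) \<le> e / 2" .
  qed
  also have "\<dots> = e" by simp
  finally show "\<exists>h. approximable h \<and> (\<integral>v. \<bar>c * f v - h v\<bar> \<partial>unit_interval) < e"
    using approximable_rat_step by blast
qed

lemma approximable_LIMSEQ: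
  assumes s: "\<And>i. approximable (s i)" and f: "integrable unit_interval f" and w: "integrable unit_interval w"
    and lim: "\<And>v. v \<in> {0..1} \<Longrightarrow> (\<lambda>i. s i v) \<longlonglongrightarrow> f v"
    and dom: "\<And>i v. v \<in> {0..1} \<Longrightarrow> \<bar>f v - s i v\<bar> \<le> w v"
  shows "approximable f"
proof (rule approximable_limit[OF f])
  fix e :: real assume e: "0 < e"
  have [measurable]: "s i \<in> borel_measurable unit_interval" for i
    using s by (auto simp: approximable_def)
  have [measurable]: "f \<in> borel_measurable unit_interval" using f by auto
  have "(\<lambda>i. \<integral>v. \<bar>f v - s i v\<bar> \<partial>unit_interval) \<longlonglongrightarrow> (\<integral>v. 0 \<partial>unit_interval)"
  proof (rule integral_dominated_convergence[where w = w])
    show "AE v in unit_interval. (\<lambda>i. \<bar>f v - s i v\<bar>) \<longlonglongrightarrow> 0"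
      using lim by (intro AE_I2 tendsto_rabs_zero) (auto intro!: tendsto_eq_intros)
  qed (use w dom in auto)
  then have "eventually (\<lambda>i. L1_dist f (s i) < e) sequentially"
    using e by (intro order_tendstoD(2)[where y = 0]) auto
  then obtain i where "L1_dist f (s i) < e" by (auto simp: eventually_sequentially)
  with s show "\<exists>g. approximable g \<and> L1_dist f g < e" by blast
qed

lemma integrable_indicator_unit_interval:
  "A \<in> sets borel \<Longrightarrow> integrable unit_interval (indicator A :: real \<Rightarrow> real)"
  by (rule integrable_unit_interval_bounded[of _ 1])
    (auto intro!: measurable_restrict_space1 split: split_indicator)

lemma approximable_cong:
  assumes "approximable f" "\<And>v. v \<in> {0..1} \<Longrightarrow> f v = g v"
  shows "approximable g"
proof -
  have "integrable unit_interval f \<longleftrightarrow> integrable unit_interval g"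
    using assms(2) by (intro Bochner_Integration.integrable_cong) auto
  moreover have "L1_dist f (rat_step l) = L1_dist g (rat_step l)" for l
    using assms(2) by (intro Bochner_Integration.integral_cong) auto
  ultimately show ?thesis using assms(1) by (simp add: approximable_def)
qed

text \<open>A Dynkin argument: half-lines form a generator stable under intersection, complements
  come from linearity, and disjoint unions from dominated convergence of the partial sums.\<close>

lemma approximable_indicator:
  assumes "A \<in> sets borel"
  shows "approximable (indicator A)"
proof -
  have "Int_stable (range (atMost :: real \<Rightarrow> real set))" by (auto simp: Int_stable_def)
  moreover have "range atMost \<subseteq> Pow (UNIV :: real set)" by simp
  moreover have "A \<in> sigma_sets UNIV (range atMost)"
    using assms by (simp add: borel_eq_atMost)
  ultimately show ?thesis
  proof (induction rule: sigma_sets_induct_disjoint)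
    case (basic A)
    then obtain a where a: "A = {..a}" by auto
    show ?case
    proof (rule approximable_limit)
      show "integrable unit_interval (indicator A :: real \<Rightarrow> real)"
        unfolding a by (rule integrable_indicator_unit_interval) simp
      fix e :: real assume e: "0 < e"
      \<comment> \<open>Moving the endpoint to a rational r changes the indicator on an interval of
        length r - a < e.\<close>
      obtain r :: rat where r: "a < of_rat r" "of_rat r < a + e" using of_rat_dense[of a "a + e"] e by auto
      have "(\<integral>v. \<bar>indicator A v - rat_step [(1, r)] v\<bar> \<partial>unit_interval) = (\<integral>v. indicator {a<..of_rat r} v \<partial>unit_interval)"
        using r by (intro Bochner_Integration.integral_cong) (auto simp: a rat_step_def split: split_indicator)
      also have "\<dots> = (\<integral>v. indicator {0..1} v * indicator {a<..of_rat r} v \<partial>lborel)"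
        by (subst integral_restrict_space) (auto simp: mult.commute)
      also have "\<dots> \<le> (\<integral>v. indicator {a<..of_rat r} v \<partial>lborel)"
        using r by (intro integral_mono_AE' integrable_real_indicator) (auto split: split_indicator)
      also have "\<dots> = of_rat r - a" using r by simp
      also have "\<dots> < e" using r by simp
      finally show "\<exists>g. approximable g \<and> L1_dist (indicator A) g < e"
        using approximable_rat_step by blast
    qed
  next
    case empty
    show ?case
      by (rule approximable_cong[OF approximable_rat_step[of "[]"]]) (simp add: rat_step_def)
  next
    case (compl A)
    show ?case
      by (rule approximable_cong[OF approximable_add[OF approximable_rat_step[of "[(1, 1)]"] approximable_scale[OF compl(2), of "-1"]]])
        (auto simp: rat_step_def split: split_indicator)
  next
    case (union A)
    have sub: "A i \<in> sets borel" for i using union(2) by (auto simp: borel_eq_atMost)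
    have sum: "approximable (\<lambda>v. \<Sum>i<n. indicator (A i) v)" for n
    proof (induction n)
      case 0
      show ?case
        by (rule approximable_cong[OF approximable_rat_step[of "[]"]]) (simp add: rat_step_def)
    next
      case (Suc n)
      then show ?case using approximable_add[OF _ union(3), of "\<lambda>v. \<Sum>i<n. indicator (A i) v" n] by simp
    qed
    have part: "(\<Sum>i<n. indicator (A i) v) = (indicator (\<Union>i<n. A i) v :: real)" for n v
      using union(1) by (intro indicator_UN_disjoint[symmetric]) (auto simp: disjoint_family_on_def)
    show ?case
    proof (rule approximable_LIMSEQ[OF sum])
      show "integrable unit_interval (indicator (\<Union>i. A i) :: real \<Rightarrow> real)"
        using sub by (intro integrable_indicator_unit_interval) auto
      show "integrable unit_interval (\<lambda>_. 1 :: real)"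
        by (rule integrable_unit_interval_bounded[of _ 1]) auto
      fix v :: real
      have "(\<lambda>n. indicator (\<Union>i<n. A i) v :: real) \<longlonglongrightarrow> indicator (\<Union>n. \<Union>i<n. A i) v"
        by (rule LIMSEQ_indicator_incseq, intro monoI UN_mono) auto
      moreover have "(\<Union>n. \<Union>i<n. A i) = (\<Union>i. A i)" by auto
      ultimately show "(\<lambda>n. \<Sum>i<n. indicator (A i) v :: real) \<longlonglongrightarrow> indicator (\<Union>i. A i) v"
        by (simp add: part)
      show "\<bar>indicator (\<Union>i. A i) v - (\<Sum>i<n. indicator (A i) v)\<bar> \<le> (1 :: real)" for n
        unfolding part by (auto split: split_indicator)
    qed
  qed
qed

lemma integrable_imp_approximable:
  assumes "integrable unit_interval f"
  shows "approximable f"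
  using assms
proof (induct rule: integrable_induct)
  case (base A c)
  then obtain B where "B \<in> sets borel" "A = {0..1} \<inter> B"
    by (auto simp: sets_restrict_space)
  then show ?case
    by (intro approximable_cong[OF approximable_scale[OF approximable_indicator, of B c]])
      (auto split: split_indicator)
next
  case (add f g)
  then show ?case by (intro approximable_add)
next
  case (lim f s)
  show ?case
  proof (rule approximable_LIMSEQ[OF lim(2) lim(5)])
    \<comment> \<open>The induction supplies approximants with |s i| \<le> 2 |f|, whence the factor
      3 for |f - s i|.\<close>
    show "integrable unit_interval (\<lambda>v. 3 * \<bar>f v\<bar>)" using lim(5) by simp
    fix v :: real assume v: "v \<in> {0..1}"
    then show "(\<lambda>i. s i v) \<longlonglongrightarrow> f v" using lim(3) by simp
    fix i
    show "\<bar>f v - s i v\<bar> \<le> 3 * \<bar>f v\<bar>" using lim(4)[of v i] v by simp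
  qed
qed

text \<open>Clipping to [0,1] makes every member an admissible density and cannot increase the
  distance to a function that already takes values in [0,1].\<close>

definition dense_unit :: "nat \<Rightarrow> real \<Rightarrow> real" where
  "dense_unit k v = max 0 (min 1 (rat_step (from_nat k) v))"

lemma dense_unit_range: "dense_unit k v \<in> {0..1}"
  by (simp add: dense_unit_def)

lemma dense_unit_measurable [measurable]: "dense_unit k \<in> borel_measurable unit_interval"
  unfolding dense_unit_def by measurable

lemma dense_unit_dense:
  assumes g: "g \<in> borel_measurable unit_interval" "\<And>v. v \<in> {0..1} \<Longrightarrow> g v \<in> {0..1}" and "0 < e"
  shows "\<exists>k. L1_dist g (dense_unit k) < e"
proof -
  have gi: "integrable unit_interval g"
    using g by (intro integrable_unit_interval_bounded[of _ 1]) auto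
  obtain l where l: "L1_dist g (rat_step l) < e"
    using integrable_imp_approximable[OF gi] \<open>0 < e\<close> unfolding approximable_def by blast
  have du: "integrable unit_interval (dense_unit k)" for k
    using dense_unit_range by (intro integrable_unit_interval_bounded[of _ 1]) auto
  have "L1_dist g (dense_unit (to_nat l)) \<le> L1_dist g (rat_step l)"
  proof (intro integral_mono integrable_abs Bochner_Integration.integrable_diff gi du integrable_rat_step)
    fix v assume "v \<in> space unit_interval"
    then have "0 \<le> g v" "g v \<le> 1" using g(2)[of v] by auto
    then show "\<bar>g v - dense_unit (to_nat l) v\<bar> \<le> \<bar>g v - rat_step l v\<bar>"
      by (simp add: dense_unit_def)
  qed
  with l show ?thesis by (meson le_less_trans)
qed

section \<open>Graphon mixtures in the distance \<open>wop2\<close>\<close>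

text \<open>The mass \<open>m\<close> common to both densities is left in place and the remainders \<open>k1\<close>, \<open>k2\<close> are
  coupled independently; the Boolean coordinate selects between the two.\<close>

lemma wasserstein2_coupling_bound:
  fixes X1 X2 :: "'a \<Rightarrow> real ^ 'd" and m k1 k2 :: "'a \<Rightarrow> ennreal" and r :: real
  assumes "prob_space P"
    and [measurable]: "m \<in> borel_measurable P" "k1 \<in> borel_measurable P" "k2 \<in> borel_measurable P"
    and [measurable]: "X1 \<in> borel_measurable P" "X2 \<in> borel_measurable P"
    and r: "0 \<le> r" "(\<integral>\<^sup>+ w. k1 w \<partial>P) = ennreal r" "(\<integral>\<^sup>+ w. k2 w \<partial>P) = ennreal r"
    and m: "(\<integral>\<^sup>+ w. m w \<partial>P) + ennreal r = 1"
    and cost: "(\<integral>\<^sup>+ w. ennreal ((norm (X1 w - X2 w))\<^sup>2) * m w \<partial>P)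
        + 2 * (\<integral>\<^sup>+ w. ennreal ((norm (X1 w - c))\<^sup>2) * k1 w \<partial>P)
        + 2 * (\<integral>\<^sup>+ w. ennreal ((norm (X2 w - c))\<^sup>2) * k2 w \<partial>P) \<le> ennreal D"
    and "0 \<le> D"
  shows "(wasserstein2 (distr (density P (\<lambda>w. m w + k1 w)) borel X1)
      (distr (density P (\<lambda>w. m w + k2 w)) borel X2))\<^sup>2 \<le> D"
proof -
  let ?Ma = "distr (density P (\<lambda>w. m w + k1 w)) borel X1"
    and ?Mb = "distr (density P (\<lambda>w. m w + k2 w)) borel X2"
  interpret P: prob_space P by fact
  let ?B = "count_space (UNIV :: bool set)"
  interpret PP: pair_sigma_finite P P by unfold_locales
  \<comment> \<open>Both remainders have mass r, so their product has mass r^2 and must be divided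
    by r. For r = 0 the remainders vanish almost everywhere and the value 0 is harmless.\<close>
  define \<rho> where "\<rho> = (if r = 0 then 0 else 1 / r)"
  have \<rho>: "0 \<le> \<rho>" "\<rho> * r = (if r = 0 then 0 else 1)" using r by (auto simp: \<rho>_def)
  \<comment> \<open>On the \<open>True\<close> branch w' is a dummy that integrates to 1, so both
    points are evaluated at the same w; on the \<open>False\<close> branch w and w' vary
    independently.\<close>
  define W where "W = (\<lambda>(b, w, w'). if b then m w else ennreal \<rho> * (k1 w * k2 w'))"
  define \<Phi> where "\<Phi> = (\<lambda>(b, w, w'). (X1 w, X2 (if b then w else w')))"
  have [measurable]: "W \<in> borel_measurable (?B \<Otimes>\<^sub>M (P \<Otimes>\<^sub>M P))"
    unfolding W_def by measurable
  have [measurable]: "\<Phi> \<in> (?B \<Otimes>\<^sub>M (P \<Otimes>\<^sub>M P)) \<rightarrow>\<^sub>M (borel \<Otimes>\<^sub>M borel)"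
    unfolding \<Phi>_def by measurable
  define \<pi> where "\<pi> = distr (density (?B \<Otimes>\<^sub>M (P \<Otimes>\<^sub>M P)) W) (borel \<Otimes>\<^sub>M borel) \<Phi>"
  have sigmaPP: "sigma_finite_measure (P \<Otimes>\<^sub>M P)" by unfold_locales
  have int_\<pi>: "(\<integral>\<^sup>+ p. H p \<partial>\<pi>) = (\<integral>\<^sup>+ w. H (X1 w, X2 w) * m w \<partial>P)
      + ennreal \<rho> * (\<integral>\<^sup>+ w. (\<integral>\<^sup>+ w'. H (X1 w, X2 w') * (k1 w * k2 w') \<partial>P) \<partial>P)"
    if [measurable]: "H \<in> borel_measurable (borel \<Otimes>\<^sub>M borel)" for H
  proof -
    have "(\<integral>\<^sup>+ p. H p \<partial>\<pi>) = (\<integral>\<^sup>+ q. W q * H (\<Phi> q) \<partial>(?B \<Otimes>\<^sub>M (P \<Otimes>\<^sub>M P)))"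
      unfolding \<pi>_def by (simp add: nn_integral_distr nn_integral_density)
    also have "\<dots> = (\<integral>\<^sup>+ b. (\<integral>\<^sup>+ q. W (b, q) * H (\<Phi> (b, q)) \<partial>(P \<Otimes>\<^sub>M P)) \<partial>?B)"
      by (rule sigma_finite_measure.nn_integral_fst[OF sigmaPP, symmetric]) measurable
    also have "\<dots> = (\<Sum>b\<in>UNIV. (\<integral>\<^sup>+ q. W (b, q) * H (\<Phi> (b, q)) \<partial>(P \<Otimes>\<^sub>M P)))"
      by (rule nn_integral_count_space_finite) simp
    also have "\<dots> = (\<integral>\<^sup>+ q. W (True, q) * H (\<Phi> (True, q)) \<partial>(P \<Otimes>\<^sub>M P))
        + (\<integral>\<^sup>+ q. W (False, q) * H (\<Phi> (False, q)) \<partial>(P \<Otimes>\<^sub>M P))"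
      by (simp add: UNIV_bool)
    also have "(\<integral>\<^sup>+ q. W (True, q) * H (\<Phi> (True, q)) \<partial>(P \<Otimes>\<^sub>M P)) = (\<integral>\<^sup>+ w. (\<integral>\<^sup>+ w'. m w * H (X1 w, X2 w) \<partial>P) \<partial>P)"
      by (subst P.nn_integral_fst[symmetric]) (simp_all add: W_def \<Phi>_def)
    also have "\<dots> = (\<integral>\<^sup>+ w. H (X1 w, X2 w) * m w \<partial>P)"
      by (simp add: P.emeasure_space_1 mult.commute)
    also have "(\<integral>\<^sup>+ q. W (False, q) * H (\<Phi> (False, q)) \<partial>(P \<Otimes>\<^sub>M P))
        = (\<integral>\<^sup>+ w. (\<integral>\<^sup>+ w'. ennreal \<rho> * (H (X1 w, X2 w') * (k1 w * k2 w')) \<partial>P) \<partial>P)"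
      by (subst P.nn_integral_fst[symmetric]) (simp_all add: W_def \<Phi>_def ac_simps)
    also have "\<dots> = ennreal \<rho> * (\<integral>\<^sup>+ w. (\<integral>\<^sup>+ w'. H (X1 w, X2 w') * (k1 w * k2 w') \<partial>P) \<partial>P)"
      by (subst nn_integral_cmult[symmetric], measurable)
        (intro nn_integral_cong nn_integral_cmult, measurable)
    finally show ?thesis .
  qed
  have prod1: "ennreal \<rho> * (\<integral>\<^sup>+ w. (\<integral>\<^sup>+ w'. F w * (k1 w * k2 w') \<partial>P) \<partial>P) = ennreal (\<rho> * r) * (\<integral>\<^sup>+ w. F w * k1 w \<partial>P)"
    if [measurable]: "F \<in> borel_measurable P" for F
  proof -
    have "(\<integral>\<^sup>+ w'. F w * (k1 w * k2 w') \<partial>P) = F w * k1 w * ennreal r" for w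
      by (simp add: mult.assoc[symmetric] nn_integral_cmult r(3))
    then show ?thesis
      using \<rho>(1) r(1) by (simp add: nn_integral_cmult nn_integral_multc ennreal_mult ac_simps)
  qed
  have prod2: "ennreal \<rho> * (\<integral>\<^sup>+ w. (\<integral>\<^sup>+ w'. F w' * (k1 w * k2 w') \<partial>P) \<partial>P) = ennreal (\<rho> * r) * (\<integral>\<^sup>+ w. F w * k2 w \<partial>P)"
    if [measurable]: "F \<in> borel_measurable P" for F
  proof -
    have "(\<integral>\<^sup>+ w'. F w' * (k1 w * k2 w') \<partial>P) = k1 w * (\<integral>\<^sup>+ w'. F w' * k2 w' \<partial>P)" for w
      by (subst nn_integral_cmult[symmetric]) (simp_all add: ac_simps)
    then show ?thesis
      using \<rho>(1) r(1) by (simp add: nn_integral_multc r(2) ennreal_mult ac_simps)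
  qed
  have absorb: "ennreal (\<rho> * r) * (\<integral>\<^sup>+ w. F w * k w \<partial>P) = (\<integral>\<^sup>+ w. F w * k w \<partial>P)"
    if [measurable]: "F \<in> borel_measurable P" "k \<in> borel_measurable P" and "(\<integral>\<^sup>+ w. k w \<partial>P) = ennreal r" for F k
  proof (cases "r = 0")
    case True
    then have "(\<integral>\<^sup>+ w. k w \<partial>P) = 0" using that by simp
    then have "AE w in P. k w = 0" by (simp add: nn_integral_0_iff_AE)
    then have "(\<integral>\<^sup>+ w. F w * k w \<partial>P) = (\<integral>\<^sup>+ w. 0 \<partial>P)" by (intro nn_integral_cong_AE) auto
    then show ?thesis by simp
  qed (simp add: \<rho>)
  have marg1: "distr \<pi> borel fst = ?Ma"
  proof (rule measure_eqI)
    fix A assume "A \<in> sets (distr \<pi> borel fst)"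
    then have [measurable]: "A \<in> sets borel" by simp
    have "emeasure (distr \<pi> borel fst) A = (\<integral>\<^sup>+ x. indicator A x \<partial>(distr \<pi> borel fst))" by simp
    also have "\<dots> = (\<integral>\<^sup>+ p. indicator A (fst p) \<partial>\<pi>)"
      by (rule nn_integral_distr) (auto simp: \<pi>_def)
    also have "\<dots> = (\<integral>\<^sup>+ w. indicator A (X1 w) * m w \<partial>P) + (\<integral>\<^sup>+ w. indicator A (X1 w) * k1 w \<partial>P)"
      using prod1[of "\<lambda>w. indicator A (X1 w)"] absorb[of "\<lambda>w. indicator A (X1 w)" k1] r(2) by (simp add: int_\<pi>)
    also have "\<dots> = (\<integral>\<^sup>+ w. (m w + k1 w) * indicator A (X1 w) \<partial>P)"
      by (subst nn_integral_add[symmetric]) (simp_all add: algebra_simps)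
    also have "\<dots> = (\<integral>\<^sup>+ x. indicator A x \<partial>?Ma)"
      by (subst nn_integral_distr) (simp_all add: nn_integral_density del: nn_integral_indicator)
    finally show "emeasure (distr \<pi> borel fst) A = emeasure ?Ma A" by simp
  qed simp
  have marg2: "distr \<pi> borel snd = ?Mb"
  proof (rule measure_eqI)
    fix A assume "A \<in> sets (distr \<pi> borel snd)"
    then have [measurable]: "A \<in> sets borel" by simp
    have "emeasure (distr \<pi> borel snd) A = (\<integral>\<^sup>+ x. indicator A x \<partial>(distr \<pi> borel snd))" by simp
    also have "\<dots> = (\<integral>\<^sup>+ p. indicator A (snd p) \<partial>\<pi>)"
      by (rule nn_integral_distr) (auto simp: \<pi>_def)
    also have "\<dots> = (\<integral>\<^sup>+ w. indicator A (X2 w) * m w \<partial>P) + (\<integral>\<^sup>+ w. indicator A (X2 w) * k2 w \<partial>P)"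
      using prod2[of "\<lambda>w. indicator A (X2 w)"] absorb[of "\<lambda>w. indicator A (X2 w)" k2] r(3) by (simp add: int_\<pi>)
    also have "\<dots> = (\<integral>\<^sup>+ w. (m w + k2 w) * indicator A (X2 w) \<partial>P)"
      by (subst nn_integral_add[symmetric]) (simp_all add: algebra_simps)
    also have "\<dots> = (\<integral>\<^sup>+ x. indicator A x \<partial>?Mb)"
      by (subst nn_integral_distr) (simp_all add: nn_integral_density del: nn_integral_indicator)
    finally show "emeasure (distr \<pi> borel snd) A = emeasure ?Mb A" by simp
  qed simp
  have "prob_space \<pi>"
  proof (rule prob_spaceI)
    have "emeasure \<pi> (space \<pi>) = (\<integral>\<^sup>+ p. 1 \<partial>\<pi>)" by simp
    also have "\<dots> = 1"
      using prod1[of "\<lambda>_. 1"] absorb[of "\<lambda>_. 1" k1] r(2) m by (simp only: int_\<pi>[OF borel_measurable_const]) simp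
    finally show "emeasure \<pi> (space \<pi>) = 1" .
  qed
  then have \<pi>: "\<pi> \<in> couplings ?Ma ?Mb"
    using marg1 marg2 by (simp add: couplings_def) (simp add: \<pi>_def)
  have "(\<integral>\<^sup>+ p. ennreal ((dist (fst p) (snd p))\<^sup>2) \<partial>\<pi>) = (\<integral>\<^sup>+ w. ennreal ((norm (X1 w - X2 w))\<^sup>2) * m w \<partial>P)
      + ennreal \<rho> * (\<integral>\<^sup>+ w. (\<integral>\<^sup>+ w'. ennreal ((norm (X1 w - X2 w'))\<^sup>2) * (k1 w * k2 w') \<partial>P) \<partial>P)"
    by (subst int_\<pi>) (simp_all add: dist_norm)
  \<comment> \<open>The independent remainders are compared through the centre c by |p - q|^2 \<le>
    2 |p - c|^2 + 2 |q - c|^2; hence the factors 2 in the cost.\<close>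
  also have "\<dots> \<le> (\<integral>\<^sup>+ w. ennreal ((norm (X1 w - X2 w))\<^sup>2) * m w \<partial>P)
      + ennreal \<rho> * (\<integral>\<^sup>+ w. (\<integral>\<^sup>+ w'. 2 * (ennreal ((norm (X1 w - c))\<^sup>2) * (k1 w * k2 w'))
          + 2 * (ennreal ((norm (X2 w' - c))\<^sup>2) * (k1 w * k2 w')) \<partial>P) \<partial>P)"
  proof (intro add_left_mono mult_left_mono nn_integral_mono)
    fix w w'
    have "(norm (X1 w - X2 w'))\<^sup>2 \<le> (norm (X1 w - c) + norm (X2 w' - c))\<^sup>2"
      using norm_triangle_ineq4[of "X1 w - c" "X2 w' - c"] by (intro power_mono) auto
    also have "\<dots> \<le> 2 * (norm (X1 w - c))\<^sup>2 + 2 * (norm (X2 w' - c))\<^sup>2"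
      using sum_squares_bound[of "norm (X1 w - c)" "norm (X2 w' - c)"] by (simp add: power2_sum)
    finally have "ennreal ((norm (X1 w - X2 w'))\<^sup>2) \<le> 2 * ennreal ((norm (X1 w - c))\<^sup>2) + 2 * ennreal ((norm (X2 w' - c))\<^sup>2)"
      by (simp add: ennreal_mult'[symmetric] flip: ennreal_plus ennreal_numeral)
    then have "ennreal ((norm (X1 w - X2 w'))\<^sup>2) * (k1 w * k2 w')
        \<le> (2 * ennreal ((norm (X1 w - c))\<^sup>2) + 2 * ennreal ((norm (X2 w' - c))\<^sup>2)) * (k1 w * k2 w')"
      by (rule mult_right_mono) simp
    then show "ennreal ((norm (X1 w - X2 w'))\<^sup>2) * (k1 w * k2 w')
        \<le> 2 * (ennreal ((norm (X1 w - c))\<^sup>2) * (k1 w * k2 w')) + 2 * (ennreal ((norm (X2 w' - c))\<^sup>2) * (k1 w * k2 w'))"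
      by (simp add: distrib_right mult.assoc)
  qed simp_all
  also have "\<dots> = (\<integral>\<^sup>+ w. ennreal ((norm (X1 w - X2 w))\<^sup>2) * m w \<partial>P)
      + (2 * (ennreal \<rho> * (\<integral>\<^sup>+ w. (\<integral>\<^sup>+ w'. ennreal ((norm (X1 w - c))\<^sup>2) * (k1 w * k2 w') \<partial>P) \<partial>P))
      + 2 * (ennreal \<rho> * (\<integral>\<^sup>+ w. (\<integral>\<^sup>+ w'. ennreal ((norm (X2 w' - c))\<^sup>2) * (k1 w * k2 w') \<partial>P) \<partial>P)))"
  proof -
    have "(\<integral>\<^sup>+ w. (\<integral>\<^sup>+ w'. 2 * F (w, w') + 2 * H (w, w') \<partial>P) \<partial>P)
        = 2 * (\<integral>\<^sup>+ w. (\<integral>\<^sup>+ w'. F (w, w') \<partial>P) \<partial>P) + 2 * (\<integral>\<^sup>+ w. (\<integral>\<^sup>+ w'. H (w, w') \<partial>P) \<partial>P)"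
      if [measurable]: "F \<in> borel_measurable (P \<Otimes>\<^sub>M P)" "H \<in> borel_measurable (P \<Otimes>\<^sub>M P)" for F H
      using P.nn_integral_fst[of "\<lambda>p. 2 * F p + 2 * H p" P]
      by (simp add: P.nn_integral_fst nn_integral_add nn_integral_cmult)
    from this[of "\<lambda>(w, w'). ennreal ((norm (X1 w - c))\<^sup>2) * (k1 w * k2 w')"
        "\<lambda>(w, w'). ennreal ((norm (X2 w' - c))\<^sup>2) * (k1 w * k2 w')"]
    show ?thesis by (simp add: distrib_left mult.left_commute del: nn_integral_add nn_integral_cmult)
  qed
  also have "\<dots> = (\<integral>\<^sup>+ w. ennreal ((norm (X1 w - X2 w))\<^sup>2) * m w \<partial>P)
        + 2 * (\<integral>\<^sup>+ w. ennreal ((norm (X1 w - c))\<^sup>2) * k1 w \<partial>P)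
        + 2 * (\<integral>\<^sup>+ w. ennreal ((norm (X2 w - c))\<^sup>2) * k2 w \<partial>P)"
  proof -
    have e1: "ennreal \<rho> * (\<integral>\<^sup>+ w. (\<integral>\<^sup>+ w'. ennreal ((norm (X1 w - c))\<^sup>2) * (k1 w * k2 w') \<partial>P) \<partial>P)
        = (\<integral>\<^sup>+ w. ennreal ((norm (X1 w - c))\<^sup>2) * k1 w \<partial>P)"
      by (subst prod1, measurable, rule absorb) (use r in measurable)
    have e2: "ennreal \<rho> * (\<integral>\<^sup>+ w. (\<integral>\<^sup>+ w'. ennreal ((norm (X2 w' - c))\<^sup>2) * (k1 w * k2 w') \<partial>P) \<partial>P)
        = (\<integral>\<^sup>+ w. ennreal ((norm (X2 w - c))\<^sup>2) * k2 w \<partial>P)"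
      by (subst prod2, measurable, rule absorb) (use r in measurable)
    show ?thesis unfolding e1 e2 by (simp add: add.assoc)
  qed
  also note cost
  finally have "(INF \<pi>\<in>couplings ?Ma ?Mb.
      \<integral>\<^sup>+ p. ennreal ((dist (fst p) (snd p))\<^sup>2) \<partial>\<pi>) \<le> ennreal D"
    using \<pi> by (intro INF_lower2) auto
  then show ?thesis
    unfolding wasserstein2_def using \<open>0 \<le> D\<close> by (simp add: enn2real_leI)
qed

section \<open>Graphon mixtures as weighted marginals of a joint law\<close>

lemma scale_measure_distr_density:
  assumes [measurable]: "f \<in> borel_measurable M" "X \<in> M \<rightarrow>\<^sub>M N"
  shows "scale_measure c (distr (density M f) N X) = distr (density M (\<lambda>x. c * f x)) N X"
proof (rule measure_eqI)
  fix A assume "A \<in> sets (scale_measure c (distr (density M f) N X))"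
  then have [measurable]: "A \<in> sets N" by simp
  have [measurable]: "X -` A \<inter> space M \<in> sets M" by measurable
  show "emeasure (scale_measure c (distr (density M f) N X)) A = emeasure (distr (density M (\<lambda>x. c * f x)) N X) A"
    by (simp add: emeasure_distr emeasure_density nn_integral_cmult mult.assoc)
qed simp

lemma measurable_unit_interval_borel:
  "f \<in> restrict_space borel {0..1} \<rightarrow>\<^sub>M N \<longleftrightarrow> f \<in> unit_interval \<rightarrow>\<^sub>M N"
proof -
  have "sets (restrict_space borel {0..1}) = sets unit_interval" by (simp add: sets_restrict_space)
  from measurable_cong_sets[OF this refl, of N] show ?thesis by (simp only:)
qed

text \<open>The joint law of (v, x) with v uniform on the unit interval and x distributed as \<mu> v
  given v. All mixtures of the family live on this one space, where they can be coupled.\<close>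

definition family_measure :: "(real \<Rightarrow> (real ^ 'd) measure) \<Rightarrow> (real \<times> (real ^ 'd)) measure" where
  "family_measure \<mu> = unit_interval \<bind> (\<lambda>v. distr (\<mu> v) (unit_interval \<Otimes>\<^sub>M borel) (Pair v))"

text \<open>The mixture seen as a function of the density alone, so that dependence on the label
  becomes dependence on G u. The label 0 is arbitrary, as the function passed to
  \<open>graphon_mix\<close> ignores it.\<close>

definition density_mix :: "(real \<Rightarrow> (real ^ 'd) measure) \<Rightarrow> (real \<Rightarrow> real) \<Rightarrow> (real ^ 'd) measure" where
  "density_mix \<mu> g = graphon_mix (\<lambda>_. g) \<mu> 0"

lemma graphon_mix_eq_density_mix: "graphon_mix G \<mu> u = density_mix \<mu> (G u)"
  by (simp add: density_mix_def graphon_mix_def)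

definition unit_valued :: "(real \<Rightarrow> real) \<Rightarrow> bool" where
  "unit_valued g \<longleftrightarrow> g \<in> borel_measurable unit_interval \<and> (\<forall>v\<in>{0..1}. g v \<in> {0..1})"

lemma unit_valued_measurable: "unit_valued g \<Longrightarrow> g \<in> borel_measurable unit_interval"
  by (simp add: unit_valued_def)

lemma unit_valued_integrable: "unit_valued g \<Longrightarrow> integrable unit_interval g"
  by (rule integrable_unit_interval_bounded[of _ 1]) (auto simp: unit_valued_def)

lemma unit_valued_integral:
  assumes "unit_valued g"
  shows "(\<integral>v. g v \<partial>unit_interval) \<in> {0..1}"
proof -
  interpret prob_space unit_interval by (rule prob_space_unit_interval)
  have "(\<integral>v. g v \<partial>unit_interval) \<le> (\<integral>v. 1 \<partial>unit_interval)"
    using assms by (intro integral_mono unit_valued_integrable) (auto simp: unit_valued_def)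
  moreover have "0 \<le> (\<integral>v. g v \<partial>unit_interval)"
    using assms by (intro integral_nonneg_AE AE_I2) (auto simp: unit_valued_def)
  ultimately show ?thesis using prob_space by simp
qed

locale measure_family =
  fixes \<mu> :: "real \<Rightarrow> (real ^ 'd) measure"
  assumes measure_families: "\<mu> \<in> measure_families"
begin

lemma prob_space_family: "v \<in> {0..1} \<Longrightarrow> prob_space (\<mu> v)"
  and sets_family: "v \<in> {0..1} \<Longrightarrow> sets (\<mu> v) = sets borel"
  using measure_families by (auto simp: measure_families_def prob_measures2_def)

lemma family_measurable [measurable]: "\<mu> \<in> unit_interval \<rightarrow>\<^sub>M prob_algebra borel"
proof (intro measurable_prob_algebraI measurable_subprob_algebra)
  fix v assume "v \<in> space unit_interval"
  then have v: "v \<in> {0..1}" by simp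
  show "prob_space (\<mu> v)" using v by (rule prob_space_family)
  show "sets (\<mu> v) = sets borel" using v by (rule sets_family)
  show "subprob_space (\<mu> v)" using prob_space_family[OF v] by (rule prob_space_imp_subprob_space)
next
  fix A :: "(real ^ 'd) set" assume "A \<in> sets borel"
  then have "(\<lambda>v. ennreal (measure (\<mu> v) A)) \<in> borel_measurable unit_interval"
    using measure_families by (auto simp: measure_families_def measurable_unit_interval_borel)
  moreover have eq: "emeasure (\<mu> v) A = ennreal (measure (\<mu> v) A)" if "v \<in> space unit_interval" for v
    using that prob_space_family[of v]
    by (intro finite_measure.emeasure_eq_measure) (auto simp: prob_space.finite_measure)
  ultimately show "(\<lambda>v. emeasure (\<mu> v) A) \<in> borel_measurable unit_interval"
    by (subst measurable_cong[OF eq])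
qed

lemma family_kernel_measurable:
  "(\<lambda>v. distr (\<mu> v) (unit_interval \<Otimes>\<^sub>M borel) (Pair v)) \<in> unit_interval \<rightarrow>\<^sub>M prob_algebra (unit_interval \<Otimes>\<^sub>M borel)"
  by (rule measurable_distr_prob_space2[where M = borel]) measurable

lemma prob_space_family_measure: "prob_space (family_measure \<mu>)"
  and sets_family_measure [measurable_cong]: "sets (family_measure \<mu>) = sets (unit_interval \<Otimes>\<^sub>M borel)"
proof -
  have "unit_interval \<in> space (prob_algebra unit_interval)"
    using prob_space_unit_interval by (simp add: space_prob_algebra)
  then show "prob_space (family_measure \<mu>)" "sets (family_measure \<mu>) = sets (unit_interval \<Otimes>\<^sub>M borel)"
    unfolding family_measure_def
    using prob_space_bind'[OF _ family_kernel_measurable] sets_bind'[OF _ family_kernel_measurable] by auto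
qed

lemma nn_integral_family_measure:
  assumes [measurable]: "F \<in> borel_measurable (unit_interval \<Otimes>\<^sub>M borel)"
  shows "(\<integral>\<^sup>+ p. F p \<partial>(family_measure \<mu>)) = (\<integral>\<^sup>+ v. (\<integral>\<^sup>+ x. F (v, x) \<partial>(\<mu> v)) \<partial>unit_interval)"
proof -
  have "(\<integral>\<^sup>+ p. F p \<partial>(family_measure \<mu>))
      = (\<integral>\<^sup>+ v. (\<integral>\<^sup>+ p. F p \<partial>(distr (\<mu> v) (unit_interval \<Otimes>\<^sub>M borel) (Pair v))) \<partial>unit_interval)"
    unfolding family_measure_def
    by (rule nn_integral_bind[where B = "unit_interval \<Otimes>\<^sub>M borel"])
      (simp_all add: measurable_prob_algebraD family_kernel_measurable)
  also have "\<dots> = (\<integral>\<^sup>+ v. (\<integral>\<^sup>+ x. F (v, x) \<partial>(\<mu> v)) \<partial>unit_interval)"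
  proof (rule nn_integral_cong)
    fix v assume v: "v \<in> space unit_interval"
    then have [measurable_cong]: "sets (\<mu> v) = sets borel" by (simp add: sets_family)
    have "Pair v \<in> \<mu> v \<rightarrow>\<^sub>M unit_interval \<Otimes>\<^sub>M borel" using v by measurable
    then show "(\<integral>\<^sup>+ p. F p \<partial>(distr (\<mu> v) (unit_interval \<Otimes>\<^sub>M borel) (Pair v))) = (\<integral>\<^sup>+ x. F (v, x) \<partial>(\<mu> v))"
      by (simp add: nn_integral_distr)
  qed
  finally show ?thesis .
qed

text \<open>A \<open>measure_of\<close> degenerates unless its set function is a measure. Agreement
  on Borel sets with a genuine pushforward settles this and gives access to integrals.\<close>

lemma density_mix_eq:
  assumes [measurable]: "g \<in> borel_measurable unit_interval"
  shows "density_mix \<mu> g = distr (density (family_measure \<mu>) (\<lambda>p. ennreal (g (fst p)))) borel snd"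
    (is "_ = ?N")
proof -
  have "(\<integral>\<^sup>+ v\<in>{0..1}. ennreal (g v) * emeasure (\<mu> v) A \<partial>lborel) = emeasure ?N A" if [measurable]: "A \<in> sets borel" for A
  proof -
    have [measurable]: "snd -` A \<inter> space (family_measure \<mu>) \<in> sets (family_measure \<mu>)" by measurable
    have "emeasure ?N A = (\<integral>\<^sup>+ p. ennreal (g (fst p)) * indicator A (snd p) \<partial>(family_measure \<mu>))"
      by (subst emeasure_distr, simp_all add: emeasure_density)
        (intro nn_integral_cong, auto split: split_indicator)
    also have "\<dots> = (\<integral>\<^sup>+ v. (\<integral>\<^sup>+ x. ennreal (g v) * indicator A x \<partial>(\<mu> v)) \<partial>unit_interval)"
      by (subst nn_integral_family_measure) simp_all
    also have "\<dots> = (\<integral>\<^sup>+ v. ennreal (g v) * emeasure (\<mu> v) A \<partial>unit_interval)"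
      by (intro nn_integral_cong nn_integral_cmult_indicator) (simp add: sets_family)
    also have "\<dots> = (\<integral>\<^sup>+ v\<in>{0..1}. ennreal (g v) * emeasure (\<mu> v) A \<partial>lborel)"
      by (rule nn_integral_restrict_space) simp
    finally show ?thesis by simp
  qed
  then have "density_mix \<mu> g = measure_of UNIV (sets borel) (emeasure ?N)"
    unfolding density_mix_def graphon_mix_def
    by (intro measure_of_eq) (simp_all add: sets.sigma_sets_eq[of borel, unfolded space_borel])
  also have "\<dots> = ?N" using measure_of_of_measure[of ?N] by simp
  finally show ?thesis .
qed

lemma nn_integral_density_mix:
  assumes [measurable]: "g \<in> borel_measurable unit_interval" "F \<in> borel_measurable borel"
  shows "(\<integral>\<^sup>+ x. F x \<partial>(density_mix \<mu> g)) = (\<integral>\<^sup>+ v. ennreal (g v) * (\<integral>\<^sup>+ x. F x \<partial>(\<mu> v)) \<partial>unit_interval)"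
proof -
  have "(\<integral>\<^sup>+ x. F x \<partial>(density_mix \<mu> g)) = (\<integral>\<^sup>+ p. ennreal (g (fst p)) * F (snd p) \<partial>(family_measure \<mu>))"
    by (simp add: density_mix_eq nn_integral_distr nn_integral_density)
  also have "\<dots> = (\<integral>\<^sup>+ v. (\<integral>\<^sup>+ x. ennreal (g v) * F x \<partial>(\<mu> v)) \<partial>unit_interval)"
    by (subst nn_integral_family_measure) simp_all
  also have "\<dots> = (\<integral>\<^sup>+ v. ennreal (g v) * (\<integral>\<^sup>+ x. F x \<partial>(\<mu> v)) \<partial>unit_interval)"
    by (intro nn_integral_cong nn_integral_cmult) (simp add: measurable_cong_sets[OF sets_family refl])
  finally show ?thesis .
qed

lemma second_moment_bound:
  obtains D where "0 \<le> D" "\<And>v. v \<in> {0..1} \<Longrightarrow> (\<integral>\<^sup>+ x. ennreal ((norm (x - c))\<^sup>2) \<partial>(\<mu> v)) \<le> ennreal D"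
proof -
  let ?S = "SUP u\<in>{0..1}. \<integral>\<^sup>+ x. ennreal ((norm x)\<^sup>2) \<partial>\<mu> u"
  have fin: "?S < top" using measure_families by (simp add: measure_families_def)
  have "(\<integral>\<^sup>+ x. ennreal ((norm (x - c))\<^sup>2) \<partial>(\<mu> v)) \<le> ennreal (2 * enn2real ?S + 2 * (norm c)\<^sup>2)"
    if v: "v \<in> {0..1}" for v
  proof -
    interpret prob_space "\<mu> v" using v by (rule prob_space_family)
    have [measurable_cong]: "sets (\<mu> v) = sets borel" using v by (rule sets_family)
    have "(\<integral>\<^sup>+ x. ennreal ((norm (x - c))\<^sup>2) \<partial>(\<mu> v)) \<le> (\<integral>\<^sup>+ x. 2 * ennreal ((norm x)\<^sup>2) + ennreal (2 * (norm c)\<^sup>2) \<partial>(\<mu> v))"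
    proof (rule nn_integral_mono)
      fix x
      have "(norm (x - c))\<^sup>2 \<le> (norm x + norm c)\<^sup>2" using norm_triangle_ineq4[of x c] by (intro power_mono) auto
      also have "\<dots> \<le> 2 * (norm x)\<^sup>2 + 2 * (norm c)\<^sup>2"
        using sum_squares_bound[of "norm x" "norm c"] by (simp add: power2_sum)
      finally show "ennreal ((norm (x - c))\<^sup>2) \<le> 2 * ennreal ((norm x)\<^sup>2) + ennreal (2 * (norm c)\<^sup>2)"
        by (simp add: ennreal_mult'[symmetric] flip: ennreal_plus ennreal_numeral)
    qed
    also have "\<dots> = 2 * (\<integral>\<^sup>+ x. ennreal ((norm x)\<^sup>2) \<partial>(\<mu> v)) + ennreal (2 * (norm c)\<^sup>2)"
      by (simp add: nn_integral_add nn_integral_cmult emeasure_space_1)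
    also have "\<dots> \<le> 2 * ?S + ennreal (2 * (norm c)\<^sup>2)"
      using v by (intro add_right_mono mult_left_mono SUP_upper) auto
    also have "?S = ennreal (enn2real ?S)" using fin by simp
    finally show ?thesis
      by (simp add: ennreal_mult'[symmetric] flip: ennreal_plus ennreal_numeral)
  qed
  then show ?thesis by (intro that[of "2 * enn2real ?S + 2 * (norm c)\<^sup>2"]) auto
qed

lemma emeasure_density_mix_UNIV:
  assumes "unit_valued g"
  shows "emeasure (density_mix \<mu> g) UNIV = ennreal (\<integral>v. g v \<partial>unit_interval)"
proof -
  note [measurable] = unit_valued_measurable[OF assms]
  have "space (density_mix \<mu> g) = UNIV" by (simp add: density_mix_eq)
  then have "emeasure (density_mix \<mu> g) UNIV = (\<integral>\<^sup>+ x. 1 \<partial>(density_mix \<mu> g))" by simp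
  also have "\<dots> = (\<integral>\<^sup>+ v. ennreal (g v) * (\<integral>\<^sup>+ x. 1 \<partial>(\<mu> v)) \<partial>unit_interval)"
    by (rule nn_integral_density_mix) simp_all
  also have "\<dots> = (\<integral>\<^sup>+ v. ennreal (g v) \<partial>unit_interval)"
    by (intro nn_integral_cong) (simp add: prob_space.emeasure_space_1[OF prob_space_family])
  also have "\<dots> = ennreal (\<integral>v. g v \<partial>unit_interval)"
    using assms by (intro nn_integral_eq_integral unit_valued_integrable AE_I2) (auto simp: unit_valued_def)
  finally show ?thesis .
qed

lemma mass_density_mix: "unit_valued g \<Longrightarrow> mass (density_mix \<mu> g) = (\<integral>v. g v \<partial>unit_interval)"
  using emeasure_density_mix_UNIV[of g] unit_valued_integral[of g] by (simp add: mass_def measure_def)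

lemma density_mix_finite_measures2:
  assumes "unit_valued g"
  shows "density_mix \<mu> g \<in> finite_measures2"
proof -
  note [measurable] = unit_valued_measurable[OF assms]
  obtain D where D: "0 \<le> D" "\<And>v. v \<in> {0..1} \<Longrightarrow> (\<integral>\<^sup>+ x. ennreal ((norm (x - 0))\<^sup>2) \<partial>(\<mu> v)) \<le> ennreal D"
    using second_moment_bound[of 0] by blast
  have space: "space (density_mix \<mu> g) = UNIV" by (simp add: density_mix_eq)
  have "(\<integral>\<^sup>+ x. ennreal ((norm x)\<^sup>2) \<partial>(density_mix \<mu> g))
      = (\<integral>\<^sup>+ v. ennreal (g v) * (\<integral>\<^sup>+ x. ennreal ((norm x)\<^sup>2) \<partial>(\<mu> v)) \<partial>unit_interval)"
    by (rule nn_integral_density_mix) simp_all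
  also have "\<dots> \<le> (\<integral>\<^sup>+ v. 1 * ennreal D \<partial>unit_interval)"
    using assms D(2) by (intro nn_integral_mono mult_mono) (auto simp: unit_valued_def)
  also have "\<dots> = ennreal D" by (simp add: emeasure_restrict_space)
  also have "\<dots> < \<infinity>" by simp
  finally show ?thesis
    using emeasure_density_mix_UNIV[OF assms] space
    by (auto simp: finite_measures2_def density_mix_eq intro!: finite_measureI)
qed

text \<open>The density of the normalized mixture relative to the joint law; the default 1 keeps the
  total mass 1 when g has integral 0.\<close>

definition weight :: "(real \<Rightarrow> real) \<Rightarrow> real \<Rightarrow> real" where
  "weight g v = (if 0 < (\<integral>v. g v \<partial>unit_interval) then g v / (\<integral>v. g v \<partial>unit_interval) else 1)"

text \<open>For mass \<open>0\<close> the dilation is constant, so any probability weight gives \<open>\<delta>\<^bsub>x\<^sub>0\<^esub>\<close>.\<close>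

lemma dilated_density_mix:
  assumes "unit_valued g"
  shows "distr (normalized x\<^sub>0 (density_mix \<mu> g)) borel (dilation x\<^sub>0 (mass (density_mix \<mu> g)))
    = distr (density (family_measure \<mu>) (\<lambda>p. ennreal (weight g (fst p)))) borel
        (\<lambda>p. dilation x\<^sub>0 (mass (density_mix \<mu> g)) (snd p))"
proof -
  note [measurable] = unit_valued_measurable[OF assms]
  let ?a = "\<integral>v. g v \<partial>unit_interval"
  interpret P: prob_space "family_measure \<mu>" by (rule prob_space_family_measure)
  have dil [measurable]: "dilation x\<^sub>0 a \<in> borel_measurable borel" for a :: real
    unfolding dilation_def by measurable
  show ?thesis
  proof (cases "0 < ?a")
    case True
    have "normalized x\<^sub>0 (density_mix \<mu> g)
        = distr (density (family_measure \<mu>) (\<lambda>p. ennreal (1 / ?a) * ennreal (g (fst p)))) borel snd"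
      using True by (simp add: normalized_def mass_density_mix[OF assms])
        (simp add: density_mix_eq scale_measure_distr_density)
    also have "density (family_measure \<mu>) (\<lambda>p. ennreal (1 / ?a) * ennreal (g (fst p)))
        = density (family_measure \<mu>) (\<lambda>p. ennreal (weight g (fst p)))"
      using True by (intro density_cong) (auto simp: weight_def ennreal_mult'[symmetric])
    finally show ?thesis by (simp add: distr_distr comp_def)
  next
    case False
    then have a: "?a = 0" using unit_valued_integral[OF assms] by simp
    have const: "dilation x\<^sub>0 0 = (\<lambda>_. x\<^sub>0)" by (simp add: dilation_def fun_eq_iff)
    have d: "density (family_measure \<mu>) (\<lambda>p. ennreal (weight g (fst p))) = family_measure \<mu>"
      using False by (simp add: weight_def density_1)
    show ?thesis
      unfolding mass_density_mix[OF assms] a d normalized_def const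
      by (simp add: P.distr_const prob_space.distr_const[OF prob_space_return])
  qed
qed

text \<open>The inner second moment is at most D for every v, so only the integral of f is left. In
  the transport cost, f is the common part or a remainder of two weights and s a squared scaling
  factor.\<close>

lemma moment_weight_le:
  assumes D: "0 \<le> D" "\<And>v. v \<in> {0..1} \<Longrightarrow> (\<integral>\<^sup>+ x. ennreal ((norm (x - c))\<^sup>2) \<partial>(\<mu> v)) \<le> ennreal D"
    and f: "integrable unit_interval f" "\<And>v. v \<in> {0..1} \<Longrightarrow> 0 \<le> f v" and "0 \<le> s"
  shows "(\<integral>\<^sup>+ p. ennreal (s * (norm (snd p - c))\<^sup>2) * ennreal (f (fst p)) \<partial>(family_measure \<mu>))
    \<le> ennreal (s * D * (\<integral>v. f v \<partial>unit_interval))"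
proof -
  have [measurable]: "f \<in> borel_measurable unit_interval" using f by auto
  have "(\<integral>\<^sup>+ p. ennreal (s * (norm (snd p - c))\<^sup>2) * ennreal (f (fst p)) \<partial>(family_measure \<mu>))
      = (\<integral>\<^sup>+ v. (\<integral>\<^sup>+ x. ennreal (f v) * ennreal s * ennreal ((norm (x - c))\<^sup>2) \<partial>(\<mu> v)) \<partial>unit_interval)"
    using \<open>0 \<le> s\<close> by (subst nn_integral_family_measure) (simp_all add: ennreal_mult ac_simps)
  also have "\<dots> = (\<integral>\<^sup>+ v. ennreal (f v) * ennreal s * (\<integral>\<^sup>+ x. ennreal ((norm (x - c))\<^sup>2) \<partial>(\<mu> v)) \<partial>unit_interval)"
    by (intro nn_integral_cong nn_integral_cmult) (simp add: measurable_cong_sets[OF sets_family refl])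
  also have "\<dots> \<le> (\<integral>\<^sup>+ v. ennreal (f v) * ennreal s * ennreal D \<partial>unit_interval)"
    using D(2) by (intro nn_integral_mono mult_left_mono) auto
  also have "\<dots> = ennreal s * ennreal D * (\<integral>\<^sup>+ v. ennreal (f v) \<partial>unit_interval)"
    by (subst nn_integral_cmult[symmetric]) (simp_all add: ac_simps)
  also have "(\<integral>\<^sup>+ v. ennreal (f v) \<partial>unit_interval) = ennreal (\<integral>v. f v \<partial>unit_interval)"
    using f by (intro nn_integral_eq_integral AE_I2) auto
  also have "ennreal s * ennreal D * ennreal (\<integral>v. f v \<partial>unit_interval) = ennreal (s * D * (\<integral>v. f v \<partial>unit_interval))"
    using D(1) \<open>0 \<le> s\<close> f(2) by (simp add: ennreal_mult' ennreal_mult integral_nonneg_AE AE_I2)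
  finally show ?thesis .
qed

end

section \<open>Continuity of mixtures in the L1 distance of their densities\<close>

context measure_family
begin

lemma weight_nonneg: "unit_valued g \<Longrightarrow> v \<in> {0..1} \<Longrightarrow> 0 \<le> weight g v"
  by (auto simp: weight_def unit_valued_def)

lemma weight_measurable:
  assumes "unit_valued g"
  shows "weight g \<in> borel_measurable unit_interval"
proof -
  note [measurable] = unit_valued_measurable[OF assms]
  show ?thesis unfolding weight_def by measurable
qed

lemma weight_integrable:
  assumes "unit_valued g"
  shows "integrable unit_interval (weight g)"
proof (cases "0 < (\<integral>v. g v \<partial>unit_interval)")
  case True
  then have "weight g = (\<lambda>v. g v / (\<integral>v. g v \<partial>unit_interval))" by (simp add: weight_def fun_eq_iff)
  then show ?thesis using unit_valued_integrable[OF assms] by simp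
next
  case False
  then have "weight g = (\<lambda>_. 1)" by (simp add: weight_def fun_eq_iff)
  then show ?thesis using integrable_unit_interval_bounded[of "\<lambda>_. 1" 1] by simp
qed

lemma weight_integral:
  assumes "unit_valued g"
  shows "(\<integral>v. weight g v \<partial>unit_interval) = 1"
proof (cases "0 < (\<integral>v. g v \<partial>unit_interval)")
  case True
  then show ?thesis by (simp add: weight_def)
next
  case False
  then show ?thesis
    using prob_space.prob_space[OF prob_space_unit_interval] by (simp add: weight_def)
qed

text \<open>The common part of the two weights is taken to be \<open>min g1 g2 / max a1 a2\<close>, where \<open>a1\<close>
  and \<open>a2\<close> are the masses; the mass \<open>r\<close> left over satisfies \<open>r * max a1 a2 \<le> \<integral>\<bar>g1 - g2\<bar>\<close>.\<close>

lemma wop2_density_mix_le: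
  assumes D: "0 \<le> D" "\<And>v. v \<in> {0..1} \<Longrightarrow> (\<integral>\<^sup>+ x. ennreal ((norm (x - x\<^sub>0))\<^sup>2) \<partial>(\<mu> v)) \<le> ennreal D"
    and g: "unit_valued g1" "unit_valued g2"
  shows "wop2 x\<^sub>0 (density_mix \<mu> g1) (density_mix \<mu> g2)
    \<le> sqrt ((1 + 5 * D) * L1_dist g1 g2)"
proof -
  interpret U: prob_space unit_interval by (rule prob_space_unit_interval)
  interpret P: prob_space "family_measure \<mu>" by (rule prob_space_family_measure)
  let ?P = "family_measure \<mu>"
  define a1 a2 \<delta> where "a1 = (\<integral>v. g1 v \<partial>unit_interval)" and "a2 = (\<integral>v. g2 v \<partial>unit_interval)"
    and "\<delta> = L1_dist g1 g2"
  define A where "A = max a1 a2"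
  note gi = unit_valued_integrable[OF g(1)] unit_valued_integrable[OF g(2)]
  note [measurable] = unit_valued_measurable[OF g(1)] unit_valued_measurable[OF g(2)]
    weight_measurable[OF g(1)] weight_measurable[OF g(2)]
  have a: "0 \<le> a1" "a1 \<le> 1" "0 \<le> a2" "a2 \<le> 1"
    using unit_valued_integral[OF g(1)] unit_valued_integral[OF g(2)] by (auto simp: a1_def a2_def)
  have A: "0 \<le> A" "A \<le> 1" "a1 \<le> A" "a2 \<le> A" using a by (auto simp: A_def)
  have a12: "\<bar>a1 - a2\<bar> \<le> \<delta>"
    using integral_norm_bound[of unit_interval "\<lambda>v. g1 v - g2 v"] gi
    by (simp add: a1_def a2_def \<delta>_def)
  have sq: "(a1 - a2)\<^sup>2 \<le> \<delta>"
  proof -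
    have "(a1 - a2)\<^sup>2 = \<bar>a1 - a2\<bar> * \<bar>a1 - a2\<bar>" by (simp add: power2_eq_square)
    also have "\<dots> \<le> 1 * \<bar>a1 - a2\<bar>" using a by (intro mult_right_mono) auto
    finally show ?thesis using a12 by simp
  qed
  \<comment> \<open>Dividing by the larger mass A keeps \<open>mr\<close> below both weights. If one
    mass is 0 there is no common part; then A is |a1 - a2| and thus already at most
    \<delta>.\<close>
  define mr where "mr v = (if 0 < a1 \<and> 0 < a2 then min (g1 v) (g2 v) / A else 0)" for v
  have [measurable]: "mr \<in> borel_measurable unit_interval" unfolding mr_def by measurable
  have mr0: "0 \<le> mr v" and mr1: "mr v \<le> weight g1 v" and mr2: "mr v \<le> weight g2 v" if v: "v \<in> {0..1}" for v
  proof -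
    have gv: "0 \<le> g1 v" "0 \<le> g2 v" using g v by (auto simp: unit_valued_def)
    then show "0 \<le> mr v" using A by (simp add: mr_def)
    have "min (g1 v) (g2 v) / A \<le> g1 v / a1" if "0 < a1" "0 < a2"
      using gv A that by (intro frac_le) auto
    then show "mr v \<le> weight g1 v" using gv weight_nonneg[OF g(1) v] by (auto simp: mr_def weight_def a1_def)
    have "min (g1 v) (g2 v) / A \<le> g2 v / a2" if "0 < a1" "0 < a2"
      using gv A that by (intro frac_le) auto
    then show "mr v \<le> weight g2 v" using gv weight_nonneg[OF g(2) v] by (auto simp: mr_def weight_def a2_def)
  qed
  have mri: "integrable unit_interval mr"
  proof (rule Bochner_Integration.integrable_bound[OF weight_integrable[OF g(1)]])
    show "AE v in unit_interval. norm (mr v) \<le> norm (weight g1 v)"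
      using mr0 mr1 by (intro AE_I2) force
  qed measurable
  define r where "r = 1 - (\<integral>v. mr v \<partial>unit_interval)"
  have wi: "integrable unit_interval (\<lambda>v. weight g1 v - mr v)" "integrable unit_interval (\<lambda>v. weight g2 v - mr v)"
    using weight_integrable[OF g(1)] weight_integrable[OF g(2)] mri by auto
  have k_int: "(\<integral>v. weight g1 v - mr v \<partial>unit_interval) = r" "(\<integral>v. weight g2 v - mr v \<partial>unit_interval) = r"
    using weight_integrable[OF g(1)] weight_integrable[OF g(2)] mri weight_integral[OF g(1)] weight_integral[OF g(2)]
    by (simp_all add: r_def)
  have r: "0 \<le> r" using mr1 unfolding k_int(1)[symmetric] by (intro integral_nonneg_AE AE_I2) auto
  have mr_int: "0 \<le> (\<integral>v. mr v \<partial>unit_interval)" using mr0 by (intro integral_nonneg_AE AE_I2) auto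
  then have "r \<le> 1" by (simp add: r_def)
  \<comment> \<open>If both masses are positive, r A = A - \<integral> min g1 g2, while A is at most
    the integral of max g1 g2; and max - min = |g1 - g2|.\<close>
  have rA: "r * A \<le> \<delta>"
  proof (cases "0 < a1 \<and> 0 < a2")
    case True
    then have "0 < A" by (auto simp: A_def)
    have mini: "integrable unit_interval (\<lambda>v. min (g1 v) (g2 v))" using gi by (rule integrable_min)
    have "(\<integral>v. mr v \<partial>unit_interval) = (\<integral>v. min (g1 v) (g2 v) \<partial>unit_interval) / A"
      using True by (simp add: mr_def)
    then have "r * A = A - (\<integral>v. min (g1 v) (g2 v) \<partial>unit_interval)"
      using \<open>0 < A\<close> by (simp add: r_def left_diff_distrib)
    also have "A \<le> (\<integral>v. max (g1 v) (g2 v) \<partial>unit_interval)"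
      unfolding A_def a1_def a2_def using gi by (intro max.boundedI integral_mono integrable_max) auto
    also have "(\<integral>v. max (g1 v) (g2 v) \<partial>unit_interval) - (\<integral>v. min (g1 v) (g2 v) \<partial>unit_interval)
        = (\<integral>v. max (g1 v) (g2 v) - min (g1 v) (g2 v) \<partial>unit_interval)"
      using gi mini by (intro Bochner_Integration.integral_diff[symmetric] integrable_max)
    also have "\<dots> = \<delta>" unfolding \<delta>_def by (intro Bochner_Integration.integral_cong) (auto simp: max_def min_def)
    finally show ?thesis by simp
  next
    case False
    then have "A = \<bar>a1 - a2\<bar>" using a by (auto simp: A_def)
    moreover have "r * A \<le> 1 * A" using \<open>r \<le> 1\<close> A by (intro mult_right_mono) auto
    ultimately show ?thesis using a12 by simp
  qed
  let ?m = "\<lambda>p. ennreal (mr (fst p))"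
    and ?ka = "\<lambda>p. ennreal (weight g1 (fst p) - mr (fst p))"
    and ?kb = "\<lambda>p. ennreal (weight g2 (fst p) - mr (fst p))"
    and ?X = "\<lambda>a p. dilation x\<^sub>0 a (snd p)"
  have int_fst: "(\<integral>\<^sup>+ p. ennreal (f (fst p)) \<partial>?P) = ennreal (\<integral>v. f v \<partial>unit_interval)"
    if f: "integrable unit_interval f" "\<And>v. v \<in> {0..1} \<Longrightarrow> 0 \<le> f v" for f
  proof -
    have [measurable]: "f \<in> borel_measurable unit_interval" using f by auto
    have "(\<integral>\<^sup>+ p. ennreal (f (fst p)) \<partial>?P) = (\<integral>\<^sup>+ v. (\<integral>\<^sup>+ x. ennreal (f v) \<partial>(\<mu> v)) \<partial>unit_interval)"
      by (subst nn_integral_family_measure) simp_all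
    also have "\<dots> = (\<integral>\<^sup>+ v. ennreal (f v) \<partial>unit_interval)"
      by (intro nn_integral_cong) (simp add: prob_space.emeasure_space_1[OF prob_space_family])
    also have "\<dots> = ennreal (\<integral>v. f v \<partial>unit_interval)"
      using f by (intro nn_integral_eq_integral AE_I2) auto
    finally show ?thesis .
  qed
  have dil [measurable]: "dilation x\<^sub>0 a \<in> borel_measurable borel" for a :: real
    unfolding dilation_def by measurable
  have space_P: "fst p \<in> {0..1}" if "p \<in> space ?P" for p
    using that sets_eq_imp_space_eq[OF sets_family_measure] by (auto simp: space_pair_measure)
  \<comment> \<open>The 5 is 1 + 2 + 2. The common part moves by (a1 - a2) (x -
    \<open>x\<^sub>0\<close>), with (a1 - a2)^2 \<le> \<delta>. Each remainder enters with factor 2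
    and scale a_i^2 r \<le> A (r A) \<le> \<delta>. Taking the centre of the dilations as c makes
    the distances scale exactly. The 1 in 1 + 5 D is the squared mass difference.\<close>
  have "(wasserstein2 (distr (density ?P (\<lambda>p. ?m p + ?ka p)) borel (?X a1))
      (distr (density ?P (\<lambda>p. ?m p + ?kb p)) borel (?X a2)))\<^sup>2 \<le> 5 * D * \<delta>"
  proof (rule wasserstein2_coupling_bound[where r = r and c = x\<^sub>0])
    show "prob_space ?P" by (rule prob_space_family_measure)
    show "(\<integral>\<^sup>+ p. ?ka p \<partial>?P) = ennreal r"
      using int_fst[OF wi(1)] mr1 k_int(1) by simp
    show "(\<integral>\<^sup>+ p. ?kb p \<partial>?P) = ennreal r"
      using int_fst[OF wi(2)] mr2 k_int(2) by simp
    have "(\<integral>\<^sup>+ p. ?m p \<partial>?P) = ennreal (1 - r)"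
      using int_fst[OF mri] mr0 by (simp add: r_def)
    then show "(\<integral>\<^sup>+ p. ?m p \<partial>?P) + ennreal r = 1"
      using r \<open>r \<le> 1\<close> by (simp flip: ennreal_plus)
    have n1: "ennreal ((norm (?X a1 p - ?X a2 p))\<^sup>2) = ennreal ((a1 - a2)\<^sup>2 * (norm (snd p - x\<^sub>0))\<^sup>2)" for p
    proof -
      have "?X a1 p - ?X a2 p = (a1 - a2) *\<^sub>R (snd p - x\<^sub>0)"
        by (simp add: dilation_def scaleR_left_diff_distrib)
      then show ?thesis by (simp add: power_mult_distrib)
    qed
    have n2: "ennreal ((norm (?X a p - x\<^sub>0))\<^sup>2) = ennreal (a\<^sup>2 * (norm (snd p - x\<^sub>0))\<^sup>2)" for a p
      by (simp add: dilation_def power_mult_distrib)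
    have "(\<integral>\<^sup>+ p. ennreal ((norm (?X a1 p - ?X a2 p))\<^sup>2) * ?m p \<partial>?P) \<le> ennreal ((a1 - a2)\<^sup>2 * D * (1 - r))"
      unfolding n1 using moment_weight_le[OF D mri mr0, of "(a1 - a2)\<^sup>2"] by (simp add: r_def)
    moreover have "(\<integral>\<^sup>+ p. ennreal ((norm (?X a1 p - x\<^sub>0))\<^sup>2) * ?ka p \<partial>?P) \<le> ennreal (a1\<^sup>2 * D * r)"
      unfolding n2 using moment_weight_le[OF D wi(1), of "a1\<^sup>2"] mr1 by (simp add: k_int)
    moreover have "(\<integral>\<^sup>+ p. ennreal ((norm (?X a2 p - x\<^sub>0))\<^sup>2) * ?kb p \<partial>?P) \<le> ennreal (a2\<^sup>2 * D * r)"
      unfolding n2 using moment_weight_le[OF D wi(2), of "a2\<^sup>2"] mr2 by (simp add: k_int)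
    ultimately have "(\<integral>\<^sup>+ p. ennreal ((norm (?X a1 p - ?X a2 p))\<^sup>2) * ?m p \<partial>?P)
        + 2 * (\<integral>\<^sup>+ p. ennreal ((norm (?X a1 p - x\<^sub>0))\<^sup>2) * ?ka p \<partial>?P)
        + 2 * (\<integral>\<^sup>+ p. ennreal ((norm (?X a2 p - x\<^sub>0))\<^sup>2) * ?kb p \<partial>?P)
      \<le> ennreal ((a1 - a2)\<^sup>2 * D * (1 - r)) + 2 * ennreal (a1\<^sup>2 * D * r) + 2 * ennreal (a2\<^sup>2 * D * r)"
      by (intro add_mono mult_left_mono) auto
    also have "\<dots> = ennreal ((a1 - a2)\<^sup>2 * D * (1 - r) + 2 * (a1\<^sup>2 * D * r) + 2 * (a2\<^sup>2 * D * r))"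
      using D r \<open>r \<le> 1\<close> by (simp add: ennreal_mult'[symmetric] flip: ennreal_plus ennreal_numeral)
    also have "\<dots> \<le> ennreal (5 * D * \<delta>)"
    proof (rule ennreal_leI)
      have "(a1 - a2)\<^sup>2 * (1 - r) \<le> \<delta> * 1" using sq r \<open>r \<le> 1\<close> a12 by (intro mult_mono) auto
      moreover have "s\<^sup>2 * r \<le> \<delta>" if "0 \<le> s" "s \<le> A" for s
      proof -
        have "s\<^sup>2 * r \<le> A\<^sup>2 * r" using that r by (intro mult_right_mono power_mono) auto
        also have "\<dots> = A * (r * A)" by (simp add: power2_eq_square)
        also have "\<dots> \<le> 1 * \<delta>" using A r rA by (intro mult_mono) auto
        finally show ?thesis by simp
      qed
      from this[of a1] this[of a2] have "a1\<^sup>2 * r \<le> \<delta>" "a2\<^sup>2 * r \<le> \<delta>" using a A by auto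
      ultimately have "(a1 - a2)\<^sup>2 * (1 - r) + 2 * (a1\<^sup>2 * r) + 2 * (a2\<^sup>2 * r) \<le> 5 * \<delta>" by linarith
      from mult_left_mono[OF this D(1)]
      show "(a1 - a2)\<^sup>2 * D * (1 - r) + 2 * (a1\<^sup>2 * D * r) + 2 * (a2\<^sup>2 * D * r) \<le> 5 * D * \<delta>"
        by (simp add: algebra_simps)
    qed
    finally show "(\<integral>\<^sup>+ p. ennreal ((norm (?X a1 p - ?X a2 p))\<^sup>2) * ?m p \<partial>?P)
        + 2 * (\<integral>\<^sup>+ p. ennreal ((norm (?X a1 p - x\<^sub>0))\<^sup>2) * ?ka p \<partial>?P)
        + 2 * (\<integral>\<^sup>+ p. ennreal ((norm (?X a2 p - x\<^sub>0))\<^sup>2) * ?kb p \<partial>?P) \<le> ennreal (5 * D * \<delta>)" .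
    show "0 \<le> 5 * D * \<delta>" using D a12 by simp
  qed (use r in measurable)
  moreover have "density ?P (\<lambda>p. ?m p + ?ka p) = density ?P (\<lambda>p. ennreal (weight g1 (fst p)))"
    using mr0 mr1 space_P by (intro density_cong) (auto intro!: AE_I2 simp flip: ennreal_plus)
  moreover have "density ?P (\<lambda>p. ?m p + ?kb p) = density ?P (\<lambda>p. ennreal (weight g2 (fst p)))"
    using mr0 mr2 space_P by (intro density_cong) (auto intro!: AE_I2 simp flip: ennreal_plus)
  ultimately have W: "(wasserstein2
      (distr (normalized x\<^sub>0 (density_mix \<mu> g1)) borel (dilation x\<^sub>0 (mass (density_mix \<mu> g1))))
      (distr (normalized x\<^sub>0 (density_mix \<mu> g2)) borel (dilation x\<^sub>0 (mass (density_mix \<mu> g2)))))\<^sup>2 \<le> 5 * D * \<delta>"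
    unfolding dilated_density_mix[OF g(1)] dilated_density_mix[OF g(2)]
    by (simp add: mass_density_mix g a1_def a2_def)
  from sq show ?thesis
    unfolding wop2_def using W
    by (intro real_sqrt_le_mono) (simp add: mass_density_mix g a1_def a2_def \<delta>_def distrib_right)
qed

end

section \<open>Measurable dependence on the label\<close>

lemma norm_matrix_vector_mult_le: "norm (A *v z) \<le> norm A * norm (z :: real ^ 'q)" for A :: "real ^ 'q ^ 'd"
proof -
  have "norm (A *v z) = L2_set (\<lambda>i. \<bar>A $ i \<bullet> z\<bar>) UNIV"
    by (simp add: norm_vec_def matrix_vector_mul_component)
  also have "\<dots> \<le> L2_set (\<lambda>i. norm (A $ i) * norm z) UNIV"
    by (intro L2_set_mono Cauchy_Schwarz_ineq2) simp
  also have "\<dots> = norm A * norm z"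
    by (simp add: L2_set_left_distrib[symmetric] norm_vec_def)
  finally show ?thesis .
qed

lemma borel_measurable_matrix_vector_mult:
  fixes A :: "'a \<Rightarrow> real ^ 'q ^ 'd"
  assumes "A \<in> borel_measurable M" "z \<in> borel_measurable M"
  shows "(\<lambda>x. A x *v z x) \<in> borel_measurable M"
proof (rule borel_measurable_continuous_Pair[OF assms])
  have "bounded_bilinear ((*v) :: real ^ 'q ^ 'd \<Rightarrow> real ^ 'q \<Rightarrow> real ^ 'd)"
    by (rule bounded_bilinear.intro)
      (auto simp: matrix_vector_mult_add_rdistrib matrix_vector_right_distrib scaleR_matrix_vector_assoc
        matrix_vector_mult_scaleR intro!: exI[of _ 1] norm_matrix_vector_mult_le)
  then show "continuous_on UNIV (\<lambda>p :: (real ^ 'q ^ 'd) \<times> (real ^ 'q). fst p *v snd p)"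
    by (rule bounded_bilinear.continuous_on) (intro continuous_intros)+
qed

lemma graphon_measurable:
  assumes "graphon G"
  shows "(\<lambda>(u, v). G u v) \<in> borel_measurable (unit_interval \<Otimes>\<^sub>M unit_interval)"
proof -
  have "(\<lambda>p. p) \<in> unit_interval \<Otimes>\<^sub>M unit_interval \<rightarrow>\<^sub>M restrict_space borel ({0..1} \<times> {0..1})"
  proof (rule measurable_restrict_space2)
    have "(\<lambda>p. (fst p, snd p)) \<in> unit_interval \<Otimes>\<^sub>M unit_interval \<rightarrow>\<^sub>M borel \<Otimes>\<^sub>M borel"
    proof (rule measurable_Pair)
      have id: "(\<lambda>v. v) \<in> unit_interval \<rightarrow>\<^sub>M borel" by (rule measurable_restrict_space1) simp
      show "fst \<in> unit_interval \<Otimes>\<^sub>M unit_interval \<rightarrow>\<^sub>M borel"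
        by (rule measurable_compose[OF measurable_fst id])
      show "snd \<in> unit_interval \<Otimes>\<^sub>M unit_interval \<rightarrow>\<^sub>M borel"
        by (rule measurable_compose[OF measurable_snd id])
    qed
    then show "(\<lambda>p. p) \<in> unit_interval \<Otimes>\<^sub>M unit_interval \<rightarrow>\<^sub>M borel" by (simp add: borel_prod)
  qed (auto simp: space_pair_measure)
  moreover have "case_prod G \<in> borel_measurable (restrict_space borel ({0..1} \<times> {0..1}))"
    using assms unfolding graphon_def by blast
  ultimately show ?thesis by (rule measurable_compose)
qed

lemma graphon_unit_valued:
  assumes "graphon G" "u \<in> {0..1}"
  shows "unit_valued (G u)"
proof -
  have "(\<lambda>v. (\<lambda>(u, v). G u v) (u, v)) \<in> borel_measurable unit_interval"
    using assms(2) by (intro measurable_compose[OF _ graphon_measurable[OF assms(1)]] measurable_Pair) auto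
  then show ?thesis using assms by (auto simp: unit_valued_def graphon_def)
qed

lemma dense_unit_unit_valued: "unit_valued (dense_unit k)"
  using dense_unit_range by (auto simp: unit_valued_def)

text \<open>A diffusion coefficient frozen at one time, with its Lipschitz bound in the entrywise
  norm of the matrix type.\<close>

locale lipschitz_coefficient = measure_family \<mu> for \<mu> :: "real \<Rightarrow> (real ^ 'd) measure" +
  fixes x\<^sub>0 :: "real ^ 'd" and s :: "real ^ 'd \<Rightarrow> (real ^ 'd) measure \<Rightarrow> real ^ 'q ^ 'd" and L :: real
  assumes L_nonneg: "0 \<le> L"
    and lipschitz: "\<And>x y \<kappa> \<nu>. \<kappa> \<in> finite_measures2 \<Longrightarrow> \<nu> \<in> finite_measures2 \<Longrightarrow>
      norm (s x \<kappa> - s y \<nu>) \<le> L * (norm (x - y) + wop2 x\<^sub>0 \<kappa> \<nu>)"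
begin

lemma coefficient_density_mix_le:
  obtains C where "0 \<le> C" "\<And>x y g g'. unit_valued g \<Longrightarrow> unit_valued g' \<Longrightarrow>
    norm (s x (density_mix \<mu> g) - s y (density_mix \<mu> g'))
      \<le> L * (norm (x - y) + C * sqrt (L1_dist g g'))"
proof -
  obtain D where D: "0 \<le> D" "\<And>v. v \<in> {0..1} \<Longrightarrow> (\<integral>\<^sup>+ x. ennreal ((norm (x - x\<^sub>0))\<^sup>2) \<partial>(\<mu> v)) \<le> ennreal D"
    using second_moment_bound[of x\<^sub>0] by blast
  show ?thesis
  proof (rule that[of "sqrt (1 + 5 * D)"])
    fix x y g g' assume g: "unit_valued g" "unit_valued g'"
    have "norm (s x (density_mix \<mu> g) - s y (density_mix \<mu> g'))
        \<le> L * (norm (x - y) + wop2 x\<^sub>0 (density_mix \<mu> g) (density_mix \<mu> g'))"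
      by (intro lipschitz density_mix_finite_measures2 g)
    also have "\<dots> \<le> L * (norm (x - y) + sqrt ((1 + 5 * D) * L1_dist g g'))"
      using L_nonneg by (intro mult_left_mono add_left_mono wop2_density_mix_le D g)
    finally show "norm (s x (density_mix \<mu> g) - s y (density_mix \<mu> g'))
      \<le> L * (norm (x - y) + sqrt (1 + 5 * D) * sqrt (L1_dist g g'))"
      by (simp add: real_sqrt_mult)
  qed (use D in simp)
qed

text \<open>\<open>G u\<close> is replaced by the first member of the dense sequence at distance less than
  \<open>1 / (n + 1)\<close>; this choice is measurable in \<open>u\<close> and takes countably many values.\<close>

lemma coefficient_measurable:
  assumes G: "graphon G"
  shows "(\<lambda>(u, x). s x (graphon_mix G \<mu> u)) \<in> borel_measurable (unit_interval \<Otimes>\<^sub>M borel)"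
proof -
  interpret U: prob_space unit_interval by (rule prob_space_unit_interval)
  note G_meas [measurable] = graphon_measurable[OF G]
  obtain C where C: "0 \<le> C" "\<And>x y g g'. unit_valued g \<Longrightarrow> unit_valued g' \<Longrightarrow>
    norm (s x (density_mix \<mu> g) - s y (density_mix \<mu> g'))
      \<le> L * (norm (x - y) + C * sqrt (L1_dist g g'))"
    using coefficient_density_mix_le by blast
  define \<delta> where "\<delta> k u = L1_dist (G u) (dense_unit k)" for k u
  have [measurable]: "\<delta> k \<in> borel_measurable unit_interval" for k
  proof -
    have "(\<lambda>(u, v). \<bar>(\<lambda>(u, v). G u v) (u, v) - dense_unit k v\<bar>) \<in> borel_measurable (unit_interval \<Otimes>\<^sub>M unit_interval)"
      by measurable
    then show ?thesis
      unfolding \<delta>_def by (intro U.borel_measurable_lebesgue_integral) simp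
  qed
  define k where "k n u = (LEAST k. \<delta> k u < 1 / real (Suc n))" for n u
  have [measurable]: "k n \<in> unit_interval \<rightarrow>\<^sub>M count_space UNIV" for n
    unfolding k_def by measurable
  have k: "\<delta> (k n u) u < 1 / real (Suc n)" if "u \<in> {0..1}" for n u
  proof -
    have "\<exists>k. \<delta> k u < 1 / real (Suc n)"
      unfolding \<delta>_def using graphon_unit_valued[OF G that]
      by (intro dense_unit_dense) (auto simp: unit_valued_def)
    then show ?thesis unfolding k_def by (rule LeastI_ex)
  qed
  have cont: "(\<lambda>x. s x (density_mix \<mu> (dense_unit j))) \<in> borel_measurable borel" for j
  proof -
    have "L-lipschitz_on UNIV (\<lambda>x. s x (density_mix \<mu> (dense_unit j)))"
    proof (rule lipschitz_onI[OF _ L_nonneg])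
      fix x y
      show "dist (s x (density_mix \<mu> (dense_unit j))) (s y (density_mix \<mu> (dense_unit j))) \<le> L * dist x y"
        using C(2)[OF dense_unit_unit_valued dense_unit_unit_valued, of x j y j] by (simp add: dist_norm)
    qed
    then show ?thesis by (intro borel_measurable_continuous_onI lipschitz_on_continuous_on)
  qed
  show ?thesis
  proof (rule borel_measurable_LIMSEQ_metric)
    show "(\<lambda>p. s (snd p) (density_mix \<mu> (dense_unit (k n (fst p))))) \<in> borel_measurable (unit_interval \<Otimes>\<^sub>M borel)" for n
    proof (rule measurable_compose_countable[where g = "\<lambda>p. k n (fst p)" and f = "\<lambda>j p. s (snd p) (density_mix \<mu> (dense_unit j))"])
      show "(\<lambda>p. s (snd p) (density_mix \<mu> (dense_unit j))) \<in> borel_measurable (unit_interval \<Otimes>\<^sub>M borel)" for j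
        by (rule measurable_compose[OF measurable_snd cont])
    qed measurable
    fix p :: "real \<times> (real ^ 'd)" assume "p \<in> space (unit_interval \<Otimes>\<^sub>M borel)"
    then obtain u x where p: "p = (u, x)" and u: "u \<in> {0..1}" by (auto simp: space_pair_measure)
    have "(\<lambda>n. s x (density_mix \<mu> (dense_unit (k n u)))) \<longlonglongrightarrow> s x (density_mix \<mu> (G u))"
    proof (rule LIM_zero_cancel, rule tendsto_0_le[where K = 1])
      have "(\<lambda>n. L * C * sqrt (1 / real (Suc n))) \<longlonglongrightarrow> L * C * sqrt 0"
        using LIMSEQ_inverse_real_of_nat by (intro tendsto_mult_left tendsto_real_sqrt) (simp add: inverse_eq_divide)
      then show "(\<lambda>n. L * C * sqrt (1 / real (Suc n))) \<longlonglongrightarrow> 0" by simp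
      show "\<forall>\<^sub>F n in sequentially. norm (s x (density_mix \<mu> (dense_unit (k n u))) - s x (density_mix \<mu> (G u)))
          \<le> norm (L * C * sqrt (1 / real (Suc n))) * 1"
      proof (intro always_eventually allI)
        fix n
        have "norm (s x (density_mix \<mu> (G u)) - s x (density_mix \<mu> (dense_unit (k n u)))) \<le> L * (C * sqrt (\<delta> (k n u) u))"
          using C(2)[OF graphon_unit_valued[OF G u] dense_unit_unit_valued, of x x "k n u"] by (simp add: \<delta>_def)
        also have "\<dots> \<le> L * (C * sqrt (1 / real (Suc n)))"
          using k[OF u, of n] L_nonneg C(1) by (intro mult_left_mono real_sqrt_le_mono) auto
        also have "\<dots> \<le> norm (L * C * sqrt (1 / real (Suc n))) * 1" by (simp add: mult.assoc)
        finally show "norm (s x (density_mix \<mu> (dense_unit (k n u))) - s x (density_mix \<mu> (G u)))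
            \<le> norm (L * C * sqrt (1 / real (Suc n))) * 1"
          by (simp only: norm_minus_commute)
      qed
    qed
    then show "(\<lambda>n. s (snd p) (density_mix \<mu> (dense_unit (k n (fst p))))) \<longlonglongrightarrow> (case p of (u, x) \<Rightarrow> s x (graphon_mix G \<mu> u))"
      by (simp add: p graphon_mix_eq_density_mix)
  qed
qed

text \<open>Comparison with the zero density at the point 0: every G u lies within L1 distance 1 of
  it, so the bound is uniform in the label.\<close>

lemma coefficient_growth:
  assumes G: "graphon G"
  obtains K where "0 \<le> K" "\<And>u x. u \<in> {0..1} \<Longrightarrow> norm (s x (graphon_mix G \<mu> u)) \<le> K * (1 + norm x)"
proof -
  obtain C where C: "0 \<le> C" "\<And>x y g g'. unit_valued g \<Longrightarrow> unit_valued g' \<Longrightarrow>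
    norm (s x (density_mix \<mu> g) - s y (density_mix \<mu> g'))
      \<le> L * (norm (x - y) + C * sqrt (L1_dist g g'))"
    using coefficient_density_mix_le by blast
  let ?c = "norm (s 0 (density_mix \<mu> (\<lambda>_. 0)))"
  have zero: "unit_valued (\<lambda>_. 0)" by (simp add: unit_valued_def)
  have "norm (s x (graphon_mix G \<mu> u)) \<le> (?c + L + L * C) * (1 + norm x)" if "u \<in> {0..1}" for u x
  proof -
    have Gu: "unit_valued (G u)" using G that by (rule graphon_unit_valued)
    have "(\<integral>v. \<bar>G u v - 0\<bar> \<partial>unit_interval) = (\<integral>v. G u v \<partial>unit_interval)"
      using Gu by (intro Bochner_Integration.integral_cong) (auto simp: unit_valued_def)
    then have "sqrt (\<integral>v. \<bar>G u v - 0\<bar> \<partial>unit_interval) \<le> 1" using unit_valued_integral[OF Gu] by simp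
    then have "L * (norm x + C * sqrt (\<integral>v. \<bar>G u v - 0\<bar> \<partial>unit_interval)) \<le> L * (norm x + C * 1)"
      using C(1) L_nonneg by (intro mult_left_mono add_left_mono) auto
    moreover have "norm (s x (density_mix \<mu> (G u)) - s 0 (density_mix \<mu> (\<lambda>_. 0)))
        \<le> L * (norm x + C * sqrt (\<integral>v. \<bar>G u v - 0\<bar> \<partial>unit_interval))"
      using C(2)[OF Gu zero, of x 0] by simp
    ultimately have "norm (s x (density_mix \<mu> (G u))) \<le> ?c + L * (norm x + C)"
      using norm_triangle_ineq2[of "s x (density_mix \<mu> (G u))" "s 0 (density_mix \<mu> (\<lambda>_. 0))"] by simp
    also have "\<dots> \<le> (?c + L + L * C) * (1 + norm x)"
      using L_nonneg C(1) by (simp add: algebra_simps)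
    finally show ?thesis by (simp add: graphon_mix_eq_density_mix)
  qed
  then show ?thesis using L_nonneg C(1) by (intro that[of "?c + L + L * C"]) auto
qed

end

text \<open>The law of b(X) + S(X) Z for independent X and Z with laws \<mu> and \<gamma>. As an
  operation on laws it can also be applied to a pair of law and coefficient that no Euler sequence
  realizes.\<close>

definition step_law ::
  "(real ^ 'q) measure \<Rightarrow> (real ^ 'd) measure \<Rightarrow> (real ^ 'd \<Rightarrow> real ^ 'd) \<Rightarrow> (real ^ 'd \<Rightarrow> real ^ 'q ^ 'd) \<Rightarrow> (real ^ 'd) measure" where
  "step_law \<gamma> \<mu> b S = distr (\<mu> \<Otimes>\<^sub>M \<gamma>) borel (\<lambda>(x, z). b x + S x *v z)"

lemma measure_familiesI:
  fixes \<nu> :: "real \<Rightarrow> (real ^ 'd) measure"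
  assumes kernel: "\<nu> \<in> unit_interval \<rightarrow>\<^sub>M prob_algebra borel"
    and bound: "\<And>u. u \<in> {0..1} \<Longrightarrow> (\<integral>\<^sup>+ x. ennreal ((norm x)\<^sup>2) \<partial>\<nu> u) \<le> C" and fin: "C < \<infinity>"
  shows "\<nu> \<in> measure_families"
  unfolding measure_families_def
proof (intro CollectI conjI ballI)
  fix u :: real assume u: "u \<in> {0..1}"
  show "\<nu> u \<in> prob_measures2"
    using measurable_space[OF kernel, of u] u le_less_trans[OF bound[OF u] fin]
    by (simp add: prob_measures2_def space_prob_algebra)
next
  fix A :: "(real ^ 'd) set" assume "A \<in> sets borel"
  then have "(\<lambda>u. measure (\<nu> u) A) \<in> borel_measurable unit_interval"
    by (intro measure_measurable_prob_algebra2[OF _ kernel] pair_measureI sets.top)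
  then show "(\<lambda>u. measure (\<nu> u) A) \<in> borel_measurable (restrict_space borel {0..1})"
    by (simp only: measurable_unit_interval_borel)
next
  show "(SUP u\<in>{0..1}. \<integral>\<^sup>+ x. ennreal ((norm x)\<^sup>2) \<partial>\<nu> u) < \<infinity>"
    using bound by (intro le_less_trans[OF SUP_least fin])
qed

text \<open>The product kernel u \<mapsto> \<mu> u \<Otimes> \<gamma> is pushed forward by a jointly
  measurable map, hence stays measurable. Linear growth and two uses of (1 + t)^2 \<le> 2 (1 + t^2)
  give the factor 4 K^2 in the moment bound.\<close>

lemma step_law_measure_families:
  fixes \<gamma> :: "(real ^ 'q) measure" and S :: "real \<Rightarrow> real ^ 'd \<Rightarrow> real ^ 'q ^ 'd"
  assumes "isotropic_prob \<gamma>" and \<mu>: "\<mu> \<in> measure_families"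
    and b: "b \<in> borel_measurable borel" "\<And>x. norm (b x) \<le> K * (1 + norm x)"
    and S: "(\<lambda>(u, x). S u x) \<in> borel_measurable (unit_interval \<Otimes>\<^sub>M borel)"
      "\<And>u x. u \<in> {0..1} \<Longrightarrow> norm (S u x) \<le> K * (1 + norm x)"
    and \<nu>: "\<And>u. u \<in> {0..1} \<Longrightarrow> \<nu> u = step_law \<gamma> (\<mu> u) b (S u)"
  shows "\<nu> \<in> measure_families"
proof -
  interpret isotropic_prob \<gamma> by fact
  interpret measure_family \<mu> by unfold_locales (rule \<mu>)
  note [measurable] = b(1) S(1)
  have \<gamma>: "(\<lambda>_. \<gamma>) \<in> unit_interval \<rightarrow>\<^sub>M prob_algebra borel"
    using prob_space_axioms sets_eq_borel by (intro measurable_const) (simp add: space_prob_algebra)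
  have pair: "(\<lambda>u. \<mu> u \<Otimes>\<^sub>M \<gamma>) \<in> unit_interval \<rightarrow>\<^sub>M prob_algebra (borel \<Otimes>\<^sub>M borel)"
    using family_measurable \<gamma> by (rule measurable_pair_prob)
  have F: "(\<lambda>(u, x, z). b x + S u x *v z) \<in> borel_measurable (unit_interval \<Otimes>\<^sub>M (borel \<Otimes>\<^sub>M borel))"
  proof -
    have "(\<lambda>p. (\<lambda>(u, x). S u x) (fst p, fst (snd p))) \<in> borel_measurable (unit_interval \<Otimes>\<^sub>M (borel \<Otimes>\<^sub>M borel))"
      by measurable
    then have "(\<lambda>p. S (fst p) (fst (snd p)) *v snd (snd p)) \<in> borel_measurable (unit_interval \<Otimes>\<^sub>M (borel \<Otimes>\<^sub>M borel))"
      by (intro borel_measurable_matrix_vector_mult) simp_all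
    then show ?thesis unfolding split_beta' by simp
  qed
  have kernel: "(\<lambda>u. step_law \<gamma> (\<mu> u) b (S u)) \<in> unit_interval \<rightarrow>\<^sub>M prob_algebra borel"
    unfolding step_law_def using F by (intro measurable_distr_prob_space2[OF pair]) (simp add: split_beta')
  obtain D where D: "0 \<le> D" "\<And>v. v \<in> {0..1} \<Longrightarrow> (\<integral>\<^sup>+ x. ennreal ((norm (x - 0))\<^sup>2) \<partial>(\<mu> v)) \<le> ennreal D"
    using second_moment_bound[of 0] by blast
  let ?g = "\<integral>\<^sup>+ z. ennreal ((norm z)\<^sup>2) \<partial>\<gamma>"
  have bound: "(\<integral>\<^sup>+ y. ennreal ((norm y)\<^sup>2) \<partial>(step_law \<gamma> (\<mu> u) b (S u)))
      \<le> ennreal (4 * K\<^sup>2) * (1 + ennreal D) * (1 + ?g)" if u: "u \<in> {0..1}" for u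
  proof -
    interpret \<mu>u: prob_space "\<mu> u" using u by (rule prob_space_family)
    have [measurable_cong]: "sets (\<mu> u) = sets borel" using u by (rule sets_family)
    have Fu [measurable]: "(\<lambda>(x, z). b x + S u x *v z) \<in> borel_measurable (\<mu> u \<Otimes>\<^sub>M \<gamma>)"
    proof -
      have "(\<lambda>p. (\<lambda>(u, x, z). b x + S u x *v z) (u, p)) \<in> borel_measurable (borel \<Otimes>\<^sub>M borel)"
        using u by (intro measurable_compose[OF _ F] measurable_Pair) auto
      then show ?thesis by (simp add: split_beta' cong: measurable_cong_sets)
    qed
    have "(\<integral>\<^sup>+ y. ennreal ((norm y)\<^sup>2) \<partial>(step_law \<gamma> (\<mu> u) b (S u)))
        = (\<integral>\<^sup>+ p. ennreal ((norm (case p of (x, z) \<Rightarrow> b x + S u x *v z))\<^sup>2) \<partial>(\<mu> u \<Otimes>\<^sub>M \<gamma>))"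
      unfolding step_law_def by (rule nn_integral_distr[OF Fu]) simp
    also have "\<dots> \<le> (\<integral>\<^sup>+ p. ennreal (4 * K\<^sup>2) * (1 + ennreal ((norm (fst p))\<^sup>2)) * (1 + ennreal ((norm (snd p))\<^sup>2)) \<partial>(\<mu> u \<Otimes>\<^sub>M \<gamma>))"
    proof (rule nn_integral_mono)
      fix p :: "(real ^ 'd) \<times> (real ^ 'q)"
      obtain x z where p: "p = (x, z)" by (cases p)
      have K: "0 \<le> K" using order_trans[OF norm_ge_zero b(2)[of 0]] by simp
      have "norm (b x + S u x *v z) \<le> norm (b x) + norm (S u x) * norm z"
        by (intro norm_triangle_le add_left_mono norm_matrix_vector_mult_le)
      also have "\<dots> \<le> K * (1 + norm x) + K * (1 + norm x) * norm z"
        using b(2)[of x] S(2)[OF u, of x] by (intro add_mono mult_right_mono) auto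
      finally have "norm (b x + S u x *v z) \<le> K * (1 + norm x) * (1 + norm z)" by (simp add: distrib_left)
      then have "(norm (b x + S u x *v z))\<^sup>2 \<le> (K * (1 + norm x) * (1 + norm z))\<^sup>2" by (intro power_mono) auto
      also have "\<dots> = K\<^sup>2 * ((1 + norm x)\<^sup>2 * (1 + norm z)\<^sup>2)" by (simp add: power_mult_distrib)
      also have "\<dots> \<le> K\<^sup>2 * ((2 * (1 + (norm x)\<^sup>2)) * (2 * (1 + (norm z)\<^sup>2)))"
      proof (intro mult_left_mono mult_mono)
        have "(1 + t)\<^sup>2 \<le> 2 * (1 + t\<^sup>2)" for t :: real
          using sum_squares_bound[of 1 t] by (simp add: power2_sum)
        then show "(1 + norm x)\<^sup>2 \<le> 2 * (1 + (norm x)\<^sup>2)" "(1 + norm z)\<^sup>2 \<le> 2 * (1 + (norm z)\<^sup>2)" by blast+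
      qed auto
      also have "\<dots> = 4 * K\<^sup>2 * (1 + (norm x)\<^sup>2) * (1 + (norm z)\<^sup>2)" by (simp add: algebra_simps)
      finally have "ennreal ((norm (b x + S u x *v z))\<^sup>2) \<le> ennreal (4 * K\<^sup>2 * (1 + (norm x)\<^sup>2) * (1 + (norm z)\<^sup>2))"
        by (rule ennreal_leI)
      also have "\<dots> = ennreal (4 * K\<^sup>2) * (1 + ennreal ((norm x)\<^sup>2)) * (1 + ennreal ((norm z)\<^sup>2))"
        by (subst ennreal_mult, simp, simp)+ (simp flip: ennreal_1 ennreal_plus)
      finally show "ennreal ((norm (case p of (x, z) \<Rightarrow> b x + S u x *v z))\<^sup>2)
          \<le> ennreal (4 * K\<^sup>2) * (1 + ennreal ((norm (fst p))\<^sup>2)) * (1 + ennreal ((norm (snd p))\<^sup>2))"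
        by (simp add: p)
    qed
    also have "\<dots> = (\<integral>\<^sup>+ x. (\<integral>\<^sup>+ z. ennreal (4 * K\<^sup>2) * (1 + ennreal ((norm x)\<^sup>2)) * (1 + ennreal ((norm z)\<^sup>2)) \<partial>\<gamma>) \<partial>(\<mu> u))"
      by (subst nn_integral_fst[symmetric]) simp_all
    also have "\<dots> = (\<integral>\<^sup>+ x. ennreal (4 * K\<^sup>2) * (1 + ennreal ((norm x)\<^sup>2)) * (1 + ?g) \<partial>(\<mu> u))"
      by (simp add: nn_integral_cmult nn_integral_add emeasure_space_1)
    also have "\<dots> = ennreal (4 * K\<^sup>2) * (1 + (\<integral>\<^sup>+ x. ennreal ((norm x)\<^sup>2) \<partial>(\<mu> u))) * (1 + ?g)"
      by (simp add: nn_integral_multc nn_integral_cmult nn_integral_add \<mu>u.emeasure_space_1)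
    also have "\<dots> \<le> ennreal (4 * K\<^sup>2) * (1 + ennreal D) * (1 + ?g)"
      using D(2)[OF u] by (intro mult_right_mono mult_left_mono add_left_mono) auto
    finally show ?thesis .
  qed
  have fin: "ennreal (4 * K\<^sup>2) * (1 + ennreal D) * (1 + ?g) < \<infinity>"
    using second_moment by (simp add: ennreal_mult_less_top)
  have "(\<lambda>u. step_law \<gamma> (\<mu> u) b (S u)) \<in> unit_interval \<rightarrow>\<^sub>M prob_algebra borel \<longleftrightarrow>
      \<nu> \<in> unit_interval \<rightarrow>\<^sub>M prob_algebra borel"
    using \<nu> by (intro measurable_cong) simp
  then show ?thesis using kernel bound \<nu> by (intro measure_familiesI[OF _ _ fin]) auto
qed

section \<open>One step of the Euler sequence\<close>

lemma positive_semidefinite_add: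
  assumes "positive_semidefinite P" "positive_semidefinite Q"
  shows "positive_semidefinite (P + Q)"
proof -
  have "transpose (P + Q) = transpose P + transpose Q" by (simp add: transpose_def vec_eq_iff)
  then show ?thesis
    using assms by (simp add: positive_semidefinite_def matrix_vector_mult_add_rdistrib inner_add_right)
qed

lemma matrix_order_trans: "A \<preceq>\<^sub>m B \<Longrightarrow> B \<preceq>\<^sub>m C \<Longrightarrow> A \<preceq>\<^sub>m C"
  unfolding matrix_order_def by (drule (1) positive_semidefinite_add) simp

lemma prob_measures2_subset: "\<mu> \<in> prob_measures2 \<Longrightarrow> \<mu> \<in> prob_measures1"
  unfolding prob_measures2_def prob_measures1_def using nn_integral_norm_finite by auto

context isotropic_prob
begin

lemma step_function_measurable:
  fixes b :: "real ^ 'd \<Rightarrow> real ^ 'd" and S :: "real ^ 'd \<Rightarrow> real ^ 'q ^ 'd"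
  assumes [measurable]: "b \<in> borel_measurable borel" "S \<in> borel_measurable borel"
  shows "(\<lambda>(x, z). b x + S x *v z) \<in> borel_measurable (borel \<Otimes>\<^sub>M borel)"
proof -
  have "(\<lambda>p. S (fst p) *v snd p) \<in> borel_measurable (borel \<Otimes>\<^sub>M borel)"
    by (rule borel_measurable_matrix_vector_mult) measurable
  then show ?thesis by (simp add: split_beta')
qed

lemma
  fixes \<phi> :: "real ^ 'd \<Rightarrow> real"
  assumes \<kappa>: "\<kappa> \<in> prob_measures1" and st: "step_law \<gamma> \<kappa> b S \<in> prob_measures1"
    and meas [measurable]: "b \<in> borel_measurable borel" "S \<in> borel_measurable borel"
    and cvx: "convex_on UNIV \<phi>" and lip: "\<And>x y. \<phi> x - \<phi> y \<le> C * norm (x - y)"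
  shows integrable_avg_step: "integrable \<kappa> (\<lambda>x. avg \<phi> (b x) (S x))"
    and integral_step_law: "integral\<^sup>L (step_law \<gamma> \<kappa> b S) \<phi> = (\<integral>x. avg \<phi> (b x) (S x) \<partial>\<kappa>)"
proof -
  have [measurable_cong]: "sets \<kappa> = sets borel" using \<kappa> by (simp add: prob_measures1_def)
  interpret \<kappa>: prob_space \<kappa> using \<kappa> by (simp add: prob_measures1_def)
  interpret pair_sigma_finite \<kappa> \<gamma> by unfold_locales
  have [measurable]: "(\<lambda>(x, z). b x + S x *v z) \<in> borel_measurable (\<kappa> \<Otimes>\<^sub>M \<gamma>)"
    using step_function_measurable[OF meas] by (simp cong: measurable_cong_sets)
  have [measurable]: "\<phi> \<in> borel_measurable borel" using cvx by (rule convex_on_UNIV_borel_measurable)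
  have "integrable (step_law \<gamma> \<kappa> b S) \<phi>"
    using st by (intro integrable_lipschitz[OF _ _ _ lip]) (auto simp: prob_measures1_def prob_space.axioms)
  then have int: "integrable (\<kappa> \<Otimes>\<^sub>M \<gamma>) (\<lambda>(x, z). \<phi> (b x + S x *v z))"
    unfolding step_law_def by (subst (asm) integrable_distr_eq) (simp_all add: split_beta')
  show "integrable \<kappa> (\<lambda>x. avg \<phi> (b x) (S x))"
    using integrable_fst'[OF int] by (simp add: avg_def)
  have "integral\<^sup>L (step_law \<gamma> \<kappa> b S) \<phi> = (\<integral>(x, z). \<phi> (b x + S x *v z) \<partial>(\<kappa> \<Otimes>\<^sub>M \<gamma>))"
    unfolding step_law_def by (subst integral_distr) (simp_all add: split_beta')
  also have "\<dots> = (\<integral>x. avg \<phi> (b x) (S x) \<partial>\<kappa>)"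
    using integral_fst'[OF int] by (simp add: avg_def)
  finally show "integral\<^sup>L (step_law \<gamma> \<kappa> b S) \<phi> = (\<integral>x. avg \<phi> (b x) (S x) \<partial>\<kappa>)" .
qed

text \<open>The law changes first, at coefficient S, and the coefficient second, at law \<nu>. The
  hybrid \<open>step_law \<gamma> \<nu> b S\<close> between them needs a first moment for its
  integrals to be finite.\<close>

lemma step_law_convex_order:
  fixes S T :: "real ^ 'd \<Rightarrow> real ^ 'q ^ 'd"
  assumes le: "\<kappa> \<preceq>\<^sub>c\<^sub>v \<nu>" and b: "affine_map b" "b \<in> borel_measurable borel"
    and S: "\<And>x y r. r \<in> {0..1} \<Longrightarrow> S (r *\<^sub>R x + (1 - r) *\<^sub>R y) \<preceq>\<^sub>m r *\<^sub>R S x + (1 - r) *\<^sub>R S y"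
    and ST: "\<And>x. S x \<preceq>\<^sub>m T x"
    and meas: "S \<in> borel_measurable borel" "T \<in> borel_measurable borel"
    and st: "step_law \<gamma> \<kappa> b S \<in> prob_measures1" "step_law \<gamma> \<nu> b S \<in> prob_measures1"
      "step_law \<gamma> \<nu> b T \<in> prob_measures1"
  shows "step_law \<gamma> \<kappa> b S \<preceq>\<^sub>c\<^sub>v step_law \<gamma> \<nu> b T"
proof (rule convex_orderI_lipschitz[OF st(1,3)])
  fix \<phi> :: "real ^ 'd \<Rightarrow> real" and C :: real
  assume cvx: "convex_on UNIV \<phi>" and lip: "\<And>x y. \<phi> x - \<phi> y \<le> C * norm (x - y)"
  have \<kappa>\<nu>: "\<kappa> \<in> prob_measures1" "\<nu> \<in> prob_measures1" using le by (auto simp: convex_order_def)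
  have "integral\<^sup>L (step_law \<gamma> \<kappa> b S) \<phi> = (\<integral>x. avg \<phi> (b x) (S x) \<partial>\<kappa>)"
    by (rule integral_step_law[OF \<kappa>\<nu>(1) st(1) b(2) meas(1) cvx lip])
  also have "\<dots> \<le> (\<integral>x. avg \<phi> (b x) (S x) \<partial>\<nu>)"
    by (intro convex_order_integral_le[OF le] convex_on_avg[OF cvx lip b(1) S]
        integrable_avg_step[OF \<kappa>\<nu>(1) st(1) b(2) meas(1) cvx lip]
        integrable_avg_step[OF \<kappa>\<nu>(2) st(2) b(2) meas(1) cvx lip])
  also have "\<dots> \<le> (\<integral>x. avg \<phi> (b x) (T x) \<partial>\<nu>)"
    by (intro integral_mono avg_mono[OF cvx lip] ST
        integrable_avg_step[OF \<kappa>\<nu>(2) st(2) b(2) meas(1) cvx lip]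
        integrable_avg_step[OF \<kappa>\<nu>(2) st(3) b(2) meas(2) cvx lip])
  also have "\<dots> = integral\<^sup>L (step_law \<gamma> \<nu> b T) \<phi>"
    by (rule integral_step_law[OF \<kappa>\<nu>(2) st(3) b(2) meas(2) cvx lip, symmetric])
  finally show "integral\<^sup>L (step_law \<gamma> \<kappa> b S) \<phi> \<le> integral\<^sup>L (step_law \<gamma> \<nu> b T) \<phi>" .
qed

end

text \<open>X m is a function of X 0 and W 0, ..., W (m - 1), so it is independent of W m. The
  \<sigma>-algebra N carries the whole noise: X 0 is independent of N, and the W k are independent
  among themselves.\<close>

lemma (in prob_space) recursion_indep:
  fixes X :: "nat \<Rightarrow> 'a \<Rightarrow> 'b :: euclidean_space" and W :: "nat \<Rightarrow> 'a \<Rightarrow> 'c :: euclidean_space"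
  assumes X0: "X 0 \<in> borel_measurable M"
    and indep: "indep_set (sets (vimage_algebra (space M) (X 0) borel)) (sets N)"
    and N: "space N = space M" and W_N: "\<And>k. W k \<in> borel_measurable N"
    and W: "\<And>n. indep_vars (\<lambda>_. borel) W {..<n}"
    and X: "\<And>k w. k < m \<Longrightarrow> X (Suc k) w = f k (X k w, W k w)"
    and f: "\<And>k. k < m \<Longrightarrow> f k \<in> borel_measurable (borel \<Otimes>\<^sub>M borel)"
  shows "X m \<in> borel_measurable M \<and>
    distr M (borel \<Otimes>\<^sub>M borel) (\<lambda>w. (X m w, W m w)) = distr M borel (X m) \<Otimes>\<^sub>M distr M borel (W m)"
proof -
  \<comment> \<open>The index is shifted by one: 0 stands for X 0 and \<open>Suc k\<close> for W
    k.\<close>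
  define E where "E i = (case i of 0 \<Rightarrow> {X 0 -` A \<inter> space M | A. A \<in> sets borel}
      | Suc k \<Rightarrow> {W k -` A \<inter> space M | A. A \<in> sets borel})" for i
  have W_rv: "W k \<in> borel_measurable M" for k using W[of "Suc k"] by (auto simp: indep_vars_def)
  have E0: "E 0 = sets (vimage_algebra (space M) (X 0) borel)"
    by (auto simp: E_def sets_vimage_algebra2)
  have E_Suc: "E (Suc k) = {W k -` A \<inter> space M | A. A \<in> sets borel}" for k by (simp add: E_def)
  have E_Suc': "E (Suc k) = sets (vimage_algebra (space M) (W k) borel)" for k
    by (simp add: E_Suc sets_vimage_algebra2)
  have E_N: "E (Suc k) \<subseteq> sets N" for k
    using measurable_sets[OF W_N] by (auto simp: E_Suc N)
  \<comment> \<open>A finite intersection splits into an event of X 0, if present, and events of the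
    W k. The latter meet in a member of N, which splits off the first factor; independence of W
    factors the rest.\<close>
  have E_ind: "indep_sets E UNIV"
  proof (rule indep_setsI)
    show "E i \<subseteq> events" for i
      using X0 W_rv by (cases i) (auto simp: E_def)
    fix A J assume J: "J \<noteq> {}" "finite J" and A: "\<forall>j\<in>J. A j \<in> E j"
    define J' where "J' = {k. Suc k \<in> J}"
    have J'_fin: "finite J'"
      unfolding J'_def using J(2) by (rule finite_vimageI[of J Suc, unfolded vimage_def]) simp
    obtain n where n: "J' \<subseteq> {..<n}" using J'_fin finite_nat_set_iff_bounded by auto
    have J'_prob: "prob (\<Inter>k\<in>J'. A (Suc k)) = (\<Prod>k\<in>J'. prob (A (Suc k)))" if "J' \<noteq> {}"
    proof (rule indep_setsD)
      show "indep_sets (\<lambda>k. E (Suc k)) {..<n}"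
        using W[of n] by (simp add: indep_vars_def2 E_Suc)
    qed (use that n J'_fin A in \<open>auto simp: J'_def\<close>)
    have J_eq: "J = (if 0 \<in> J then insert 0 (Suc ` J') else Suc ` J')"
      unfolding J'_def by (auto simp: image_iff) (metis not0_implies_Suc)+
    show "prob (\<Inter>j\<in>J. A j) = (\<Prod>j\<in>J. prob (A j))"
    proof (cases "0 \<in> J")
      case False
      then have "J = Suc ` J'" using J_eq by simp
      moreover from this have "J' \<noteq> {}" using J(1) by auto
      ultimately show ?thesis using J'_prob by (simp add: prod.reindex)
    next
      case True
      then have J2: "J = insert 0 (Suc ` J')" using J_eq by simp
      show ?thesis
      proof (cases "J' = {}")
        case True
        then show ?thesis by (simp add: J2)
      next
        case False
        have "(\<Inter>k\<in>J'. A (Suc k)) \<in> sets N"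
          using E_N A False J'_fin by (intro sets.finite_INT) (auto simp: J'_def)
        then have "prob (A 0 \<inter> (\<Inter>k\<in>J'. A (Suc k))) = prob (A 0) * prob (\<Inter>k\<in>J'. A (Suc k))"
          using A True unfolding E0[symmetric] by (intro indep_setD[OF indep[folded E0]]) auto
        then show ?thesis
          using J'_prob[OF False] J'_fin by (simp add: J2 prod.reindex)
      qed
    qed
  qed
  \<comment> \<open>By the shift, the block {..m} contains X 0 and W 0, ..., W (m - 1), while
    \<open>Suc m\<close> is W m alone.\<close>
  define I where "I j = (if j then {..m} else {Suc m})" for j
  have "indep_sets (\<lambda>j. sigma_sets (space M) (\<Union>i\<in>I j. E i)) UNIV"
  proof (rule indep_sets_collect_sigma)
    show "indep_sets E (\<Union>j\<in>UNIV. I j)" using E_ind by (rule indep_sets_mono_index[rotated]) simp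
    show "Int_stable (E i)" for i
      by (cases i) (auto simp: E0 E_Suc' Int_stable_def)
    show "disjoint_family_on I UNIV" by (auto simp: disjoint_family_on_def I_def)
  qed
  then have sig: "indep_set (sigma_sets (space M) (\<Union>i\<le>m. E i)) (sigma_sets (space M) (E (Suc m)))"
    unfolding indep_set_def by (rule indep_sets_cong[THEN iffD1, rotated 2]) (auto simp: I_def split: bool.split)
  have E_sub: "E i \<subseteq> Pow (space M)" for i by (cases i) (auto simp: E_def)
  let ?F = "\<lambda>k. sigma (space M) (\<Union>i\<le>k. E i)"
  have setsF: "sets (?F k) = sigma_sets (space M) (\<Union>i\<le>k. E i)" for k
    using E_sub by (simp add: sets_measure_of UN_subset_iff)
  have spaceF: "space (?F k) = space M" for k by (rule space_measure_of_conv)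
  have X_F: "X k \<in> borel_measurable (?F k)" if "k \<le> m" for k
    using that
  proof (induction k)
    case 0
    show ?case
    proof (rule measurableI)
      fix A :: "'b set" assume "A \<in> sets borel"
      then have "X 0 -` A \<inter> space M \<in> E 0" by (auto simp: E_def)
      then show "X 0 -` A \<inter> space (?F 0) \<in> sets (?F 0)" using E_sub by (simp add: sets_measure_of)
    qed simp
  next
    case (Suc k)
    have sub: "sets (?F k) \<subseteq> sets (?F (Suc k))"
      unfolding setsF by (rule sigma_sets_mono', rule UN_mono) auto
    have [measurable]: "X k \<in> borel_measurable (?F (Suc k))"
      using Suc by (intro measurable_from_subalg[of "?F (Suc k)" "?F k"]) (simp_all add: subalgebra_def sub spaceF)
    have [measurable]: "W k \<in> borel_measurable (?F (Suc k))"
    proof (rule measurableI)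
      fix A :: "'c set" assume "A \<in> sets borel"
      then have "W k -` A \<inter> space M \<in> E (Suc k)" by (auto simp: E_def)
      then show "W k -` A \<inter> space (?F (Suc k)) \<in> sets (?F (Suc k))"
        using E_sub by (simp add: sets_measure_of UN_subset_iff) (intro sigma_sets.Basic, auto)
    qed simp
    have "(\<lambda>w. f k (X k w, W k w)) \<in> borel_measurable (?F (Suc k))"
      using Suc by (intro measurable_compose[OF _ f]) auto
    then show ?case using X[of k] Suc by (simp add: fun_eq_iff[symmetric] cong: measurable_cong)
  qed
  have "sigma_sets (space M) (\<Union>i\<le>m. E i) \<subseteq> events"
    using sig by (rule indep_setD_ev1)
  then have "sets (?F m) \<subseteq> events" using E_sub by (simp add: sets_measure_of UN_subset_iff)
  then have Xm: "X m \<in> borel_measurable M"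
    using X_F[of m] by (intro measurable_from_subalg[of M "?F m"]) (simp_all add: subalgebra_def spaceF)
  have "distr M borel (X m) \<Otimes>\<^sub>M distr M borel (W m) = distr M (borel \<Otimes>\<^sub>M borel) (\<lambda>w. (X m w, W m w))"
  proof (rule pair_measure_eqI)
    note [measurable] = Xm W_rv
    show "sigma_finite_measure (distr M borel (X m))" "sigma_finite_measure (distr M borel (W m))"
      by (simp_all add: prob_space_distr prob_space_imp_sigma_finite)
    show "sets (distr M borel (X m) \<Otimes>\<^sub>M distr M borel (W m))
        = sets (distr M (borel \<Otimes>\<^sub>M borel) (\<lambda>w. (X m w, W m w)))"
      by (simp cong: sets_pair_measure_cong)
    fix A C assume "A \<in> sets (distr M borel (X m))" "C \<in> sets (distr M borel (W m))"
    then have [measurable]: "A \<in> sets borel" "C \<in> sets borel" by simp_all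
    have "X m -` A \<inter> space M \<in> sets (?F m)" using measurable_sets[OF X_F[of m], of A] by (simp add: spaceF)
    then have "X m -` A \<inter> space M \<in> sigma_sets (space M) (\<Union>i\<le>m. E i)"
      using E_sub by (simp add: sets_measure_of UN_subset_iff)
    moreover have "W m -` C \<inter> space M \<in> sigma_sets (space M) (E (Suc m))"
      by (rule sigma_sets.Basic) (auto simp: E_Suc)
    ultimately have "prob ((X m -` A \<inter> space M) \<inter> (W m -` C \<inter> space M))
        = prob (X m -` A \<inter> space M) * prob (W m -` C \<inter> space M)"
      by (rule indep_setD[OF sig])
    moreover have "(\<lambda>w. (X m w, W m w)) -` (A \<times> C) \<inter> space M = (X m -` A \<inter> space M) \<inter> (W m -` C \<inter> space M)"
      by auto
    ultimately show "emeasure (distr M borel (X m)) A * emeasure (distr M borel (W m)) C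
        = emeasure (distr M (borel \<Otimes>\<^sub>M borel) (\<lambda>w. (X m w, W m w))) (A \<times> C)"
      by (simp add: emeasure_distr emeasure_eq_measure ennreal_mult[symmetric])
  qed
  with Xm show ?thesis by simp
qed

section \<open>Euler sequences\<close>

lemma affine_map_regular:
  fixes f :: "real ^ 'd \<Rightarrow> real ^ 'd"
  assumes "affine_map f"
  shows affine_map_measurable: "f \<in> borel_measurable borel"
    and affine_map_growth: "\<exists>K\<ge>0. \<forall>x. norm (f x) \<le> K * (1 + norm x)"
proof -
  obtain l c where l: "linear l" and f: "\<And>x. f x = l x + c" using assms by (auto simp: affine_map_def)
  have bl: "bounded_linear l" using l by (simp add: linear_conv_bounded_linear)
  have "continuous_on UNIV f"
    unfolding f using bl by (intro continuous_intros linear_continuous_on)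
  then show "f \<in> borel_measurable borel" by (rule borel_measurable_continuous_onI)
  have "norm (f x) \<le> (onorm l + norm c) * (1 + norm x)" for x
  proof -
    have "norm (f x) \<le> onorm l * norm x + norm c"
      unfolding f by (intro norm_triangle_le add_right_mono onorm bl)
    also have "\<dots> \<le> (onorm l + norm c) * (1 + norm x)"
      using onorm_pos_le[OF bl] by (simp add: algebra_simps)
    finally show ?thesis .
  qed
  then show "\<exists>K\<ge>0. \<forall>x. norm (f x) \<le> K * (1 + norm x)"
    using onorm_pos_le[OF bl] by (intro exI[of _ "onorm l + norm c"]) auto
qed

text \<open>One locale serves both sequences, with G and \<sigma> for X, K and \<theta> for Y.
  Labels interact only through laws, so independence is stated for the initial value and the path of
  one label.\<close>

locale euler_scheme = prob_space M for M :: "'w measure" +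
  fixes x\<^sub>0 :: "real ^ 'd" and h :: real and G :: "real \<Rightarrow> real \<Rightarrow> real"
    and b :: "real \<Rightarrow> real ^ 'd \<Rightarrow> real ^ 'd"
    and s :: "real \<Rightarrow> real ^ 'd \<Rightarrow> (real ^ 'd) measure \<Rightarrow> real ^ 'q ^ 'd"
    and X\<^sub>0 :: "real \<Rightarrow> 'w \<Rightarrow> real ^ 'd" and B :: "real \<Rightarrow> real \<Rightarrow> 'w \<Rightarrow> real ^ 'q" and L :: real
  assumes h: "0 < h" and G: "graphon G"
    and X0_measurable: "\<And>u. u \<in> {0..1} \<Longrightarrow> X\<^sub>0 u \<in> borel_measurable M"
    and brownian: "\<And>u. u \<in> {0..1} \<Longrightarrow> brownian_motion M (B u)"
    and indep_X0_B: "\<And>u. u \<in> {0..1} \<Longrightarrow>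
      indep_set (sets (vimage_algebra (space M) (X\<^sub>0 u) borel))
        (sets (vimage_algebra (space M) (path (B u)) (\<Pi>\<^sub>M t\<in>{0..}. borel)))"
    and initial: "initial_regular M X\<^sub>0"
    and affine: "\<And>m. affine_map (drift_step h b m)"
    and L_nonneg: "0 \<le> L"
    and lipschitz: "\<And>t x y \<kappa> \<nu>. 0 \<le> t \<Longrightarrow> \<kappa> \<in> finite_measures2 \<Longrightarrow> \<nu> \<in> finite_measures2 \<Longrightarrow>
      norm (s t x \<kappa> - s t y \<nu>) \<le> L * (norm (x - y) + wop2 x\<^sub>0 \<kappa> \<nu>)"
begin

abbreviation X :: "nat \<Rightarrow> real \<Rightarrow> 'w \<Rightarrow> real ^ 'd" where
  "X \<equiv> euler M h G b s X\<^sub>0 B"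

text \<open>The constant depends on h alone, so the instances for X and Y share the same noise law
  and one isotropic measure serves the comparison.\<close>

definition noise :: "(real ^ 'q) measure" where
  "noise = distr (density lborel (\<lambda>z. ennreal (gaussian_density h z))) borel ((*\<^sub>R) (1 / sqrt h))"

definition increment :: "real \<Rightarrow> nat \<Rightarrow> 'w \<Rightarrow> real ^ 'q" where
  "increment u k \<omega> = B u (real (Suc k) * h) \<omega> - B u (real k * h) \<omega>"

lemma gauss_step_increment: "gauss_step h (B u) (Suc k) \<omega> = (1 / sqrt h) *\<^sub>R increment u k \<omega>"
  by (simp add: gauss_step_def increment_def)

lemma increment_distr:
  assumes "u \<in> {0..1}"
  shows "distr M lborel (increment u k) = density lborel (\<lambda>z. ennreal (gaussian_density h z))"
    and "increment u k \<in> borel_measurable M"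
proof -
  have "real k * h < real (Suc k) * h" using h by simp
  moreover have "0 \<le> real k * h" using h by simp
  ultimately have "distributed M lborel (increment u k)
      (\<lambda>z. ennreal (gaussian_density (real (Suc k) * h - real k * h) z))"
    using brownian[OF assms] unfolding brownian_motion_def increment_def by blast
  moreover have "real (Suc k) * h - real k * h = h" by (simp add: algebra_simps)
  ultimately have "distributed M lborel (increment u k) (\<lambda>z. ennreal (gaussian_density h z))" by simp
  then show "distr M lborel (increment u k) = density lborel (\<lambda>z. ennreal (gaussian_density h z))"
    "increment u k \<in> borel_measurable M"
    by (simp_all add: distributed_def)
qed

lemma isotropic_noise: "isotropic_prob noise"
proof -
  \<comment> \<open>That the Gaussian density has total mass 1 is read off from the increment at
    label 0, whose law it is.\<close>
  have "prob_space (distr M lborel (increment 0 0))"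
    using increment_distr(2)[of 0 0] by (intro prob_space_distr) simp
  then show ?thesis
    unfolding noise_def using increment_distr(1)[of 0 0] h by (intro isotropic_prob_gaussian) simp_all
qed

lemma law_gauss_step:
  assumes "u \<in> {0..1}"
  shows "distr M borel (gauss_step h (B u) (Suc k)) = noise"
proof -
  have [measurable]: "increment u k \<in> borel_measurable M" using assms by (rule increment_distr)
  have "distr M borel (gauss_step h (B u) (Suc k)) = distr (distr M lborel (increment u k)) borel ((*\<^sub>R) (1 / sqrt h))"
    by (simp add: distr_distr comp_def gauss_step_increment[abs_def])
  then show ?thesis by (simp add: increment_distr(1)[OF assms] noise_def)
qed

abbreviation coefficient :: "real \<Rightarrow> nat \<Rightarrow> real ^ 'd \<Rightarrow> real ^ 'q ^ 'd" where
  "coefficient u m x \<equiv> diffusion_step h G s u m x (\<lambda>v. law M (X m v))"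

lemma diffusion_step_regular:
  assumes "\<mu> \<in> measure_families"
  shows "(\<lambda>(u, x). diffusion_step h G s u m x \<mu>) \<in> borel_measurable (unit_interval \<Otimes>\<^sub>M borel)"
    and "\<exists>K\<ge>0. \<forall>u\<in>{0..1}. \<forall>x. norm (diffusion_step h G s u m x \<mu>) \<le> K * (1 + norm x)"
    and "u \<in> {0..1} \<Longrightarrow> (\<lambda>x. diffusion_step h G s u m x \<mu>) \<in> borel_measurable borel"
proof -
  interpret lipschitz_coefficient \<mu> x\<^sub>0 "s (real m * h)" L
    using assms L_nonneg lipschitz h by unfold_locales auto
  have "(\<lambda>p. sqrt h *\<^sub>R (\<lambda>(u, x). s (real m * h) x (graphon_mix G \<mu> u)) p) \<in> borel_measurable (unit_interval \<Otimes>\<^sub>M borel)"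
    by (intro borel_measurable_scaleR borel_measurable_const coefficient_measurable G)
  then show joint: "(\<lambda>(u, x). diffusion_step h G s u m x \<mu>) \<in> borel_measurable (unit_interval \<Otimes>\<^sub>M borel)"
    by (simp add: diffusion_step_def split_beta')
  obtain K where K: "0 \<le> K" "\<And>u x. u \<in> {0..1} \<Longrightarrow> norm (s (real m * h) x (graphon_mix G \<mu> u)) \<le> K * (1 + norm x)"
    using coefficient_growth[OF G] by blast
  have "norm (diffusion_step h G s u m x \<mu>) \<le> (sqrt h * K) * (1 + norm x)" if "u \<in> {0..1}" for u x
    using mult_left_mono[OF K(2)[OF that, of x], of "sqrt h"] h by (simp add: diffusion_step_def mult.assoc)
  then show "\<exists>K\<ge>0. \<forall>u\<in>{0..1}. \<forall>x. norm (diffusion_step h G s u m x \<mu>) \<le> K * (1 + norm x)"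
    using K(1) h by (intro exI[of _ "sqrt h * K"]) auto
  show "(\<lambda>x. diffusion_step h G s u m x \<mu>) \<in> borel_measurable borel" if "u \<in> {0..1}"
  proof -
    have "(\<lambda>x. (\<lambda>(u, x). diffusion_step h G s u m x \<mu>) (u, x)) \<in> borel_measurable borel"
      using that by (intro measurable_compose[OF _ joint] measurable_Pair) auto
    then show ?thesis by simp
  qed
qed

text \<open>The family \<mu> in the coefficient and the family \<kappa> of starting laws are
  separate because the hybrid step uses the coefficient at the laws of X on the laws of Y.\<close>

lemma step_law_diffusion_families:
  assumes "\<mu> \<in> measure_families" "\<kappa> \<in> measure_families"
    and "\<And>u. u \<in> {0..1} \<Longrightarrow> \<nu> u = step_law noise (\<kappa> u) (drift_step h b m) (\<lambda>x. diffusion_step h G s u m x \<mu>)"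
  shows "\<nu> \<in> measure_families"
proof -
  obtain K K' where K: "0 \<le> K" "\<forall>u\<in>{0..1}. \<forall>x. norm (diffusion_step h G s u m x \<mu>) \<le> K * (1 + norm x)"
    and K': "0 \<le> K'" "\<forall>x. norm (drift_step h b m x) \<le> K' * (1 + norm x)"
    using diffusion_step_regular(2)[OF assms(1)] affine_map_growth[OF affine] by blast
  show ?thesis
  proof (rule step_law_measure_families[OF isotropic_noise assms(2) affine_map_measurable[OF affine] _
        diffusion_step_regular(1)[OF assms(1)] _ assms(3)])
    show "norm (drift_step h b m x) \<le> max K K' * (1 + norm x)" for x
      using K'(2) by (meson max.cobounded2 mult_right_mono norm_ge_zero add_nonneg_nonneg zero_le_one order_trans)
    show "norm (diffusion_step h G s u m x \<mu>) \<le> max K K' * (1 + norm x)" if "u \<in> {0..1}" for u x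
      using K(2) that by (meson max.cobounded1 mult_right_mono norm_ge_zero add_nonneg_nonneg zero_le_one order_trans)
  qed
qed

text \<open>With the laws regarded as fixed, the sequence at label u is a measurable recursion in
  the increments, so its current state is independent of the next increment. All k \<le> m are
  required because every earlier coefficient must be measurable too.\<close>

lemma euler_step:
  assumes fam: "\<And>k. k \<le> m \<Longrightarrow> (\<lambda>v. law M (X k v)) \<in> measure_families" and u: "u \<in> {0..1}"
  shows "law M (X (Suc m) u) = step_law noise (law M (X m u)) (drift_step h b m) (coefficient u m)"
proof -
  let ?f = "\<lambda>k (x, w). drift_step h b k x + coefficient u k x *v ((1 / sqrt h) *\<^sub>R w)"
  interpret noise: isotropic_prob noise by (rule isotropic_noise)
  have step: "(\<lambda>(x, z). drift_step h b k x + coefficient u k x *v z) \<in> borel_measurable (borel \<Otimes>\<^sub>M borel)" if "k \<le> m" for k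
    by (intro noise.step_function_measurable affine_map_measurable affine diffusion_step_regular(3) fam that u)
  have f_meas: "?f k \<in> borel_measurable (borel \<Otimes>\<^sub>M borel)" if "k < m" for k
  proof -
    have "(\<lambda>p. (fst p, (1 / sqrt h) *\<^sub>R snd p)) \<in> borel \<Otimes>\<^sub>M borel \<rightarrow>\<^sub>M (borel :: (real ^ 'd) measure) \<Otimes>\<^sub>M (borel :: (real ^ 'q) measure)"
      by measurable
    from measurable_compose[OF this step[of k]] that show ?thesis by (simp add: split_beta')
  qed
  let ?N = "vimage_algebra (space M) (path (B u)) (\<Pi>\<^sub>M t\<in>{0..}. borel)"
  have inc_N: "increment u k \<in> borel_measurable ?N" for k
  proof -
    have "path (B u) \<in> space M \<rightarrow> space (\<Pi>\<^sub>M t\<in>{0..}. borel)"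
      by (auto simp: path_def space_PiM)
    then have P: "path (B u) \<in> ?N \<rightarrow>\<^sub>M (\<Pi>\<^sub>M t\<in>{0..}. borel)"
      by (rule measurable_vimage_algebra1)
    have "(\<lambda>\<omega>. path (B u) \<omega> t) \<in> borel_measurable ?N" if "0 \<le> t" for t
      using that by (intro measurable_compose[OF P measurable_component_singleton]) simp
    then have "B u t \<in> borel_measurable ?N" if "0 \<le> t" for t
      using that by (simp add: path_def)
    then show ?thesis
      using h unfolding increment_def by (intro borel_measurable_diff) auto
  qed
  have inc_indep: "indep_vars (\<lambda>_. borel) (increment u) {..<n}" for n
  proof -
    have inc: "indep_vars (\<lambda>_. borel) (\<lambda>k \<omega>. B u (\<tau> (Suc k)) \<omega> - B u (\<tau> k) \<omega>) {..<n}"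
      if "0 \<le> \<tau> 0" "strict_mono_on {..n} \<tau>" for \<tau> :: "nat \<Rightarrow> real"
      using brownian[OF u] that unfolding brownian_motion_def by blast
    have "strict_mono_on {..n} (\<lambda>k. real k * h)" using h by (auto simp: strict_mono_on_def)
    then have "indep_vars (\<lambda>_. borel) (\<lambda>k \<omega>. B u (real (Suc k) * h) \<omega> - B u (real k * h) \<omega>) {..<n}"
      using inc[of "\<lambda>k. real k * h"] by simp
    then show ?thesis unfolding increment_def .
  qed
  have "X m u \<in> borel_measurable M \<and>
      distr M (borel \<Otimes>\<^sub>M borel) (\<lambda>\<omega>. (X m u \<omega>, increment u m \<omega>))
        = distr M borel (X m u) \<Otimes>\<^sub>M distr M borel (increment u m)"
  proof (rule recursion_indep[where X = "\<lambda>k. X k u" and f = ?f])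
    show "X 0 u \<in> borel_measurable M" using X0_measurable[OF u] by simp
    show "indep_set (sets (vimage_algebra (space M) (X 0 u) borel)) (sets ?N)"
      using indep_X0_B[OF u] by simp
    show "space ?N = space M" by simp
    show "increment u k \<in> borel_measurable ?N" for k by (rule inc_N)
    show "indep_vars (\<lambda>_. borel) (increment u) {..<n}" for n by (rule inc_indep)
    show "X (Suc k) u \<omega> = ?f k (X k u \<omega>, increment u k \<omega>)" for k \<omega>
      by (simp add: gauss_step_increment)
    show "?f k \<in> borel_measurable (borel \<Otimes>\<^sub>M borel)" if "k < m" for k using that by (rule f_meas)
  qed
  then have Xm [measurable]: "X m u \<in> borel_measurable M"
    and joint: "distr M (borel \<Otimes>\<^sub>M borel) (\<lambda>\<omega>. (X m u \<omega>, increment u m \<omega>))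
        = distr M borel (X m u) \<Otimes>\<^sub>M distr M borel (increment u m)" by auto
  have [measurable]: "increment u m \<in> borel_measurable M" using u by (rule increment_distr)
  let ?Z = "gauss_step h (B u) (Suc m)"
  have Z: "?Z = (\<lambda>\<omega>. (1 / sqrt h) *\<^sub>R increment u m \<omega>)" by (simp add: fun_eq_iff gauss_step_increment)
  have [measurable]: "?Z \<in> borel_measurable M" unfolding Z by measurable
  have "distr M (borel \<Otimes>\<^sub>M borel) (\<lambda>\<omega>. (X m u \<omega>, ?Z \<omega>))
      = distr (distr M (borel \<Otimes>\<^sub>M borel) (\<lambda>\<omega>. (X m u \<omega>, increment u m \<omega>))) (borel \<Otimes>\<^sub>M borel) (\<lambda>(x, w). (x, (1 / sqrt h) *\<^sub>R w))"
    by (simp add: distr_distr comp_def Z)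
  also have "\<dots> = distr (distr M borel (X m u)) borel (\<lambda>x. x) \<Otimes>\<^sub>M distr (distr M borel (increment u m)) borel ((*\<^sub>R) (1 / sqrt h))"
    unfolding joint
    by (rule pair_measure_distr[symmetric]) (auto intro!: prob_space_imp_sigma_finite prob_space.prob_space_distr prob_space_distr)
  also have "\<dots> = law M (X m u) \<Otimes>\<^sub>M noise"
    by (simp add: law_def distr_distr comp_def law_gauss_step[OF u, of m, unfolded Z])
  finally have pair: "distr M (borel \<Otimes>\<^sub>M borel) (\<lambda>\<omega>. (X m u \<omega>, ?Z \<omega>)) = law M (X m u) \<Otimes>\<^sub>M noise" .
  have "law M (X (Suc m) u)
      = distr (distr M (borel \<Otimes>\<^sub>M borel) (\<lambda>\<omega>. (X m u \<omega>, ?Z \<omega>))) borel (\<lambda>(x, z). drift_step h b m x + coefficient u m x *v z)"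
    unfolding law_def by (subst distr_distr) (use step[OF order_refl] in \<open>simp_all add: comp_def law_def\<close>)
  then show ?thesis unfolding pair step_law_def .
qed

lemma initial_families: "(\<lambda>v. law M (X\<^sub>0 v)) \<in> measure_families"
proof (rule measure_familiesI)
  show "(\<lambda>v. law M (X\<^sub>0 v)) \<in> unit_interval \<rightarrow>\<^sub>M prob_algebra borel"
    using initial by (simp only: initial_regular_def measurable_unit_interval_borel)
  show "(SUP u\<in>{0..1}. \<integral>\<^sup>+ \<omega>. ennreal ((norm (X\<^sub>0 u \<omega>))\<^sup>2) \<partial>M) < \<infinity>"
    using initial by (simp add: initial_regular_def)
  fix u :: real assume u: "u \<in> {0..1}"
  have "(\<integral>\<^sup>+ x. ennreal ((norm x)\<^sup>2) \<partial>(law M (X\<^sub>0 u))) = (\<integral>\<^sup>+ \<omega>. ennreal ((norm (X\<^sub>0 u \<omega>))\<^sup>2) \<partial>M)"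
    unfolding law_def using X0_measurable[OF u] by (intro nn_integral_distr) auto
  also have "\<dots> \<le> (SUP u\<in>{0..1}. \<integral>\<^sup>+ \<omega>. ennreal ((norm (X\<^sub>0 u \<omega>))\<^sup>2) \<partial>M)"
    using u by (rule SUP_upper)
  finally show "(\<integral>\<^sup>+ x. ennreal ((norm x)\<^sup>2) \<partial>(law M (X\<^sub>0 u)))
      \<le> (SUP u\<in>{0..1}. \<integral>\<^sup>+ \<omega>. ennreal ((norm (X\<^sub>0 u \<omega>))\<^sup>2) \<partial>M)" .
qed

text \<open>Strong induction, since one step presupposes the family property at all earlier
  times.\<close>

lemma euler_families: "(\<lambda>v. law M (X m v)) \<in> measure_families"
proof (induction m rule: less_induct)
  case (less m)
  show ?case
  proof (cases m)
    case 0
    then show ?thesis using initial_families by simp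
  next
    case (Suc k)
    have fam: "(\<lambda>v. law M (X j v)) \<in> measure_families" if "j \<le> k" for j
      using that Suc by (intro less) simp
    have "law M (X m u) = step_law noise (law M (X k u)) (drift_step h b k) (coefficient u k)" if "u \<in> {0..1}" for u
      unfolding Suc using fam that by (rule euler_step)
    then show ?thesis
      by (rule step_law_diffusion_families[OF fam[OF order_refl] fam[OF order_refl]])
  qed
qed

lemma law_euler_Suc:
  "u \<in> {0..1} \<Longrightarrow> law M (X (Suc m) u) = step_law noise (law M (X m u)) (drift_step h b m) (coefficient u m)"
  using euler_families by (intro euler_step)

end

section \<open>Comparison of the two sequences\<close>

lemma measure_families_prob_measures1: "\<mu> \<in> measure_families \<Longrightarrow> u \<in> {0..1} \<Longrightarrow> \<mu> u \<in> prob_measures1"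
  by (intro prob_measures2_subset) (auto simp: measure_families_def)

lemma indep_source_events:
  assumes "prob_space M" "prob_space.indep_sets M E I" "i \<in> I" "j \<in> I" "i \<noteq> j"
  shows "prob_space.indep_set M (E i) (E j)"
proof -
  interpret prob_space M by fact
  show ?thesis
    unfolding indep_sets2_eq
  proof (intro conjI ballI)
    show "E i \<subseteq> events" "E j \<subseteq> events" using assms(2-4) by (auto simp: indep_sets_def)
    fix a c assume "a \<in> E i" "c \<in> E j"
    then show "prob (a \<inter> c) = prob a * prob c"
      using indep_setsD[OF assms(2), of "{i, j}" "\<lambda>k. if k = i then a else c"] assms(3-5)
      by (auto simp: inf_commute)
  qed
qed

lemma norm_le_of_onorm_le:
  fixes A :: "real ^ 'q ^ 'd"
  assumes "onorm ((*v) A) \<le> L * r"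
  shows "norm A \<le> (real CARD('d) * real CARD('q) * L) * r"
proof -
  have "norm A \<le> real CARD('d) * real CARD('q) * onorm ((*v) A)" by (rule norm_matrix_le_onorm)
  also have "\<dots> \<le> real CARD('d) * real CARD('q) * (L * r)" using assms by (intro mult_left_mono) auto
  finally show ?thesis by (simp add: mult.assoc)
qed

theorem proposition3p3:
  fixes x\<^sub>0 :: "real ^ 'd"
    and G K :: "real \<Rightarrow> real \<Rightarrow> real"
    and b :: "real \<Rightarrow> real ^ 'd \<Rightarrow> real ^ 'd"
    and \<sigma> \<theta> :: "real \<Rightarrow> real ^ 'd \<Rightarrow> (real ^ 'd) measure \<Rightarrow> real ^ 'q ^ 'd"
    and M :: "'w measure" and F :: "real \<Rightarrow> 'w measure"
    and X\<^sub>0 Y\<^sub>0 :: "real \<Rightarrow> 'w \<Rightarrow> real ^ 'd"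
    and B :: "real \<Rightarrow> real \<Rightarrow> 'w \<Rightarrow> real ^ 'q"
    and h :: real
  assumes "0 < h"
    and "graphon G" and "graphon K"
    and "random_data M F X\<^sub>0 Y\<^sub>0 B"
    and "RD x\<^sub>0 M G K b \<sigma> \<theta> X\<^sub>0 Y\<^sub>0"
    and "\<And>m. affine_map (drift_step h b m)"
    and "\<And>m u x y r \<mu>. \<lbrakk>u \<in> {0..1}; r \<in> {0..1}; \<mu> \<in> measure_families\<rbrakk> \<Longrightarrow>
           diffusion_step h G \<sigma> u m (r *\<^sub>R x + (1 - r) *\<^sub>R y) \<mu>
             \<preceq>\<^sub>m r *\<^sub>R diffusion_step h G \<sigma> u m x \<mu> + (1 - r) *\<^sub>R diffusion_step h G \<sigma> u m y \<mu>"
    and "\<And>m u x \<mu> \<nu>. \<lbrakk>u \<in> {0..1}; \<mu> \<in> measure_families; \<nu> \<in> measure_families;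
             \<forall>v\<in>{0..1}. \<mu> v \<preceq>\<^sub>c\<^sub>v \<nu> v\<rbrakk> \<Longrightarrow>
           diffusion_step h G \<sigma> u m x \<mu> \<preceq>\<^sub>m diffusion_step h G \<sigma> u m x \<nu>"
    and "\<And>m u x \<mu>. \<lbrakk>u \<in> {0..1}; \<mu> \<in> measure_families\<rbrakk> \<Longrightarrow>
           diffusion_step h G \<sigma> u m x \<mu> \<preceq>\<^sub>m diffusion_step h K \<theta> u m x \<mu>"
    and "\<And>u. u \<in> {0..1} \<Longrightarrow>
           law M (euler M h G b \<sigma> X\<^sub>0 B 0 u) \<preceq>\<^sub>c\<^sub>v law M (euler M h K b \<theta> Y\<^sub>0 B 0 u)"
  shows "\<forall>m. \<forall>u\<in>{0..1}.
           law M (euler M h G b \<sigma> X\<^sub>0 B m u) \<preceq>\<^sub>c\<^sub>v law M (euler M h K b \<theta> Y\<^sub>0 B m u)"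
proof -
  have prob: "prob_space M"
    and data: "\<And>u. u \<in> {0..1} \<Longrightarrow> X\<^sub>0 u \<in> borel_measurable M \<and> Y\<^sub>0 u \<in> borel_measurable M \<and> brownian_motion M (B u)"
    and indep: "prob_space.indep_sets M (source_events M X\<^sub>0 Y\<^sub>0 B)
       (Init_X ` {0..1} \<union> Init_Y ` {0..1} \<union> Noise ` {0..1})"
    using assms(4) by (auto simp: random_data_def filtered_prob_space_def)
  obtain L where L: "0 < L" and lip: "space_lipschitz x\<^sub>0 b \<sigma> \<theta> L"
    and init: "initial_regular M X\<^sub>0" "initial_regular M Y\<^sub>0"
    using assms(5) by (auto simp: RD_def)
  \<comment> \<open>The dimensional factor turns the operator-norm Lipschitz condition into the
    entrywise one of \<open>euler_scheme\<close>.\<close>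
  let ?L = "real CARD('d) * real CARD('q) * L"
  have onorm_le: "onorm ((*v) (\<sigma> t x \<kappa> - \<sigma> t y \<nu>)) \<le> L * (norm (x - y) + wop2 x\<^sub>0 \<kappa> \<nu>)"
      "onorm ((*v) (\<theta> t x \<kappa> - \<theta> t y \<nu>)) \<le> L * (norm (x - y) + wop2 x\<^sub>0 \<kappa> \<nu>)"
    if "0 \<le> t" "\<kappa> \<in> finite_measures2" "\<nu> \<in> finite_measures2" for t x y \<kappa> \<nu>
    using lip that by (auto simp: space_lipschitz_def)
  have X: "euler_scheme M x\<^sub>0 h G b \<sigma> X\<^sub>0 B ?L"
    using indep_source_events[OF prob indep, of "Init_X _" "Noise _"] L
    by (intro euler_scheme.intro euler_scheme_axioms.intro prob assms(1,2,6) init norm_le_of_onorm_le onorm_le)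
      (auto simp: data source_events_def)
  have Y: "euler_scheme M x\<^sub>0 h K b \<theta> Y\<^sub>0 B ?L"
    using indep_source_events[OF prob indep, of "Init_Y _" "Noise _"] L
    by (intro euler_scheme.intro euler_scheme_axioms.intro prob assms(1,3,6) init norm_le_of_onorm_le onorm_le)
      (auto simp: data source_events_def)
  interpret X: euler_scheme M x\<^sub>0 h G b \<sigma> X\<^sub>0 B ?L by (rule X)
  interpret Y: euler_scheme M x\<^sub>0 h K b \<theta> Y\<^sub>0 B ?L by (rule Y)
  interpret noise: isotropic_prob X.noise by (rule X.isotropic_noise)
  \<comment> \<open>All labels are treated together: monotonicity in the measure argument asks for
    the order at every v.\<close>
  have "\<forall>u\<in>{0..1}. law M (X.X m u) \<preceq>\<^sub>c\<^sub>v law M (Y.X m u)" for m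
  proof (induction m)
    case 0
    then show ?case using assms(10) by blast
  next
    case (Suc m)
    show ?case
    proof
      fix u :: real assume u: "u \<in> {0..1}"
      let ?\<mu> = "\<lambda>v. law M (X.X m v)" and ?\<nu> = "\<lambda>v. law M (Y.X m v)"
      have "step_law X.noise (?\<mu> u) (drift_step h b m) (X.coefficient u m)
          \<preceq>\<^sub>c\<^sub>v step_law X.noise (?\<nu> u) (drift_step h b m) (Y.coefficient u m)"
      proof (rule noise.step_law_convex_order)
        show "?\<mu> u \<preceq>\<^sub>c\<^sub>v ?\<nu> u" using Suc u by blast
        show "affine_map (drift_step h b m)" "drift_step h b m \<in> borel_measurable borel"
          using assms(6) affine_map_measurable by blast+
        show "X.coefficient u m (r *\<^sub>R x + (1 - r) *\<^sub>R y) \<preceq>\<^sub>m r *\<^sub>R X.coefficient u m x + (1 - r) *\<^sub>R X.coefficient u m y"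
          if "r \<in> {0..1}" for x y r
          using assms(7)[OF u that X.euler_families] .
        \<comment> \<open>The intermediate matrix is \<sigma> at the laws of Y: monotonicity in the
          measure on one side, domination by \<theta> on the other.\<close>
        show "X.coefficient u m x \<preceq>\<^sub>m Y.coefficient u m x" for x
          using assms(8)[OF u X.euler_families Y.euler_families Suc] assms(9)[OF u Y.euler_families]
          by (rule matrix_order_trans)
        show "X.coefficient u m \<in> borel_measurable borel" "Y.coefficient u m \<in> borel_measurable borel"
          using X.diffusion_step_regular(3)[OF X.euler_families u] Y.diffusion_step_regular(3)[OF Y.euler_families u]
          by blast+
        show "step_law X.noise (?\<mu> u) (drift_step h b m) (X.coefficient u m) \<in> prob_measures1"
          using measure_families_prob_measures1[OF X.euler_families u, of "Suc m"] unfolding X.law_euler_Suc[OF u] .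
        \<comment> \<open>This is the hybrid law, which belongs to neither sequence; its moment
          comes from stability of the families under any such step.\<close>
        show "step_law X.noise (?\<nu> u) (drift_step h b m) (X.coefficient u m) \<in> prob_measures1"
          using measure_families_prob_measures1[OF X.step_law_diffusion_families[OF X.euler_families Y.euler_families refl] u] .
        show "step_law X.noise (?\<nu> u) (drift_step h b m) (Y.coefficient u m) \<in> prob_measures1"
          using measure_families_prob_measures1[OF Y.euler_families u, of "Suc m"] unfolding Y.law_euler_Suc[OF u] .
      qed
      then show "law M (X.X (Suc m) u) \<preceq>\<^sub>c\<^sub>v law M (Y.X (Suc m) u)"
        unfolding X.law_euler_Suc[OF u] Y.law_euler_Suc[OF u] .
    qed
  qed
  then show ?thesis by blast
qed

end
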